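(* Let $z(t,u)$ be the solution of the Cauchy problem for $$z_t-\Big(g(z)\exp\int_u^\infty g(z(t,v))\,dv\Big)_u=\mu ,\qquad z\ge0,$$ whose initial data satisfies: $z(0,\cdot)\in BV$, $z(0,\cdot)-1\in L^1(\mathbb R)$, $\lim_{u\to\pm\infty}z(0,u)=1$, $0\le z(0,u)\le1$, and, for some $u_a\in\mathbb R$, $z(0,u)=1$ for $u<u_a$ while $u\mapsto z(0,u)$ is non-decreasing on $[u_a,\infty)$. Let $D=\|z(0,\cdot)-1\|_{L^1}>0$ be the total drop, let $\zeta(t,q)$, $-D\le q\le 0$, be the function obtained from $z$ by using the drop $q$ as independent variable, and assume that $\zeta$ has the structural properties (S1)–(S4) listed in the context. Let $Z(q)$, $-D\le q\le 0$, be the stationary traveling wave profile with total drop $D$. Then there is a constant $C$ such that for every $\varepsilon>0$ there exists a finite $T^\varepsilon$ with $$\|\zeta(t,\cdot)-Z(\cdot)\|_{L^1(-D,0)}\le C\varepsilon\qquad\text{for all }t\ge T^\varepsilon ,$$ where $C$ is independent of $\varepsilon$.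
   Context: Data. $g\in\mathcal C^2([0,\infty))$ satisfies $g(1)=0$, $g(0)\ge0$, $g''<0$. Put $h(z)=g(z)/(1-z)$ for $z\ne1$, $h(1)=-g'(1)$; $h$ is $\mathcal C^1$ with $h'>0$. Put $\psi(s)=(e^{h(0)s}-1)/s$ for $s>0$, $\psi(0)=h(0)$, and $F(\zeta;q)=\exp\int_q^0h(\zeta(t,s))\,ds$. Solutions. The measure $\mu$ projects onto the cone of non-negative functions; "the solution" is the entropy weak solution given by the $L^1$-Lipschitz semigroup obtained as limit of front tracking approximations. One has $z(t,\cdot)-1\in L^1$, $0\le z\le1$, and $\|z(t,\cdot)-1\|_{L^1}=D$ for all $t$. The drop function is $q(t,u)=\int_u^{+\infty}(z(t,v)-1)\,dv\in[-D,0]$; for each $t$, $z(t,\cdot)=1$ outside an interval and $z(t,\cdot)<1$ inside it, so $u\mapsto q(t,u)$ is invertible there with inverse $\tilde u(t,q)$, and $\zeta(t,q)=z(t,\tilde u(t,q))$ for $-D<q<0$, with $\zeta(t,-D)=\zeta(t,0)=1$. Structural properties assumed for $\zeta$: (S1) there is a stationary downward jump at $q=-D$, with $\zeta(t,-D-)=1$, for all $t\ge0$; (S2) there is at most one shock (interval where $\zeta=0$), with left front at $q=-D$ and right front at some $q^+(t)\in[-D,0]$; (S3) for every $t>0$, $\zeta(t,\cdot)$ is locally Lipschitz and strictly increasing on $(\tilde q(t),0]$, where $\tilde q(t)=q^+(t)$ if there is a shock and $\tilde q(t)=-D$ otherwise; (S4) the total variation of $q\mapsto\zeta(t,q)$ is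 at most $2$ for all $t\ge0$. Evolution laws of the solution in these variables: (E1) on the part $q>\tilde q(t)$ (where $\zeta>0$), $\zeta$ solves $\zeta_t-(1-\zeta)^2\big(h'(\zeta)\zeta_q-h^2(\zeta)\big)F(\zeta;q)=0$, i.e. along characteristics $\dot q=-(1-\zeta)^2h'(\zeta)F(\zeta;q)$ and $\dot\zeta=-(1-\zeta)^2h^2(\zeta)F(\zeta;q)$; (E2) if a shock of size $\Delta=q^+(t)+D$ is present and $z^+=\zeta(t,q^+(t)+)>0$, then $\dot q^+=F(\zeta;q^+)\frac{1-z^+}{z^+}\,[\psi(\Delta)-h(z^+)]$; (E3) the right front satisfies the Lax admissibility condition $h(z^+)-z^+(1-z^+)h'(z^+)\le\psi(\Delta)$. The profile $Z$. Let $\phi(q)=h^{-1}\!\big(\tfrac{h(1)}{1-h(1)q}\big)$ for $-D_{hk}\le q\le0$ and $\phi(q)=0$ for $q<-D_{hk}$, where $D_{hk}=\frac1{h(0)}-\frac1{h(1)}$ if $h(0)>0$ and $D_{hk}=+\infty$ if $h(0)=0$. If $h(0)>0$, let $D_{ss}$ be the unique solution of $\psi(D_{ss})=h(1)$; one has $D_{hk}<D_{ss}$. Then $Z(-D)=Z(0)=1$ and: - if $D\le D_{hk}$: $Z(q)=\phi(q)$ for $-D<q\le0$; - if $D_{hk}<D<D_{ss}$: $Z(q)=0$ for $-D<q\le q^+$ and $Z(q)=\phi(q)$ for $q^+<q\le0$, where $q^+\in(-D_{hk},0)$ is the unique point with $h(\phi(q^+))=\psi(q^++D)$; - if $D\ge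 D_{ss}$: $Z(q)=0$ for $-D<q<0$. *)

theory Defs
  imports "HOL-Analysis.Analysis"
begin

section \<open>Erosion function and derived functions\<close>

definition erosion_function :: "(real \<Rightarrow> real) \<Rightarrow> bool" where
  "erosion_function g \<longleftrightarrow>
     (\<exists>g' g''.
        (\<forall>z\<ge>0. (g has_real_derivative g' z) (at z within {0..}) \<and>
               (g' has_real_derivative g'' z) (at z within {0..}) \<and>
               g'' z < 0) \<and>
        continuous_on {0..} g'') \<and>
     g 1 = 0 \<and> g 0 \<ge> 0"

definition hfun :: "(real \<Rightarrow> real) \<Rightarrow> real \<Rightarrow> real" where
  "hfun g z = (if z = 1 then - deriv g 1 else g z / (1 - z))"

definition psi :: "(real \<Rightarrow> real) \<Rightarrow> real \<Rightarrow> real" where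
  "psi g s = (if s = 0 then hfun g 0 else (exp (hfun g 0 * s) - 1) / s)"

text \<open>The nonlocal factor $F(f;q)$, used for $q \le 0$.\<close>

definition Ffun :: "(real \<Rightarrow> real) \<Rightarrow> (real \<Rightarrow> real) \<Rightarrow> real \<Rightarrow> real" where
  "Ffun g f q = exp (LINT s:{q..0}|lborel. hfun g (f s))"

definition total_variation :: "(real \<Rightarrow> real) \<Rightarrow> real set \<Rightarrow> ereal" where
  "total_variation f S =
     (SUP xs \<in> {xs. sorted xs \<and> set xs \<subseteq> S}.
        ereal (\<Sum>i<length xs - 1. \<bar>f (xs ! Suc i) - f (xs ! i)\<bar>))"

section \<open>The equation in the physical variables\<close>

definition flux :: "(real \<Rightarrow> real) \<Rightarrow> (real \<Rightarrow> real \<Rightarrow> real) \<Rightarrow> real \<Rightarrow> real \<Rightarrow> real" where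
  "flux g z t u = g (z t u) * exp (LINT v:{u..}|lborel. g (z t v))"

text \<open>
  The measure \<open>\<mu>\<close> projects onto the cone \<open>z \<ge> 0\<close> without changing the total drop. If
  \<open>x(t, \<cdot>)\<close> is a primitive of \<open>z(t, \<cdot>)\<close>, then \<open>z \<ge> 0\<close> says that \<open>x\<close> is non-decreasing; the
  unconstrained evolution is \<open>x_t = flux\<close>, and the projection onto the non-decreasing functions
  replaces the velocity on each maximal interval where \<open>x\<close> is constant (that is, \<open>z = 0\<close>) by
  its mean there. On such an interval \<open>[a, b]\<close> of length \<open>\<Delta>\<close> the mean is
  \<open>psi g \<Delta> * exp (\<integral>_b^\<infinity> g(z))\<close>, and the Rankine-Hugoniot conditions at \<open>a\<close> and \<open>b\<close>
  yield the stationary left front and the law for the right front (\<open>front_law\<close> below).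
  Thus \<open>\<mu>\<close> is the distributional \<open>u\<close>-derivative of \<open>projected_flux - flux\<close>.
\<close>

definition plateau :: "(real \<Rightarrow> real \<Rightarrow> real) \<Rightarrow> real \<Rightarrow> real \<Rightarrow> real set" where
  "plateau z t u = connected_component_set {v. z t v = 0} u"

definition projected_flux ::
    "(real \<Rightarrow> real) \<Rightarrow> (real \<Rightarrow> real \<Rightarrow> real) \<Rightarrow> real \<Rightarrow> real \<Rightarrow> real" where
  "projected_flux g z t u =
     (if z t u = 0 \<and> measure lborel (plateau z t u) > 0
      then (LINT v:plateau z t u|lborel. flux g z t v) / measure lborel (plateau z t u)
      else flux g z t u)"

definition test_function ::
    "(real \<Rightarrow> real \<Rightarrow> real) \<Rightarrow> (real \<Rightarrow> real \<Rightarrow> real) \<Rightarrow> (real \<Rightarrow> real \<Rightarrow> real) \<Rightarrow> bool" where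
  "test_function w wt wu \<longleftrightarrow>
     (\<forall>t u. ((\<lambda>s. w s u) has_real_derivative wt t u) (at t) \<and>
            ((\<lambda>v. w t v) has_real_derivative wu t u) (at u)) \<and>
     continuous_on UNIV (\<lambda>(t, u). wt t u) \<and>
     continuous_on UNIV (\<lambda>(t, u). wu t u) \<and>
     (\<exists>R. \<forall>t u. \<bar>t\<bar> > R \<or> \<bar>u\<bar> > R \<longrightarrow> w t u = 0)"

text \<open>The pairing of \<open>\<mu>\<close> with a test function whose \<open>u\<close>-derivative is \<open>wu\<close>.\<close>

definition mu_pairing ::
    "(real \<Rightarrow> real) \<Rightarrow> (real \<Rightarrow> real \<Rightarrow> real) \<Rightarrow> (real \<Rightarrow> real \<Rightarrow> real) \<Rightarrow> real" where
  "mu_pairing g z wu =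
     - (LINT p:{0..} \<times> UNIV|lborel.
          (projected_flux g z (fst p) (snd p) - flux g z (fst p) (snd p)) * wu (fst p) (snd p))"

text \<open>\<open>z_t - (flux)_u = \<mu>\<close> in the sense of distributions, with initial datum \<open>z 0\<close>.\<close>

definition weak_equation :: "(real \<Rightarrow> real) \<Rightarrow> (real \<Rightarrow> real \<Rightarrow> real) \<Rightarrow> bool" where
  "weak_equation g z \<longleftrightarrow>
     (\<forall>w wt wu. test_function w wt wu \<longrightarrow>
        - (LINT p:{0..} \<times> UNIV|lborel. z (fst p) (snd p) * wt (fst p) (snd p))
        - (LINT u|lborel. z 0 u * w 0 u)
        + (LINT p:{0..} \<times> UNIV|lborel. flux g z (fst p) (snd p) * wu (fst p) (snd p))
        = mu_pairing g z wu)"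

text \<open>Away from the plateaus the flux \<open>- g\<close> is convex, so that admissible jumps are downward;
  the upward jump at the right end of a plateau is treated in \<open>front_lax\<close> below.\<close>

definition jumps_admissible :: "(real \<Rightarrow> real \<Rightarrow> real) \<Rightarrow> bool" where
  "jumps_admissible z \<longleftrightarrow>
     (\<forall>t>0. \<forall>u zl zr. (z t \<longlongrightarrow> zl) (at_left u) \<and> (z t \<longlongrightarrow> zr) (at_right u) \<and> zl > 0
        \<longrightarrow> zr \<le> zl)"

text \<open>
  The values of \<open>z\<close> at negative times are irrelevant.
\<close>

definition weak_solution ::
    "(real \<Rightarrow> real) \<Rightarrow> real \<Rightarrow> (real \<Rightarrow> real \<Rightarrow> real) \<Rightarrow> bool" where
  "weak_solution g D z \<longleftrightarrow>
     set_borel_measurable borel ({0..} \<times> UNIV) (\<lambda>p. z (fst p) (snd p)) \<and>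
     set_borel_measurable borel ({0..} \<times> UNIV) (\<lambda>p. projected_flux g z (fst p) (snd p)) \<and>
     (\<forall>t\<ge>0. (\<forall>u. 0 \<le> z t u \<and> z t u \<le> 1) \<and>
            integrable lborel (\<lambda>u. z t u - 1) \<and>
            (LINT u|lborel. \<bar>z t u - 1\<bar>) = D \<and>
            is_interval {u. z t u < 1}) \<and>
     (\<forall>T\<ge>0. \<exists>L. \<forall>s\<in>{0..T}. \<forall>t\<in>{0..T}. (LINT u|lborel. \<bar>z t u - z s u\<bar>) \<le> L * \<bar>t - s\<bar>) \<and>
     weak_equation g z \<and>
     jumps_admissible z"

section \<open>The drop as independent variable\<close>

definition drop_at :: "(real \<Rightarrow> real \<Rightarrow> real) \<Rightarrow> real \<Rightarrow> real \<Rightarrow> real" where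
  "drop_at z t u = (LINT v:{u..}|lborel. z t v - 1)"

text \<open>Outside \<open>(-D, 0)\<close> the value is 1, in accordance with \<open>\<zeta>(t,-D) = \<zeta>(t,0) = 1\<close> and
  with \<open>z = 1\<close> outside the interval where \<open>z < 1\<close>.\<close>

definition zeta :: "real \<Rightarrow> (real \<Rightarrow> real \<Rightarrow> real) \<Rightarrow> real \<Rightarrow> real \<Rightarrow> real" where
  "zeta D z t q =
     (if -D < q \<and> q < 0 then z t (the_inv_into {u. z t u < 1} (drop_at z t) q) else 1)"

text \<open>The right front \<open>q\<^sup>+\<close>, with the convention \<open>q\<^sup>+ = -D\<close> if there is no shock; hence
  \<open>\<zeta> > 0\<close> to the right of it in both cases, and a shock is present iff \<open>front D z t > -D\<close>.\<close>

definition front :: "real \<Rightarrow> (real \<Rightarrow> real \<Rightarrow> real) \<Rightarrow> real \<Rightarrow> real" where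
  "front D z t = Sup (insert (-D) {q. -D < q \<and> q < 0 \<and> zeta D z t q = 0})"

text \<open>The state on the right of the front; it is 1 if the front is at 0.\<close>

definition front_state :: "real \<Rightarrow> (real \<Rightarrow> real \<Rightarrow> real) \<Rightarrow> real \<Rightarrow> real" where
  "front_state D z t = Lim (at_right (front D z t)) (zeta D z t)"

subsection \<open>Structural properties\<close>

text \<open>The point \<open>q = -D\<close> corresponds to the location \<open>a\<close> of the downward jump of \<open>z(t, \<cdot>)\<close>;
  since \<open>q\<close> never lies below \<open>-D\<close>, the left state \<open>\<zeta>(t,-D-)\<close> is the left limit of
  \<open>z(t, \<cdot>)\<close> at \<open>a\<close>.\<close>

definition stationary_left_jump :: "real \<Rightarrow> (real \<Rightarrow> real \<Rightarrow> real) \<Rightarrow> bool" where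
  "stationary_left_jump D z \<longleftrightarrow>
     (\<forall>t\<ge>0. \<exists>a l. drop_at z t a = -D \<and> (\<forall>u>a. drop_at z t u > -D) \<and>
                  (z t \<longlongrightarrow> 1) (at_left a) \<and>
                  (zeta D z t \<longlongrightarrow> l) (at_right (-D)) \<and> l < 1)"

definition single_shock :: "real \<Rightarrow> (real \<Rightarrow> real \<Rightarrow> real) \<Rightarrow> bool" where
  "single_shock D z \<longleftrightarrow>
     (\<forall>t\<ge>0. \<forall>q. -D < q \<and> q < front D z t \<longrightarrow> zeta D z t q = 0)"

definition regular_right_of_front :: "real \<Rightarrow> (real \<Rightarrow> real \<Rightarrow> real) \<Rightarrow> bool" where
  "regular_right_of_front D z \<longleftrightarrow>
     (\<forall>t>0. (\<forall>K. compact K \<and> K \<subseteq> {front D z t<..0} \<longrightarrow> (\<exists>L. L-lipschitz_on K (zeta D z t))) \<and>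
            strict_mono_on {front D z t<..0} (zeta D z t))"

definition variation_at_most_2 :: "real \<Rightarrow> (real \<Rightarrow> real \<Rightarrow> real) \<Rightarrow> bool" where
  "variation_at_most_2 D z \<longleftrightarrow> (\<forall>t\<ge>0. total_variation (zeta D z t) {-D..0} \<le> 2)"

subsection \<open>Evolution laws\<close>

text \<open>The equation is required wherever \<open>\<zeta>\<close> is differentiable, and a characteristic is required
  to pass, locally in time, through every point of the region \<open>\<zeta> > 0\<close>.\<close>

definition smooth_law :: "(real \<Rightarrow> real) \<Rightarrow> real \<Rightarrow> (real \<Rightarrow> real \<Rightarrow> real) \<Rightarrow> bool" where
  "smooth_law g D z \<longleftrightarrow>
     (\<forall>t q. t > 0 \<and> front D z t < q \<and> q < 0 \<longrightarrow>
        (\<forall>A. ((\<lambda>p. zeta D z (fst p) (snd p)) has_derivative A) (at (t, q)) \<longrightarrow>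
           A (1, 0)
           - (1 - zeta D z t q)\<^sup>2
             * (deriv (hfun g) (zeta D z t q) * A (0, 1) - (hfun g (zeta D z t q))\<^sup>2)
             * Ffun g (zeta D z t) q = 0) \<and>
        (\<exists>d>0. \<exists>c. c t = q \<and>
           (\<forall>s. \<bar>s - t\<bar> < d \<longrightarrow>
              s > 0 \<and> front D z s < c s \<and> c s < 0 \<and>
              (c has_real_derivative
                 - (1 - zeta D z s (c s))\<^sup>2 * deriv (hfun g) (zeta D z s (c s))
                   * Ffun g (zeta D z s) (c s)) (at s) \<and>
              ((\<lambda>r. zeta D z r (c r)) has_real_derivative
                 - (1 - zeta D z s (c s))\<^sup>2 * (hfun g (zeta D z s (c s)))\<^sup>2
                   * Ffun g (zeta D z s) (c s)) (at s))))"

definition front_law :: "(real \<Rightarrow> real) \<Rightarrow> real \<Rightarrow> (real \<Rightarrow> real \<Rightarrow> real) \<Rightarrow> bool" where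
  "front_law g D z \<longleftrightarrow>
     (\<forall>t>0. front D z t > -D \<and> front_state D z t > 0 \<longrightarrow>
        (front D z has_real_derivative
           Ffun g (zeta D z t) (front D z t)
           * ((1 - front_state D z t) / front_state D z t)
           * (psi g (front D z t + D) - hfun g (front_state D z t))) (at t))"

definition front_lax :: "(real \<Rightarrow> real) \<Rightarrow> real \<Rightarrow> (real \<Rightarrow> real \<Rightarrow> real) \<Rightarrow> bool" where
  "front_lax g D z \<longleftrightarrow>
     (\<forall>t>0. front D z t > -D \<longrightarrow>
        hfun g (front_state D z t)
        - front_state D z t * (1 - front_state D z t) * deriv (hfun g) (front_state D z t)
        \<le> psi g (front D z t + D))"

section \<open>The stationary profile\<close>

definition D_hk :: "(real \<Rightarrow> real) \<Rightarrow> ereal" where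
  "D_hk g = (if hfun g 0 > 0 then ereal (1 / hfun g 0 - 1 / hfun g 1) else \<infinity>)"

text \<open>Only meaningful, and only used, if \<open>hfun g 0 > 0\<close>.\<close>

definition D_ss :: "(real \<Rightarrow> real) \<Rightarrow> real" where
  "D_ss g = (THE s. s > 0 \<and> psi g s = hfun g 1)"

definition phi :: "(real \<Rightarrow> real) \<Rightarrow> real \<Rightarrow> real" where
  "phi g q = (if - D_hk g \<le> ereal q
              then the_inv_into {0..} (hfun g) (hfun g 1 / (1 - hfun g 1 * q))
              else 0)"

definition profile_front :: "(real \<Rightarrow> real) \<Rightarrow> real \<Rightarrow> real" where
  "profile_front g D =
     (THE p. - D_hk g < ereal p \<and> p < 0 \<and> hfun g (phi g p) = psi g (p + D))"

definition profile :: "(real \<Rightarrow> real) \<Rightarrow> real \<Rightarrow> real \<Rightarrow> real" where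
  "profile g D q =
     (if q = -D \<or> q = 0 then 1
      else if ereal D \<le> D_hk g then phi g q
      else if D < D_ss g then (if q \<le> profile_front g D then 0 else phi g q)
      else 0)"

end

theory Submission
  imports Defs
begin

text \<open>
  Along characteristics \<open>k = q + 1 / h(\<zeta>)\<close> is constant, and the arc \<open>\<phi>\<close> of the profile is the
  level set \<open>k = 1 / h(1)\<close>. Characteristics move to the left with speed \<open>V(\<zeta>) F\<close>,
  \<open>V(\<zeta>) = (1 - \<zeta>)\<^sup>2 h'(\<zeta>)\<close>, which vanishes only at \<open>\<zeta> = 1\<close>, where \<open>k = 1 / h(1)\<close>. So on the right
  of the front \<open>k\<close> tends to \<open>1 / h(1)\<close>, except for values that a sonic front may emit. Lower values
  of \<open>k\<close> are never emitted, by the Lax condition and the monotonicity of \<open>\<zeta>\<close>; higher values are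
  emitted only while the front itself moves to the left. With \<open>E(q) = q + 1 / \<psi>(q + D)\<close>, which is
  strictly increasing, the front moves to the right iff \<open>k > E\<close> there, so it converges to the
  point where \<open>E = 1 / h(1)\<close> (or to an end point). All limits are taken for semicontinuous
  quantities (the front, the right ends of level sets of \<open>k\<close>) by one-sided growth arguments.

  The front law says nothing when the state on the right of the front is \<open>0\<close>: for
  \<open>D > 1 / h(0) - 1 / h(1)\<close> the stationary state \<open>\<zeta> = \<phi>\<close> satisfies all laws except the weak
  equation. This case is excluded by testing the weak equation.
\<close>

section \<open>The erosion function\<close>

locale erosion =
  fixes g g1 g2 :: "real \<Rightarrow> real"
  assumes deriv_g: "\<And>z. z \<ge> 0 \<Longrightarrow> (g has_real_derivative g1 z) (at z within {0..})"
    and deriv_g1: "\<And>z. z \<ge> 0 \<Longrightarrow> (g1 has_real_derivative g2 z) (at z within {0..})"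
    and g2_neg: "\<And>z. z \<ge> 0 \<Longrightarrow> g2 z < 0"
    and cont_g2: "continuous_on {0..} g2"
    and g_1: "g 1 = 0" and g_0: "g 0 \<ge> 0"
begin

abbreviation h where "h \<equiv> hfun g"

definition V :: "real \<Rightarrow> real" where "V z = g z + g1 z * (1 - z)"

definition G :: "real \<Rightarrow> real" where "G z = g z - z * g1 z"

lemma within_at: "z > 0 \<Longrightarrow> (at z within {0..}) = at (z::real)"
  by (rule at_within_interior) simp

lemma g_at: "z > 0 \<Longrightarrow> (g has_real_derivative g1 z) (at z)"
  using deriv_g[of z] by (simp add: within_at)

lemma g1_at: "z > 0 \<Longrightarrow> (g1 has_real_derivative g2 z) (at z)"
  using deriv_g1[of z] by (simp add: within_at)

lemma cont_g: "continuous_on {0..} g"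
  using deriv_g by (auto simp: continuous_on_eq_continuous_within intro: DERIV_continuous)

lemma cont_g1: "continuous_on {0..} g1"
  using deriv_g1 by (auto simp: continuous_on_eq_continuous_within intro: DERIV_continuous)

lemma cont_V: "continuous_on {0..} V"
  unfolding V_def by (intro continuous_intros cont_g cont_g1)

lemma cont_G: "continuous_on {0..} G"
  unfolding G_def by (intro continuous_intros cont_g cont_g1)

lemma V_at: "z > 0 \<Longrightarrow> (V has_real_derivative g2 z * (1 - z)) (at z)"
  unfolding V_def by (rule derivative_eq_intros g_at g1_at refl | simp add: algebra_simps)+

lemma G_at: "z > 0 \<Longrightarrow> (G has_real_derivative - z * g2 z) (at z)"
  unfolding G_def by (rule derivative_eq_intros g_at g1_at refl | simp add: algebra_simps)+

lemma V_1 [simp]: "V 1 = 0"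
  by (simp add: V_def g_1)

lemma V_strict_anti: "0 \<le> a \<Longrightarrow> a < b \<Longrightarrow> b \<le> 1 \<Longrightarrow> V b < V a"
  by (rule DERIV_neg_imp_decreasing_open)
    (auto intro!: exI V_at mult_neg_pos g2_neg continuous_on_subset[OF cont_V])

lemma V_anti: "0 \<le> a \<Longrightarrow> a \<le> b \<Longrightarrow> b \<le> 1 \<Longrightarrow> V b \<le> V a"
  using V_strict_anti[of a b] by (cases "a = b") auto

lemma V_pos: "0 \<le> z \<Longrightarrow> z < 1 \<Longrightarrow> V z > 0"
  using V_strict_anti[of z 1] by simp

lemma V_nonneg: "0 \<le> z \<Longrightarrow> z \<le> 1 \<Longrightarrow> V z \<ge> 0"
  using V_anti[of z 1] by simp

lemma G_strict_mono: "0 \<le> a \<Longrightarrow> a < b \<Longrightarrow> G a < G b"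
  by (rule DERIV_pos_imp_increasing_open)
    (auto intro!: exI G_at continuous_on_subset[OF cont_G] simp: mult_pos_neg g2_neg)

lemma deriv_g_1: "deriv g 1 = g1 1"
  by (rule DERIV_imp_deriv) (rule g_at, simp)

lemma h_eq: "z \<noteq> 1 \<Longrightarrow> h z = g z / (1 - z)"
  by (simp add: hfun_def)

lemma g_eq: "g z = h z * (1 - z)"
  by (simp add: hfun_def g_1)

lemma h_0: "h 0 = g 0"
  by (simp add: hfun_def)

lemma h_1: "h 1 = - g1 1"
  by (simp add: hfun_def deriv_g_1)

lemma h_at:
  assumes "z > 0" "z \<noteq> 1"
  shows "(h has_real_derivative V z / (1 - z)\<^sup>2) (at z)"
proof -
  have "((\<lambda>z. g z / (1 - z)) has_real_derivative V z / (1 - z)\<^sup>2) (at z)"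
    unfolding V_def using assms
    by (auto intro!: derivative_eq_intros g_at simp: field_simps power2_eq_square)
  moreover have "\<forall>\<^sub>F x in nhds z. g x / (1 - x) = h x"
    using t1_space_nhds[of z 1] assms by (auto elim!: eventually_mono simp: h_eq)
  ultimately show ?thesis
    using DERIV_cong_ev[OF refl, of "\<lambda>z. g z / (1 - z)" h] by simp
qed

lemma deriv_h: "0 < z \<Longrightarrow> z \<noteq> 1 \<Longrightarrow> deriv h z = V z / (1 - z)\<^sup>2"
  by (rule DERIV_imp_deriv) (rule h_at)

lemma V_eq: "0 < z \<Longrightarrow> z \<noteq> 1 \<Longrightarrow> (1 - z)\<^sup>2 * deriv h z = V z"
  by (simp add: deriv_h)

lemma G_eq:
  assumes "0 < z"
  shows "h z - z * (1 - z) * deriv h z = G z"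
proof (cases "z = 1")
  case True
  then show ?thesis by (simp add: h_1 G_def g_1)
next
  case False
  define c where "c = 1 - z"
  have c: "c \<noteq> 0" "z = 1 - c" using False by (auto simp: c_def)
  have "h z - z * (1 - z) * deriv h z = g z / c - z * c * ((g z + g1 z * c) / c\<^sup>2)"
    using assms False by (simp add: deriv_h h_eq V_def c_def)
  also have "\<dots> = (g z - z * (g z + g1 z * c)) / c"
    using c(1) by (simp add: field_simps power2_eq_square)
  also have "g z - z * (g z + g1 z * c) = c * G z"
    unfolding G_def c_def by (simp add: algebra_simps)
  also have "c * G z / c = G z"
    using c by simp
  finally show ?thesis .
qed

lemma h_cont_1: "(h \<longlongrightarrow> h 1) (at 1)"
proof -
  have "((\<lambda>y. (g y - g 1) / (y - 1)) \<longlongrightarrow> g1 1) (at 1)"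
    using g_at[of 1] by (simp add: has_field_derivative_iff)
  then have "((\<lambda>y. - ((g y - g 1) / (y - 1))) \<longlongrightarrow> - g1 1) (at 1)"
    by (rule tendsto_minus)
  moreover have "\<forall>\<^sub>F y in at 1. - ((g y - g 1) / (y - 1)) = h y"
    unfolding eventually_at_filter
    by (rule always_eventually) (auto simp: h_eq g_1 minus_divide_right)
  ultimately show ?thesis
    unfolding h_1 by (rule Lim_transform_eventually)
qed

lemma cont_h: "continuous_on {0..} h"
  unfolding continuous_on_eq_continuous_within
proof
  fix z :: real assume z: "z \<in> {0..}"
  show "continuous (at z within {0..}) h"
  proof (cases "z = 1")
    case True
    then show ?thesis
      using tendsto_within_subset[OF h_cont_1, of "{0..}"] by (simp add: continuous_within)
  next
    case False
    have "continuous (at z within {0..}) (\<lambda>z. g z / (1 - z))"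
      using z False cont_g by (intro continuous_intros) (auto simp: continuous_on_eq_continuous_within)
    moreover have "\<forall>\<^sub>F x in at z within {0..}. g x / (1 - x) = h x"
    proof -
      have "\<forall>\<^sub>F x in at z within {0..}. x \<noteq> 1"
        using False t1_space_nhds[of z 1] by (auto simp: eventually_at_filter elim: eventually_mono)
      then show ?thesis by eventually_elim (simp add: h_eq)
    qed
    ultimately show ?thesis
      unfolding continuous_within using False
      by (simp add: h_eq Lim_transform_eventually)
  qed
qed

lemma V_ge_square:
  obtains m where "m > 0" "\<And>z. 0 \<le> z \<Longrightarrow> z \<le> 1 \<Longrightarrow> m * (1 - z)\<^sup>2 \<le> V z"
proof -
  have "compact {0..1::real}" "continuous_on {0..1} g2"
    using continuous_on_subset[OF cont_g2] by auto
  then obtain x where x: "x \<in> {0..1}" "\<And>y. y \<in> {0..1} \<Longrightarrow> g2 y \<le> g2 x"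
    using continuous_attains_sup[of "{0..1::real}" g2] by auto
  define m where "m = - g2 x / 2"
  have m: "m > 0" using g2_neg[of x] x by (simp add: m_def)
  have "m * (1 - z)\<^sup>2 \<le> V z" if "0 \<le> z" "z \<le> 1" for z
  proof -
    have "V 1 - m * (1 - 1)\<^sup>2 \<le> V z - m * (1 - z)\<^sup>2"
    proof (rule DERIV_nonpos_imp_decreasing_open[where f = "\<lambda>z. V z - m * (1 - z)\<^sup>2"])
      show "z \<le> 1" by fact
      show "continuous_on {z..1} (\<lambda>z. V z - m * (1 - z)\<^sup>2)"
        using that by (intro continuous_intros continuous_on_subset[OF cont_V]) auto
      fix y assume y: "z < y" "y < 1"
      have "((\<lambda>z. V z - m * (1 - z)\<^sup>2) has_real_derivative (g2 y + 2 * m) * (1 - y)) (at y)"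
        using y that
        by (auto intro!: derivative_eq_intros V_at simp: algebra_simps)
      moreover have "(g2 y + 2 * m) * (1 - y) \<le> 0"
        using y that x(2)[of y] by (intro mult_nonpos_nonneg) (auto simp: m_def)
      ultimately show "\<exists>d. ((\<lambda>z. V z - m * (1 - z)\<^sup>2) has_real_derivative d) (at y) \<and> d \<le> 0"
        by blast
    qed
    then show ?thesis by simp
  qed
  from that[OF m this] show thesis .
qed

lemma h_expanding:
  obtains m where "m > 0" "\<And>a b. 0 \<le> a \<Longrightarrow> a \<le> b \<Longrightarrow> b \<le> 1 \<Longrightarrow> m * (b - a) \<le> h b - h a"
proof -
  obtain m where m: "m > 0" "\<And>z. 0 \<le> z \<Longrightarrow> z \<le> 1 \<Longrightarrow> m * (1 - z)\<^sup>2 \<le> V z"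
    using V_ge_square by metis
  have "m * (b - a) \<le> h b - h a" if ab: "0 \<le> a" "a \<le> b" "b \<le> 1" for a b
  proof -
    have "h a - m * a \<le> h b - m * b"
    proof (rule DERIV_nonneg_imp_increasing_open[where f = "\<lambda>z. h z - m * z"])
      show "a \<le> b" by fact
      show "continuous_on {a..b} (\<lambda>z. h z - m * z)"
        using ab by (intro continuous_intros continuous_on_subset[OF cont_h]) auto
      fix y assume y: "a < y" "y < b"
      have "((\<lambda>z. h z - m * z) has_real_derivative V y / (1 - y)\<^sup>2 - m) (at y)"
        using y ab by (auto intro!: derivative_eq_intros h_at)
      moreover have "V y / (1 - y)\<^sup>2 - m \<ge> 0"
        using m(2)[of y] y ab by (simp add: field_simps)
      ultimately show "\<exists>d. ((\<lambda>z. h z - m * z) has_real_derivative d) (at y) \<and> 0 \<le> d"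
        by blast
    qed
    then show ?thesis by (simp add: algebra_simps)
  qed
  from that[OF m(1) this] show thesis .
qed

lemma h_strict_mono: "0 \<le> a \<Longrightarrow> a < b \<Longrightarrow> b \<le> 1 \<Longrightarrow> h a < h b"
  using h_expanding by (smt (verit) mult_pos_pos)

lemma h_mono: "0 \<le> a \<Longrightarrow> a \<le> b \<Longrightarrow> b \<le> 1 \<Longrightarrow> h a \<le> h b"
  using h_strict_mono[of a b] by (cases "a = b") auto

lemma h_0_nonneg: "h 0 \<ge> 0"
  using g_0 by (simp add: h_0)

lemma h_pos: "0 < z \<Longrightarrow> z \<le> 1 \<Longrightarrow> h z > 0"
  using h_strict_mono[of 0 z] h_0_nonneg by simp

lemma h_nonneg: "0 \<le> z \<Longrightarrow> z \<le> 1 \<Longrightarrow> h z \<ge> 0"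
  using h_mono[of 0 z] h_0_nonneg by simp

lemma h_1_pos: "h 1 > 0"
  by (simp add: h_pos)

lemma h_beyond_1:
  assumes "z > 1"
  shows "h 1 < h z"
proof -
  have "g z - g1 1 * z < g 1 - g1 1 * 1"
  proof (rule DERIV_neg_imp_decreasing_open[OF assms])
    show "continuous_on {1..z} (\<lambda>z. g z - g1 1 * z)"
      by (intro continuous_intros continuous_on_subset[OF cont_g]) auto
    fix y assume y: "1 < y" "y < z"
    have "g1 y < g1 1"
    proof (rule DERIV_neg_imp_decreasing_open[where f = g1])
      show "continuous_on {1..y} g1" by (rule continuous_on_subset[OF cont_g1]) auto
    qed (use y in \<open>auto intro!: exI g1_at g2_neg\<close>)
    moreover have "((\<lambda>z. g z - g1 1 * z) has_real_derivative g1 y - g1 1) (at y)"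
      using y by (auto intro!: derivative_eq_intros g_at)
    ultimately show "\<exists>d. ((\<lambda>z. g z - g1 1 * z) has_real_derivative d) (at y) \<and> d < 0"
      by auto
  qed
  then have "g z < g1 1 * (z - 1)" by (simp add: g_1 algebra_simps)
  then show ?thesis using assms by (simp add: h_1 h_eq field_simps)
qed

lemma h_inverse:
  assumes "0 \<le> z" "z \<le> 1"
  shows "the_inv_into {0..} h (h z) = z"
  unfolding the_inv_into_def
proof (rule the_equality)
  show "z \<in> {0..} \<and> h z = h z" using assms by simp
  fix x assume x: "x \<in> {0..} \<and> h x = h z"
  have "x \<le> 1" using h_beyond_1[of x] h_mono[of z 1] x assms by (cases "x > 1") auto
  then show "x = z" using h_strict_mono[of x z] h_strict_mono[of z x] x assms
    by (cases x z rule: linorder_cases) auto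
qed

lemma h_surj:
  assumes "h 0 \<le> y" "y \<le> h 1"
  obtains z where "0 \<le> z" "z \<le> 1" "h z = y"
  using IVT'[of h 0 y 1] assms continuous_on_subset[OF cont_h, of "{0..1}"] by auto

lemma inverse_h_diff:
  assumes m: "m > 0" "\<And>a b. 0 \<le> a \<Longrightarrow> a \<le> b \<Longrightarrow> b \<le> 1 \<Longrightarrow> m * (b - a) \<le> h b - h a"
    and ab: "0 \<le> a" "a \<le> 1" "0 \<le> b" "b \<le> 1" "h a > 0" "h b > 0"
    and close: "\<bar>1 / h a - 1 / h b\<bar> \<le> \<eta>"
  shows "\<bar>a - b\<bar> \<le> (h 1)\<^sup>2 / m * \<eta>"
proof -
  have "m * \<bar>a - b\<bar> \<le> \<bar>h a - h b\<bar>"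
    using m(2)[of a b] m(2)[of b a] ab by (cases "a \<le> b") auto
  also have "\<dots> = h a * h b * \<bar>1 / h a - 1 / h b\<bar>"
    using ab by (simp add: field_simps abs_mult abs_minus_commute)
  also have "\<dots> \<le> h 1 * h 1 * \<eta>"
    using ab close h_1_pos by (intro mult_mono h_mono) auto
  finally show ?thesis using m(1) by (simp add: field_simps power2_eq_square)
qed

end

section \<open>The drop as independent variable\<close>

lemma integral_tail_tendsto:
  fixes p :: "real \<Rightarrow> real"
  assumes "integrable lborel p"
  shows "(\<lambda>i. LINT v:{real i..}|lborel. p v) \<longlonglongrightarrow> 0"
    and "(\<lambda>i. LINT v:{- real i..}|lborel. p v) \<longlonglongrightarrow> (LINT v|lborel. p v)"
proof -
  have meas: "p \<in> borel_measurable lborel" using assms by simp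
  have 1: "(\<lambda>i. indicator {real i..} x *\<^sub>R p x) \<longlonglongrightarrow> 0" for x
  proof (rule tendsto_eventually)
    show "\<forall>\<^sub>F i in sequentially. indicator {real i..} x *\<^sub>R p x = 0"
      using eventually_gt_at_top[of "nat \<lceil>x\<rceil>"]
      by eventually_elim (auto simp: indicator_def; linarith)
  qed
  have 2: "(\<lambda>i. indicator {- real i..} x *\<^sub>R p x) \<longlonglongrightarrow> p x" for x
  proof (rule tendsto_eventually)
    show "\<forall>\<^sub>F i in sequentially. indicator {- real i..} x *\<^sub>R p x = p x"
      using eventually_gt_at_top[of "nat \<lceil>-x\<rceil>"]
      by eventually_elim (auto simp: indicator_def; linarith)
  qed
  have "(\<lambda>i. LINT v:{real i..}|lborel. p v) \<longlonglongrightarrow> (LINT v::real|lborel. 0)"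
    unfolding set_lebesgue_integral_def
    by (rule integral_dominated_convergence[where w = "\<lambda>x. \<bar>p x\<bar>"])
      (use assms 1 in \<open>auto simp: indicator_def\<close>)
  then show "(\<lambda>i. LINT v:{real i..}|lborel. p v) \<longlonglongrightarrow> 0" by simp
  show "(\<lambda>i. LINT v:{- real i..}|lborel. p v) \<longlonglongrightarrow> (LINT v|lborel. p v)"
    unfolding set_lebesgue_integral_def
    by (rule integral_dominated_convergence[where w = "\<lambda>x. \<bar>p x\<bar>"])
      (use assms 2 in \<open>auto simp: indicator_def\<close>)
qed

lemma AE_lborel_unless_single:
  fixes P :: "real \<Rightarrow> bool"
  assumes "\<And>u v. \<not> P u \<Longrightarrow> \<not> P v \<Longrightarrow> u = v"
  shows "AE v in lborel. P v"
proof (cases "\<forall>v. P v")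
  case False
  then obtain v0 where "\<not> P v0" by blast
  then show ?thesis
    using AE_lborel_singleton[of v0] assms by (auto elim!: AE_mp)
qed auto

locale flow = erosion +
  fixes D :: real and z :: "real \<Rightarrow> real \<Rightarrow> real"
  assumes D_pos: "D > 0" and solution: "weak_solution g D z"
    and smooth: "smooth_law g D z" and law: "front_law g D z" and lax: "front_lax g D z"
    and shock: "single_shock D z" and regular: "regular_right_of_front D z"
begin

abbreviation Q where "Q \<equiv> drop_at z"
abbreviation \<zeta> where "\<zeta> \<equiv> zeta D z"
abbreviation Y where "Y \<equiv> front D z"
abbreviation zp where "zp \<equiv> front_state D z"
abbreviation F where "F t \<equiv> Ffun g (\<zeta> t)"

lemma z_range: "t \<ge> 0 \<Longrightarrow> 0 \<le> z t u \<and> z t u \<le> 1"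
  and z_integrable: "t \<ge> 0 \<Longrightarrow> integrable lborel (\<lambda>u. z t u - 1)"
  and z_integral: "t \<ge> 0 \<Longrightarrow> (LINT u|lborel. \<bar>z t u - 1\<bar>) = D"
  and z_interval: "t \<ge> 0 \<Longrightarrow> is_interval {u. z t u < 1}"
  using solution unfolding weak_solution_def by auto

lemma compl_integrable: "t \<ge> 0 \<Longrightarrow> integrable lborel (\<lambda>u. 1 - z t u)"
  using z_integrable[of t] integrable_minus[of lborel "\<lambda>u. z t u - 1"] by simp

lemma compl_integral: "t \<ge> 0 \<Longrightarrow> (LINT u|lborel. 1 - z t u) = D"
proof -
  assume t: "t \<ge> 0"
  have "1 - z t u = \<bar>z t u - 1\<bar>" for u using z_range[OF t, of u] by simp
  then show ?thesis using z_integral[OF t] by simp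
qed

lemma compl_set_integrable: "t \<ge> 0 \<Longrightarrow> A \<in> sets borel \<Longrightarrow> set_integrable lborel A (\<lambda>u. 1 - z t u)"
  using compl_integrable[of t] unfolding set_integrable_def
  by (intro integrable_mult_indicator) auto

lemma Q_eq: "Q t u = - (LINT v:{u..}|lborel. 1 - z t v)"
proof -
  have "(LINT v:{u..}|lborel. - (1 - z t v)) = - (LINT v:{u..}|lborel. 1 - z t v)"
    unfolding set_lebesgue_integral_def by (subst integral_minus[symmetric]) (simp add: algebra_simps)
  then show ?thesis by (simp add: drop_at_def)
qed

lemma Q_diff:
  assumes "t \<ge> 0" "u \<le> v"
  shows "Q t v - Q t u = (LINT x:{u..<v}|lborel. 1 - z t x)"
proof -
  have "(LINT x:{u..<v} \<union> {v..}|lborel. 1 - z t x)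
      = (LINT x:{u..<v}|lborel. 1 - z t x) + (LINT x:{v..}|lborel. 1 - z t x)"
    by (rule set_integral_Un) (auto intro: compl_set_integrable assms)
  moreover have "{u..<v} \<union> {v..} = {u..}" using assms by auto
  ultimately show ?thesis by (simp add: Q_eq)
qed

lemma Q_mono:
  assumes "t \<ge> 0" "u \<le> v"
  shows "Q t u \<le> Q t v"
proof -
  have "0 \<le> (LINT x:{u..<v}|lborel. 1 - z t x)"
    unfolding set_lebesgue_integral_def
    by (rule Bochner_Integration.integral_nonneg) (use z_range[of t] assms in \<open>auto simp: indicator_def\<close>)
  then show ?thesis using Q_diff[OF assms] by simp
qed

lemma Q_diff_le:
  assumes "t \<ge> 0" "u \<le> v" "AE x in lborel. x \<in> {u<..<v} \<longrightarrow> 1 - z t x \<le> c"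
  shows "Q t v - Q t u \<le> c * (v - u)"
proof -
  have "(LINT x:{u..<v}|lborel. 1 - z t x) \<le> (LINT x:{u..<v}|lborel. c)"
  proof (rule set_integral_mono_AE)
    show "AE x\<in>{u..<v} in lborel. 1 - z t x \<le> c"
      using assms(3) AE_lborel_singleton[of u] by eventually_elim auto
  qed (use assms compl_set_integrable in \<open>auto simp: set_integrable_def\<close>)
  also have "\<dots> = c * (v - u)" using assms by (simp add: set_lebesgue_integral_def)
  finally show ?thesis using Q_diff[OF assms(1,2)] by simp
qed

lemma Q_diff_ge:
  assumes "t \<ge> 0" "u \<le> v" "AE x in lborel. x \<in> {u<..<v} \<longrightarrow> c \<le> 1 - z t x"
  shows "c * (v - u) \<le> Q t v - Q t u"
proof -
  have "(LINT x:{u..<v}|lborel. c) \<le> (LINT x:{u..<v}|lborel. 1 - z t x)"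
  proof (rule set_integral_mono_AE)
    show "AE x\<in>{u..<v} in lborel. c \<le> 1 - z t x"
      using assms(3) AE_lborel_singleton[of u] by eventually_elim auto
  qed (use assms compl_set_integrable in \<open>auto simp: set_integrable_def\<close>)
  moreover have "(LINT x:{u..<v}|lborel. c) = c * (v - u)"
    using assms by (simp add: set_lebesgue_integral_def)
  ultimately show ?thesis using Q_diff[OF assms(1,2)] by simp
qed

lemma Q_lipschitz: "t \<ge> 0 \<Longrightarrow> u \<le> v \<Longrightarrow> Q t v \<le> Q t u + (v - u)"
  using Q_diff_le[of t u v 1] z_range[of t] by simp

lemma Q_cont: "t \<ge> 0 \<Longrightarrow> continuous_on A (Q t)"
proof -
  assume t: "t \<ge> 0"
  have "dist (Q t u) (Q t v) \<le> 1 * dist u v" for u v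
    using Q_lipschitz[OF t, of u v] Q_lipschitz[OF t, of v u] Q_mono[OF t, of u v] Q_mono[OF t, of v u]
    by (cases "u \<le> v") (auto simp: dist_real_def)
  then have "1-lipschitz_on A (Q t)" by (auto simp: lipschitz_on_def)
  then show ?thesis by (rule lipschitz_on_continuous_on)
qed

lemma Q_le_0: "t \<ge> 0 \<Longrightarrow> Q t u \<le> 0"
proof -
  assume t: "t \<ge> 0"
  have "0 \<le> (LINT v:{u..}|lborel. 1 - z t v)"
    unfolding set_lebesgue_integral_def
    by (rule Bochner_Integration.integral_nonneg) (use z_range[of t] t in \<open>auto simp: indicator_def\<close>)
  then show ?thesis by (simp add: Q_eq)
qed

lemma Q_attains:
  assumes t: "t \<ge> 0" and q: "-D < q" "q < 0"
  obtains u where "Q t u = q"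
proof -
  have "(\<lambda>i. Q t (real i)) \<longlonglongrightarrow> - 0" "(\<lambda>i. Q t (- real i)) \<longlonglongrightarrow> - D"
    unfolding Q_eq compl_integral[OF t, symmetric]
    by (intro tendsto_minus integral_tail_tendsto compl_integrable t)+
  then have "\<forall>\<^sub>F i in sequentially. q < Q t (real i)" "\<forall>\<^sub>F i in sequentially. Q t (- real i) < q"
    using q by (auto simp: order_tendsto_iff)
  then have "\<forall>\<^sub>F i in sequentially. q < Q t (real i) \<and> Q t (- real i) < q" by eventually_elim auto
  then obtain i where "q < Q t (real i)" "Q t (- real i) < q"
    using eventually_happens'[OF sequentially_bot] by blast
  then show thesis
    using IVT'[of "Q t" "- real i" q "real i"] Q_cont[OF t] that by auto
qed

lemma z_less_1:
  assumes t: "t \<ge> 0" and "-D < Q t u" "Q t u < 0"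
  shows "z t u < 1"
proof (rule ccontr)
  let ?I = "{u. z t u < 1}"
  assume "\<not> z t u < 1"
  then have u: "u \<notin> ?I" by simp
  have "(\<forall>v\<in>?I. v < u) \<or> (\<forall>v\<in>?I. v > u)"
    using z_interval[OF t] u unfolding is_interval_1 by (metis linorder_not_le order_le_less)
  then show False
  proof
    assume *: "\<forall>v\<in>?I. v < u"
    have "z t v = 1" if "v \<ge> u" for v using bspec[OF *, of v] that z_range[OF t, of v] by (cases "z t v < 1") auto
    then have "Q t u = 0" by (simp add: drop_at_def set_lebesgue_integral_def indicator_def)
        (rule integral_eq_zero_AE, auto)
    with assms show False by simp
  next
    assume *: "\<forall>v\<in>?I. v > u"
    have "z t v = 1" if "v < u" for v using bspec[OF *, of v] that z_range[OF t, of v] by (cases "z t v < 1") auto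
    then have "(LINT v:{u..}|lborel. 1 - z t v) = (LINT v|lborel. 1 - z t v)"
      unfolding set_lebesgue_integral_def
      by (intro Bochner_Integration.integral_cong) (auto simp: indicator_def)
    with assms show False by (simp add: Q_eq compl_integral)
  qed
qed

lemma Q_strict_mono_on_interval:
  assumes t: "t \<ge> 0" and "u < v" "z t u < 1" "z t v < 1"
  shows "Q t u < Q t v"
proof (rule ccontr)
  assume "\<not> Q t u < Q t v"
  then have *: "(LINT x:{u..<v}|lborel. 1 - z t x) = 0"
    using Q_diff[OF t, of u v] Q_mono[OF t, of u v] assms by simp
  have "AE x in lborel. indicator {u..<v} x *\<^sub>R (1 - z t x) = 0"
  proof (subst integral_nonneg_eq_0_iff_AE[symmetric])
    show "integrable lborel (\<lambda>x. indicator {u..<v} x *\<^sub>R (1 - z t x))"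
      using compl_set_integrable[OF t, of "{u..<v}"] by (simp add: set_integrable_def)
    show "AE x in lborel. 0 \<le> indicator {u..<v} x *\<^sub>R (1 - z t x)"
      using z_range[OF t] by (auto simp: indicator_def)
  qed (use * in \<open>simp add: set_lebesgue_integral_def\<close>)
  moreover have "indicator {u..<v} x *\<^sub>R (1 - z t x) \<noteq> 0" if "x \<in> {u..<v}" for x
  proof -
    have "x \<in> {u. z t u < 1}"
      using mem_is_interval_1_I[OF z_interval[OF t], of u v x] assms that by simp
    then show ?thesis using that by simp
  qed
  ultimately have "AE x in lborel. x \<notin> {u..<v}" by (auto elim: AE_mp)
  then have "emeasure lborel {u..<v} = 0"
    by (subst (asm) AE_iff_measurable[where N = "{u..<v}"]) auto
  then show False using assms by simp
qed

lemma zeta_Q: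
  assumes t: "t \<ge> 0" and "-D < Q t u" "Q t u < 0"
  shows "\<zeta> t (Q t u) = z t u"
proof -
  have "inj_on (Q t) {u. z t u < 1}"
    by (rule linorder_inj_onI') (use Q_strict_mono_on_interval[OF t] in force)
  then have "the_inv_into {u. z t u < 1} (Q t) (Q t u) = u"
    by (rule the_inv_into_f_f) (simp add: z_less_1 assms)
  then show ?thesis using assms by (simp add: zeta_def)
qed

lemma Q_inj:
  assumes t: "t \<ge> 0" and "-D < Q t u" "Q t u < 0" "Q t v = Q t u"
  shows "u = v"
proof -
  have "z t u < 1" "z t v < 1" using z_less_1[OF t] assms by auto
  then show ?thesis
    using Q_strict_mono_on_interval[OF t, of u v] Q_strict_mono_on_interval[OF t, of v u] assms
    by (metis linorder_neqE_linordered_idom order_less_irrefl)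
qed

lemma Q_time_lipschitz:
  assumes "T \<ge> 0"
  shows "\<exists>L>0. \<forall>s\<in>{0..T}. \<forall>t\<in>{0..T}.
    (LINT u|lborel. \<bar>z t u - z s u\<bar>) \<le> L * \<bar>t - s\<bar> \<and> (\<forall>u. \<bar>Q t u - Q s u\<bar> \<le> L * \<bar>t - s\<bar>)"
proof -
  obtain L0 where L0: "\<forall>s\<in>{0..T}. \<forall>t\<in>{0..T}. (LINT u|lborel. \<bar>z t u - z s u\<bar>) \<le> L0 * \<bar>t - s\<bar>"
    using solution assms unfolding weak_solution_def by blast
  define L where "L = \<bar>L0\<bar> + 1"
  have L: "(LINT u|lborel. \<bar>z t u - z s u\<bar>) \<le> L * \<bar>t - s\<bar>" if "0 \<le> s" "s \<le> T" "0 \<le> t" "t \<le> T" for s t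
  proof -
    have "(LINT u|lborel. \<bar>z t u - z s u\<bar>) \<le> L0 * \<bar>t - s\<bar>" using L0 that by auto
    also have "\<dots> \<le> L * \<bar>t - s\<bar>" by (intro mult_right_mono) (auto simp: L_def)
    finally show ?thesis .
  qed
  have "\<bar>Q t u - Q s u\<bar> \<le> L * \<bar>t - s\<bar>" if st: "0 \<le> s" "s \<le> T" "0 \<le> t" "t \<le> T" for s t u
  proof -
    have i: "integrable lborel (\<lambda>u. z t u - z s u)"
      using Bochner_Integration.integrable_diff[OF z_integrable[of t] z_integrable[of s]] st by simp
    have "Q t u - Q s u = (LINT v:{u..}|lborel. z t v - z s v)"
      using set_integral_diff(2)[OF compl_set_integrable[of s "{u..}"] compl_set_integrable[of t "{u..}"]] st
      by (simp add: Q_eq)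
    also have "\<bar>\<dots>\<bar> \<le> (LINT v|lborel. \<bar>indicator {u..} v *\<^sub>R (z t v - z s v)\<bar>)"
      unfolding set_lebesgue_integral_def by (rule integral_abs_bound)
    also have "\<dots> \<le> (LINT v|lborel. \<bar>z t v - z s v\<bar>)"
    proof (rule integral_mono)
      show "integrable lborel (\<lambda>v. \<bar>indicator {u..} v *\<^sub>R (z t v - z s v)\<bar>)"
        using i by (intro integrable_abs integrable_mult_indicator) auto
    qed (use i in \<open>auto simp: indicator_def\<close>)
    also have "\<dots> \<le> L * \<bar>t - s\<bar>" by (rule L) fact+
    finally show ?thesis .
  qed
  moreover have "L > 0" by (simp add: L_def)
  ultimately show ?thesis using L by (intro exI[of _ L]) auto
qed

lemma zeta_range: "t \<ge> 0 \<Longrightarrow> 0 \<le> \<zeta> t q \<and> \<zeta> t q \<le> 1"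
  using z_range by (simp add: zeta_def)

lemma zeta_0 [simp]: "\<zeta> t 0 = 1"
  by (simp add: zeta_def)

lemma front_bounds: "-D \<le> Y t" "Y t \<le> 0"
  and zeta_0_le_front: "-D < q \<Longrightarrow> q < 0 \<Longrightarrow> \<zeta> t q = 0 \<Longrightarrow> q \<le> Y t"
proof -
  let ?S = "insert (-D) {q. -D < q \<and> q < 0 \<and> \<zeta> t q = 0}"
  have bdd: "bdd_above ?S" using D_pos by (auto intro!: bdd_aboveI[where M = 0])
  show "-D \<le> Y t" unfolding front_def by (rule cSup_upper[OF _ bdd]) simp
  show "Y t \<le> 0" unfolding front_def by (rule cSup_least) (use D_pos in auto)
  show "q \<le> Y t" if "-D < q" "q < 0" "\<zeta> t q = 0"
    unfolding front_def by (rule cSup_upper[OF _ bdd]) (use that in simp)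
qed

lemma zeta_left: "t \<ge> 0 \<Longrightarrow> -D < q \<Longrightarrow> q < Y t \<Longrightarrow> \<zeta> t q = 0"
  using shock by (auto simp: single_shock_def)

lemma zeta_pos:
  assumes "t \<ge> 0" "Y t < q" "q \<le> 0" shows "\<zeta> t q > 0"
  using zeta_0_le_front[of q t] front_bounds[of t] zeta_range[OF assms(1), of q] assms
  by (cases "q = 0") force+

lemma zeta_strict_mono: "t > 0 \<Longrightarrow> Y t < q \<Longrightarrow> q < r \<Longrightarrow> r \<le> 0 \<Longrightarrow> \<zeta> t q < \<zeta> t r"
  using regular unfolding regular_right_of_front_def strict_mono_on_def by auto

lemma zeta_mono: "t > 0 \<Longrightarrow> Y t < q \<Longrightarrow> q \<le> r \<Longrightarrow> r \<le> 0 \<Longrightarrow> \<zeta> t q \<le> \<zeta> t r"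
  using zeta_strict_mono[of t q r] by (cases "q = r") auto

lemma zeta_less_1: "t > 0 \<Longrightarrow> Y t < q \<Longrightarrow> q < 0 \<Longrightarrow> \<zeta> t q < 1"
  using zeta_strict_mono[of t q 0] by simp

lemma zeta_cont:
  assumes "t > 0" shows "continuous_on {Y t<..0} (\<zeta> t)"
  unfolding continuous_on_eq_continuous_within
proof
  fix q assume q: "q \<in> {Y t<..0}"
  define a where "a = (Y t + q) / 2"
  have a: "Y t < a" "a < q" using q by (auto simp: a_def)
  obtain L where "L-lipschitz_on {a..0} (\<zeta> t)"
    using regular assms a unfolding regular_right_of_front_def
    by (metis atLeastAtMost_iff compact_Icc greaterThanAtMost_iff less_le_trans subsetI)
  then have "continuous_on {a..0} (\<zeta> t)" by (rule lipschitz_on_continuous_on)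
  then have "continuous (at q within {a..0}) (\<zeta> t)"
    using q a by (auto simp: continuous_on_eq_continuous_within)
  moreover have "at q within {a..0} = at q within {Y t<..0}"
    by (rule at_within_nhd[of q "{a<..}"]) (use a q in auto)
  ultimately show "continuous (at q within {Y t<..0}) (\<zeta> t)" by simp
qed

text \<open>The value of \<open>\<zeta>\<close> at the front itself is not determined by the hypotheses, so it is
  replaced by \<open>0\<close>; this makes the profile monotone.\<close>

definition y :: "real \<Rightarrow> real \<Rightarrow> real" where
  "y t q = (if q \<le> Y t then 0 else \<zeta> t q)"

lemma y_range: "t > 0 \<Longrightarrow> 0 \<le> y t q \<and> y t q \<le> 1"
  using zeta_range[of t q] by (simp add: y_def)

lemma y_mono: "t > 0 \<Longrightarrow> q \<le> r \<Longrightarrow> r \<le> 0 \<Longrightarrow> y t q \<le> y t r"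
  using zeta_range[of t r] zeta_mono[of t q r] by (auto simp: y_def)

lemma z_eq_y:
  assumes t: "t > 0"
  shows "AE v in lborel. -D < Q t v \<and> Q t v < 0 \<longrightarrow> z t v = y t (Q t v)"
proof (rule AE_lborel_unless_single)
  have *: "-D < Q t v \<and> Q t v < 0 \<and> Q t v = Y t"
    if "\<not> (-D < Q t v \<and> Q t v < 0 \<longrightarrow> z t v = y t (Q t v))" for v
    using that zeta_Q[of t v] zeta_left[of t "Q t v"] t
    by (cases "Q t v" "Y t" rule: linorder_cases) (auto simp: y_def)
  fix u v
  assume "\<not> (-D < Q t u \<and> Q t u < 0 \<longrightarrow> z t u = y t (Q t u))"
    "\<not> (-D < Q t v \<and> Q t v < 0 \<longrightarrow> z t v = y t (Q t v))"
  from *[OF this(1)] *[OF this(2)] show "u = v" using Q_inj[of t u v] t by simp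
qed

lemma z_eq_1:
  assumes t: "t \<ge> 0"
  shows "AE v in lborel. 0 \<le> Q t v \<longrightarrow> z t v = 1"
proof (rule AE_lborel_unless_single)
  have *: "z t v < 1 \<and> Q t v = 0" if "\<not> (0 \<le> Q t v \<longrightarrow> z t v = 1)" for v
    using that z_range[OF t, of v] Q_le_0[OF t, of v] by auto
  fix u v
  assume "\<not> (0 \<le> Q t u \<longrightarrow> z t u = 1)" "\<not> (0 \<le> Q t v \<longrightarrow> z t v = 1)"
  from *[OF this(1)] *[OF this(2)] show "u = v"
    using Q_strict_mono_on_interval[OF t, of u v] Q_strict_mono_on_interval[OF t, of v u]
    by (cases u v rule: linorder_cases) auto
qed

text \<open>Since \<open>Q t\<close> is concave, uniform closeness of \<open>Q s\<close> and \<open>Q t\<close> forces closeness of the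
  slopes \<open>1 - y\<close>, up to a shift \<open>\<theta>\<close> of the argument.\<close>

lemma slope_sandwich:
  assumes st: "s > 0" "t > 0" and r: "\<And>u. \<bar>Q t u - Q s u\<bar> \<le> r" and \<theta>: "r < \<theta>"
    and q: "r < q + D" "q + \<theta> < 0"
  shows "(\<theta> - r) * (1 - y t (q + \<theta>)) \<le> (\<theta> + r) * (1 - y s q)"
proof -
  have r0: "r \<ge> 0" using r[of 0] by linarith
  obtain u0 where u0: "Q s u0 = q" using Q_attains[of s q] st q r0 \<theta> by auto
  obtain u1 where u1: "Q t u1 = q + \<theta>" using Q_attains[of t "q + \<theta>"] st q r0 \<theta> by auto
  have "Q t u0 < Q t u1" using r[of u0] u0 u1 \<theta> by linarith
  then have u: "u0 < u1" using Q_mono[of t u1 u0] st by (metis less_le_not_le linorder_not_le)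
  have "Q s u1 - Q s u0 \<le> (1 - y s q) * (u1 - u0)"
  proof (rule Q_diff_le)
    show "AE x in lborel. x \<in> {u0<..<u1} \<longrightarrow> 1 - z s x \<le> 1 - y s q"
      using z_eq_y[OF st(1)] z_eq_1[OF less_imp_le[OF st(1)]]
    proof (eventually_elim, intro impI)
      fix x assume a: "-D < Q s x \<and> Q s x < 0 \<longrightarrow> z s x = y s (Q s x)" "0 \<le> Q s x \<longrightarrow> z s x = 1"
        and x: "x \<in> {u0<..<u1}"
      have "Q s x \<ge> q" using Q_mono[of s u0 x] x u0 st by simp
      then show "1 - z s x \<le> 1 - y s q"
        using a y_mono[of s q "Q s x"] y_range[of s q] st q r0 by (cases "Q s x < 0") auto
    qed
  qed (use st u in auto)
  moreover have "\<theta> - r \<le> Q s u1 - Q s u0" using r[of u1] u0 u1 by linarith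
  ultimately have 1: "\<theta> - r \<le> (1 - y s q) * (u1 - u0)" by linarith
  have "(1 - y t (q + \<theta>)) * (u1 - u0) \<le> Q t u1 - Q t u0"
  proof (rule Q_diff_ge)
    show "AE x in lborel. x \<in> {u0<..<u1} \<longrightarrow> 1 - y t (q + \<theta>) \<le> 1 - z t x"
      using z_eq_y[OF st(2)]
    proof (eventually_elim, intro impI)
      fix x assume a: "-D < Q t x \<and> Q t x < 0 \<longrightarrow> z t x = y t (Q t x)"
        and x: "x \<in> {u0<..<u1}"
      have "Q t x \<le> q + \<theta>" using Q_mono[of t x u1] x u1 st by simp
      moreover have "-D < Q t x" using Q_mono[of t u0 x] x u0 st r[of u0] q by simp
      ultimately show "1 - y t (q + \<theta>) \<le> 1 - z t x"
        using a y_mono[of t "Q t x" "q + \<theta>"] st q by auto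
    qed
  qed (use st u in auto)
  moreover have "Q t u1 - Q t u0 \<le> \<theta> + r" using r[of u0] u0 u1 by linarith
  ultimately have 2: "(1 - y t (q + \<theta>)) * (u1 - u0) \<le> \<theta> + r" by linarith
  have "(\<theta> - r) * (1 - y t (q + \<theta>)) \<le> (1 - y s q) * (u1 - u0) * (1 - y t (q + \<theta>))"
    using 1 y_range[OF st(2)] by (intro mult_right_mono) auto
  also have "\<dots> = (1 - y s q) * ((1 - y t (q + \<theta>)) * (u1 - u0))" by simp
  also have "\<dots> \<le> (1 - y s q) * (\<theta> + r)"
    using 2 y_range[OF st(1)] by (intro mult_left_mono) auto
  finally show ?thesis by (simp add: mult.commute)
qed

lemma y_shift:
  assumes t: "t > 0" and \<theta>: "\<theta> > 0" and \<epsilon>: "\<epsilon> > 0"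
  obtains d where "d > 0" "d < t"
    "\<And>s q. \<bar>s - t\<bar> < d \<Longrightarrow> -D + \<theta> \<le> q \<Longrightarrow> q + \<theta> < 0 \<Longrightarrow> y s q \<le> y t (q + \<theta>) + \<epsilon>"
    "\<And>s q. \<bar>s - t\<bar> < d \<Longrightarrow> -D + \<theta> \<le> q \<Longrightarrow> q + \<theta> < 0 \<Longrightarrow> y t q \<le> y s (q + \<theta>) + \<epsilon>"
proof -
  obtain L where L: "L > 0"
    "\<forall>s\<in>{0..2 * t}. \<forall>t'\<in>{0..2 * t}. \<forall>u. \<bar>Q t' u - Q s u\<bar> \<le> L * \<bar>t' - s\<bar>"
    using Q_time_lipschitz[of "2 * t"] t by auto
  define r where "r = min (\<theta> / 2) (\<epsilon> * \<theta> / 2)"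
  define d where "d = min (t / 2) (r / L)"
  have r: "r > 0" "r < \<theta>" "2 * r \<le> \<epsilon> * \<theta>" using \<theta> \<epsilon> by (auto simp: r_def min_def)
  have *: "y s q \<le> y t' (q + \<theta>) + \<epsilon>"
    if "s > 0" "t' > 0" "\<And>u. \<bar>Q t' u - Q s u\<bar> \<le> r" "-D + \<theta> \<le> q" "q + \<theta> < 0" for s t' q
  proof -
    have "(\<theta> - r) * (1 - y t' (q + \<theta>)) \<le> (\<theta> + r) * (1 - y s q)"
      by (rule slope_sandwich) (use that r in auto)
    then have "\<theta> * (y s q - y t' (q + \<theta>)) \<le> r * ((1 - y s q) + (1 - y t' (q + \<theta>)))"
      by (simp add: algebra_simps)
    also have "\<dots> \<le> r * 2"
      using r y_range[of s q] y_range[of t' "q + \<theta>"] that by (intro mult_left_mono) auto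
    also have "\<dots> \<le> \<theta> * \<epsilon>" using r by (simp add: mult.commute)
    finally show ?thesis using \<theta> by simp
  qed
  have close: "s > 0 \<and> \<bar>Q t u - Q s u\<bar> \<le> r \<and> \<bar>Q s u - Q t u\<bar> \<le> r" if "\<bar>s - t\<bar> < d" for s u
  proof -
    have s: "0 < s" "s \<le> 2 * t" "L * \<bar>t - s\<bar> \<le> r"
    proof -
      have "\<bar>s - t\<bar> < t / 2" "\<bar>t - s\<bar> < r / L" using that by (auto simp: d_def)
      then show "0 < s" "s \<le> 2 * t" "L * \<bar>t - s\<bar> \<le> r"
        using t L(1) by (linarith, linarith, simp add: field_simps)
    qed
    moreover have "\<bar>Q t u - Q s u\<bar> \<le> L * \<bar>t - s\<bar>"
      using L(2)[rule_format, of s t u] s t by simp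
    ultimately have "\<bar>Q t u - Q s u\<bar> \<le> r" by linarith
    then show ?thesis using s by (simp add: abs_minus_commute)
  qed
  show thesis
  proof (rule that)
    show "d > 0" "d < t" using t r L by (auto simp: d_def)
    show "y s q \<le> y t (q + \<theta>) + \<epsilon>" if "\<bar>s - t\<bar> < d" "-D + \<theta> \<le> q" "q + \<theta> < 0" for s q
      by (rule *) (use close that t in auto)
    show "y t q \<le> y s (q + \<theta>) + \<epsilon>" if "\<bar>s - t\<bar> < d" "-D + \<theta> \<le> q" "q + \<theta> < 0" for s q
      by (rule *) (use close that t in auto)
  qed
qed

end

section \<open>Continuity in time and characteristics\<close>

lemma backward_growth:
  fixes f :: "real \<Rightarrow> real"
  assumes usc: "\<And>s w. t0 \<le> s \<Longrightarrow> s < T \<Longrightarrow> f s < w \<Longrightarrow> \<forall>\<^sub>F \<tau> in at_right s. f \<tau> < w"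
    and step: "\<And>t. t0 < t \<Longrightarrow> t \<le> T \<Longrightarrow> f t > ylow \<Longrightarrow> \<exists>s. t0 \<le> s \<and> s < t \<and> f t + v * (t - s) \<le> f s"
    and "t0 \<le> T" "v \<ge> 0" "f T > ylow"
  shows "f T + v * (T - t0) \<le> f t0"
proof -
  define S where "S = {s. t0 \<le> s \<and> s \<le> T \<and> f T + v * (T - s) \<le> f s}"
  define i where "i = Inf S"
  have T: "T \<in> S" using assms by (simp add: S_def)
  have bdd: "bdd_below S" by (auto simp: S_def intro!: bdd_belowI[of _ t0])
  have i: "t0 \<le> i" "i \<le> T"
    unfolding i_def by (rule cInf_greatest cInf_lower[OF T bdd]; use T in \<open>auto simp: S_def\<close>)+
  have iS: "i \<in> S"
  proof (rule ccontr)
    assume *: "i \<notin> S"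
    then have iT: "i < T" using i T by (cases "i = T") auto
    define u where "u = f T + v * (T - i)"
    define w where "w = (f i + u) / 2"
    have "f i < u" using * i by (simp add: S_def u_def)
    then have w: "f i < w" "w < u" by (auto simp: w_def)
    have "((\<lambda>\<tau>. f T + v * (T - \<tau>)) \<longlongrightarrow> u) (at_right i)"
      unfolding u_def by (intro tendsto_intros)
    then have "\<forall>\<^sub>F \<tau> in at_right i. w < f T + v * (T - \<tau>)"
      using w(2) by (simp add: order_tendsto_iff)
    then have "\<forall>\<^sub>F \<tau> in at_right i. \<tau> \<notin> S"
      using usc[OF i(1) iT w(1)] by eventually_elim (auto simp: S_def)
    then obtain b where b: "i < b" "\<And>\<tau>. i < \<tau> \<Longrightarrow> \<tau> < b \<Longrightarrow> \<tau> \<notin> S"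
      by (auto simp: eventually_at_right_field)
    have "Inf S < b" using b by (simp add: i_def)
    then obtain \<tau> where "\<tau> \<in> S" "\<tau> < b" using T cInf_lessD[of S b] by blast
    moreover have "i \<le> \<tau>" using cInf_lower[OF \<open>\<tau> \<in> S\<close> bdd] by (simp add: i_def)
    ultimately show False using b(2)[of \<tau>] * by (cases "\<tau> = i") auto
  qed
  have "i = t0"
  proof (rule ccontr)
    assume "i \<noteq> t0"
    then have "t0 < i" using i by simp
    moreover have "f i > ylow"
    proof -
      have "0 \<le> v * (T - i)" using assms i by simp
      then show ?thesis using iS assms(5) by (simp add: S_def)
    qed
    ultimately obtain s where s: "t0 \<le> s" "s < i" "f i + v * (i - s) \<le> f s"
      using step i by blast
    then have "s \<in> S" using iS i by (simp add: S_def algebra_simps)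
    then show False using cInf_lower[OF _ bdd, of s] s by (simp add: i_def)
  qed
  then show ?thesis using iS by (simp add: S_def)
qed

lemma forward_growth:
  fixes f :: "real \<Rightarrow> real"
  assumes usc: "\<And>s w. t0 < s \<Longrightarrow> s \<le> T \<Longrightarrow> f s < w \<Longrightarrow> \<forall>\<^sub>F \<tau> in at_left s. f \<tau> < w"
    and step: "\<And>t. t0 \<le> t \<Longrightarrow> t < T \<Longrightarrow> f t < ylow \<Longrightarrow> \<exists>s. t < s \<and> s \<le> T \<and> f t + v * (s - t) \<le> f s"
    and stay: "\<And>t. t0 \<le> t \<Longrightarrow> t < T \<Longrightarrow> f t \<ge> ylow \<Longrightarrow> \<exists>s. t < s \<and> s \<le> T \<and> ylow \<le> f s"
    and "t0 \<le> T"
  shows "min ylow (f t0 + v * (T - t0)) \<le> f T"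
proof -
  define b where "b = (\<lambda>\<tau>. min ylow (f t0 + v * (\<tau> - t0)))"
  define S where "S = {s. t0 \<le> s \<and> s \<le> T \<and> b s \<le> f s}"
  define i where "i = Sup S"
  have T: "t0 \<in> S" using assms by (simp add: S_def b_def)
  have bdd: "bdd_above S" by (auto simp: S_def intro!: bdd_aboveI[of _ T])
  have i: "t0 \<le> i" "i \<le> T"
    unfolding i_def by (rule cSup_upper[OF T bdd] cSup_least; use T in \<open>auto simp: S_def\<close>)+
  have iS: "i \<in> S"
  proof (rule ccontr)
    assume *: "i \<notin> S"
    then have iT: "t0 < i" using i T by (cases "i = t0") auto
    define w where "w = (f i + b i) / 2"
    have "f i < b i" using * i by (simp add: S_def)
    then have w: "f i < w" "w < b i" by (auto simp: w_def)
    have "(b \<longlongrightarrow> b i) (at_left i)"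
      unfolding b_def by (intro tendsto_intros)
    then have "\<forall>\<^sub>F \<tau> in at_left i. w < b \<tau>"
      using w(2) by (simp add: order_tendsto_iff)
    then have "\<forall>\<^sub>F \<tau> in at_left i. \<tau> \<notin> S"
      using usc[OF iT i(2) w(1)] by eventually_elim (auto simp: S_def)
    then obtain a where a: "a < i" "\<And>\<tau>. a < \<tau> \<Longrightarrow> \<tau> < i \<Longrightarrow> \<tau> \<notin> S"
      by (auto simp: eventually_at_left_field)
    have "a < Sup S" using a by (simp add: i_def)
    then obtain \<tau> where "\<tau> \<in> S" "a < \<tau>" using T less_cSupD[of S a] by blast
    moreover have "\<tau> \<le> i" using cSup_upper[OF \<open>\<tau> \<in> S\<close> bdd] by (simp add: i_def)
    ultimately show False using a(2)[of \<tau>] * by (cases "\<tau> = i") auto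
  qed
  have "i = T"
  proof (rule ccontr)
    assume "i \<noteq> T"
    then have iT: "i < T" using i by simp
    have "\<exists>s. i < s \<and> s \<in> S"
    proof (cases "f i < ylow")
      case True
      then obtain s where s: "i < s" "s \<le> T" "f i + v * (s - i) \<le> f s" using step i iT by blast
      have "f t0 + v * (i - t0) \<le> f i" using iS True by (auto simp: S_def b_def min_def split: if_splits)
      then have "f t0 + v * (s - t0) \<le> f s" using s by (simp add: algebra_simps)
      then show ?thesis using s i by (auto simp: S_def b_def)
    next
      case False
      then obtain s where "i < s" "s \<le> T" "ylow \<le> f s" using stay[of i] i iT by auto
      then show ?thesis using i by (auto simp: S_def b_def)
    qed
    then show False using cSup_upper[OF _ bdd] by (auto simp: i_def not_le[symmetric])
  qed
  then show ?thesis using iS by (simp add: S_def b_def)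
qed

context flow
begin

lemma front_usc:
  assumes t: "t > 0" and w: "Y t < w"
  shows "\<forall>\<^sub>F s in nhds t. Y s < w"
proof (cases "w > 0")
  case True
  then have "Y s < w" for s using front_bounds(2)[of s] by linarith
  then show ?thesis by simp
next
  case False
  define \<theta> where "\<theta> = (w - Y t) / 3"
  have \<theta>: "\<theta> > 0" "Y t + \<theta> + \<theta> < w" using w by (auto simp: \<theta>_def field_simps)
  define e where "e = y t (Y t + \<theta>) / 2"
  have e: "e > 0" using zeta_pos[of t "Y t + \<theta>"] t \<theta> False by (auto simp: e_def y_def)
  obtain d where d: "d > 0"
    "\<And>s q. \<bar>s - t\<bar> < d \<Longrightarrow> -D + \<theta> \<le> q \<Longrightarrow> q + \<theta> < 0 \<Longrightarrow> y t q \<le> y s (q + \<theta>) + e"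
    using y_shift[OF t \<theta>(1) e] by metis
  have "Y s < w" if "\<bar>s - t\<bar> < d" for s
  proof -
    have "y t (Y t + \<theta>) \<le> y s (Y t + \<theta> + \<theta>) + e"
      by (rule d) (use that \<theta> False front_bounds(1)[of t] in auto)
    then have "y s (Y t + \<theta> + \<theta>) > 0" using e by (simp add: e_def)
    then show ?thesis using \<theta> by (auto simp: y_def split: if_splits)
  qed
  then show ?thesis using d(1) by (auto simp: eventually_nhds_metric dist_real_def)
qed

lemma zeta_near:
  assumes t: "t > 0" and q: "Y t < q" "q \<le> 0" and e: "e > 0"
  obtains d where "d > 0"
    "\<And>s r. \<bar>s - t\<bar> < d \<Longrightarrow> \<bar>r - q\<bar> < d \<Longrightarrow> r \<le> 0 \<Longrightarrow> Y s < r \<and> \<bar>\<zeta> s r - \<zeta> t q\<bar> < e"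
proof -
  obtain \<eta>0 where \<eta>0: "\<eta>0 > 0"
    "\<And>r. r \<in> {Y t<..0} \<Longrightarrow> \<bar>r - q\<bar> < \<eta>0 \<Longrightarrow> \<bar>\<zeta> t r - \<zeta> t q\<bar> < e / 2"
    using zeta_cont[OF t] q e unfolding continuous_on_iff dist_real_def
    by (metis greaterThanAtMost_iff half_gt_zero)
  define \<eta> where "\<eta> = min \<eta>0 (q - Y t)"
  have \<eta>: "\<eta> > 0" using \<eta>0 q by (simp add: \<eta>_def)
  have near: "\<zeta> t r < \<zeta> t q + e / 2 \<and> \<zeta> t q < \<zeta> t r + e / 2" if "\<bar>r - q\<bar> < \<eta>" "r \<le> 0" for r
  proof -
    have "\<bar>\<zeta> t r - \<zeta> t q\<bar> < e / 2" using \<eta>0(2)[of r] that by (auto simp: \<eta>_def)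
    then show ?thesis by linarith
  qed
  have pos: "Y t < r" if "\<bar>r - q\<bar> < \<eta>" for r using that by (auto simp: \<eta>_def)
  define \<theta> where "\<theta> = \<eta> / 4"
  have \<theta>: "\<theta> > 0" using \<eta> by (simp add: \<theta>_def)
  obtain d where d: "d > 0" "d < t"
    "\<And>s q. \<bar>s - t\<bar> < d \<Longrightarrow> -D + \<theta> \<le> q \<Longrightarrow> q + \<theta> < 0 \<Longrightarrow> y s q \<le> y t (q + \<theta>) + e / 2"
    "\<And>s q. \<bar>s - t\<bar> < d \<Longrightarrow> -D + \<theta> \<le> q \<Longrightarrow> q + \<theta> < 0 \<Longrightarrow> y t q \<le> y s (q + \<theta>) + e / 2"
    using y_shift[OF t \<theta>, of "e / 2"] e by (metis half_gt_zero)
  have "Y t < q - \<theta>" using pos[of "q - \<theta>"] \<theta> by (simp add: \<theta>_def)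
  from front_usc[OF t this] obtain d' where d': "d' > 0" "\<And>s. \<bar>s - t\<bar> < d' \<Longrightarrow> Y s < q - \<theta>"
    by (auto simp: eventually_nhds_metric dist_real_def)
  define d0 where "d0 = min (min d d') \<theta>"
  show thesis
  proof (rule that)
    show "d0 > 0" using d d' \<theta> by (simp add: d0_def)
    fix s r assume s: "\<bar>s - t\<bar> < d0" and r: "\<bar>r - q\<bar> < d0" "r \<le> 0"
    have s': "s > 0"
    proof -
      have "\<bar>s - t\<bar> < t" using s d by (simp add: d0_def)
      then show ?thesis by linarith
    qed
    have Y: "Y s < r" using d'(2)[of s] s r by (auto simp: d0_def)
    have rq: "\<bar>r - q\<bar> < \<eta> / 4" "\<eta> \<le> q - Y t" using r(1) by (auto simp: d0_def \<theta>_def \<eta>_def)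
    then have bnd: "-D + 2 * \<theta> \<le> r"
      using front_bounds(1)[of t] unfolding \<theta>_def by linarith
    have "\<zeta> s r < \<zeta> t q + e"
    proof (cases "r + \<theta> < 0")
      case True
      have "y s r \<le> y t (r + \<theta>) + e / 2" by (rule d) (use s True bnd \<theta> in \<open>auto simp: d0_def\<close>)
      moreover have *: "\<bar>r + \<theta> - q\<bar> < \<eta>" using rq \<eta> unfolding \<theta>_def by linarith
      ultimately show ?thesis using near[OF *] True pos[OF *] Y by (simp add: y_def)
    next
      case False
      have "\<bar>0 - q\<bar> < \<eta>" using rq \<eta> False q unfolding \<theta>_def by linarith
      from near[OF this] show ?thesis using zeta_range[of s r] s' e by simp
    qed
    moreover have "\<zeta> t q < \<zeta> s r + e"
    proof (cases "r = 0")
      case True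
      then show ?thesis using zeta_range[of t q] t e by simp
    next
      case False
      have "y t (r - \<theta>) \<le> y s (r - \<theta> + \<theta>) + e / 2"
        by (rule d) (use s False r bnd in \<open>auto simp: d0_def\<close>)
      moreover have *: "\<bar>r - \<theta> - q\<bar> < \<eta>" using rq \<eta> unfolding \<theta>_def by linarith
      ultimately show ?thesis using near[OF *] pos[OF *] Y r \<theta>
        by (simp add: y_def)
    qed
    ultimately show "Y s < r \<and> \<bar>\<zeta> s r - \<zeta> t q\<bar> < e" using Y by auto
  qed
qed

lemma zeta_tendsto:
  assumes t: "t > 0" and q: "Y t < q" "q \<le> 0"
    and s: "(s \<longlongrightarrow> t) X" and r: "(r \<longlongrightarrow> q) X" and le: "\<forall>\<^sub>F i in X. r i \<le> 0"
  shows "((\<lambda>i. \<zeta> (s i) (r i)) \<longlongrightarrow> \<zeta> t q) X" and "\<forall>\<^sub>F i in X. Y (s i) < r i"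
proof -
  have *: "\<forall>\<^sub>F i in X. Y (s i) < r i \<and> \<bar>\<zeta> (s i) (r i) - \<zeta> t q\<bar> < e" if e: "e > 0" for e
  proof -
    obtain d where d: "d > 0"
      "\<And>s r. \<bar>s - t\<bar> < d \<Longrightarrow> \<bar>r - q\<bar> < d \<Longrightarrow> r \<le> 0 \<Longrightarrow> Y s < r \<and> \<bar>\<zeta> s r - \<zeta> t q\<bar> < e"
      using zeta_near[OF t q e] by metis
    show ?thesis
      using tendstoD[OF s d(1)] tendstoD[OF r d(1)] le
      by eventually_elim (auto simp: dist_real_def d(2))
  qed
  show "((\<lambda>i. \<zeta> (s i) (r i)) \<longlongrightarrow> \<zeta> t q) X"
  proof (rule tendstoI)
    fix e :: real assume "e > 0"
    from *[OF this] show "\<forall>\<^sub>F i in X. dist (\<zeta> (s i) (r i)) (\<zeta> t q) < e"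
      by eventually_elim (simp add: dist_real_def)
  qed
  show "\<forall>\<^sub>F i in X. Y (s i) < r i"
    using *[of 1] by (auto elim: eventually_mono)
qed

definition \<kappa> :: real where "\<kappa> = 1 / h 1"

text \<open>The Riemann invariant: constant along characteristics.\<close>

definition k :: "real \<Rightarrow> real \<Rightarrow> real" where "k t q = q + 1 / h (\<zeta> t q)"

lemma k_0 [simp]: "k t 0 = \<kappa>"
  by (simp add: k_def \<kappa>_def)

lemma \<kappa>_pos: "\<kappa> > 0"
  by (simp add: \<kappa>_def h_1_pos)

lemma h_zeta_pos: "t > 0 \<Longrightarrow> Y t < q \<Longrightarrow> q \<le> 0 \<Longrightarrow> h (\<zeta> t q) > 0"
  using zeta_pos[of t q] zeta_range[of t q] by (intro h_pos) auto

lemma isCont_h: "x > 0 \<Longrightarrow> isCont h x"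
  using cont_h continuous_on_interior[of "{0..}" h x] by simp

lemma isCont_V: "x > 0 \<Longrightarrow> isCont V x"
  using cont_V continuous_on_interior[of "{0..}" V x] by simp

lemma k_tendsto:
  assumes t: "t > 0" and q: "Y t < q" "q \<le> 0"
    and s: "(s \<longlongrightarrow> t) X" and r: "(r \<longlongrightarrow> q) X" and le: "\<forall>\<^sub>F i in X. r i \<le> 0"
  shows "((\<lambda>i. k (s i) (r i)) \<longlongrightarrow> k t q) X"
proof -
  have "((\<lambda>i. h (\<zeta> (s i) (r i))) \<longlongrightarrow> h (\<zeta> t q)) X"
    by (rule isCont_tendsto_compose[OF isCont_h zeta_tendsto(1)]) (use assms zeta_pos in auto)
  then show ?thesis
    unfolding k_def using h_zeta_pos[OF t q] by (intro tendsto_intros r) auto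
qed

lemma k_shift:
  assumes t: "t > 0" and "Y t < q" "q \<le> r" "r \<le> 0"
  shows "k t r \<le> k t q + (r - q)"
proof -
  have "h (\<zeta> t q) \<le> h (\<zeta> t r)"
    using zeta_mono[of t q r] zeta_pos[of t q] zeta_range[of t r] assms by (intro h_mono) auto
  then have "1 / h (\<zeta> t r) \<le> 1 / h (\<zeta> t q)"
    using h_zeta_pos[of t q] assms by (simp add: frac_le)
  then show ?thesis by (simp add: k_def)
qed

lemma zeta_measurable:
  assumes t: "t > 0"
  shows "\<zeta> t \<in> borel_measurable borel"
proof -
  define m where "m = (\<lambda>q. if q \<le> -D then 0 else if q < 0 then y t q else 1)"
  have "mono m"
    by (rule monoI) (use y_range[OF t] y_mono[OF t] in \<open>auto simp: m_def\<close>)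
  then have m: "m \<in> borel_measurable borel" by (rule borel_measurable_mono)
  have eq: "\<zeta> t = (\<lambda>q. if q = Y t then \<zeta> t (Y t) else if -D < q \<and> q < 0 then m q else 1)"
  proof
    fix q
    consider "q = Y t" | "q \<noteq> Y t" "-D < q" "q < 0" | "q \<noteq> Y t" "\<not> (-D < q \<and> q < 0)" by blast
    then show "\<zeta> t q = (if q = Y t then \<zeta> t (Y t) else if -D < q \<and> q < 0 then m q else 1)"
    proof cases
      case 2
      then show ?thesis using zeta_left[of t q] t by (cases "q < Y t") (auto simp: m_def y_def)
    qed (auto simp: zeta_def)
  qed
  show ?thesis by (subst eq) (use m in measurable)
qed

lemma h_zeta_measurable:
  assumes t: "t > 0"
  shows "(\<lambda>q. h (\<zeta> t q)) \<in> borel_measurable borel"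
proof -
  have "continuous_on UNIV (\<lambda>x. h (max 0 x))"
    by (intro continuous_on_compose2[OF cont_h] continuous_intros) auto
  then have "(\<lambda>x. h (max 0 x)) \<in> borel_measurable borel"
    by (rule borel_measurable_continuous_onI)
  from measurable_compose[OF zeta_measurable[OF t] this] show ?thesis
    using zeta_range[of t] t by (simp add: max_def)
qed

lemma h_zeta_range: "t \<ge> 0 \<Longrightarrow> 0 \<le> h (\<zeta> t q) \<and> h (\<zeta> t q) \<le> h 1"
  using zeta_range[of t q] h_nonneg[of "\<zeta> t q"] h_mono[of "\<zeta> t q" 1] by auto

lemma h_zeta_integrable:
  assumes "t > 0"
  shows "set_integrable lborel {a..b} (\<lambda>q. h (\<zeta> t q))"
  unfolding set_integrable_def
  by (rule integrableI_bounded_set_indicator[where B = "h 1"])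
    (use assms h_zeta_measurable[OF assms] h_zeta_range[of t] emeasure_lborel_Icc_eq in
      \<open>auto simp: emeasure_lborel_Icc_eq\<close>)

lemma F_ge_1: "t \<ge> 0 \<Longrightarrow> F t q \<ge> 1"
  unfolding Ffun_def set_lebesgue_integral_def
  by (simp add: Bochner_Integration.integral_nonneg h_zeta_range indicator_def)

lemma F_anti:
  assumes t: "t > 0" and "q \<le> r"
  shows "F t r \<le> F t q"
  unfolding Ffun_def exp_le_cancel_iff set_lebesgue_integral_def
proof (rule Bochner_Integration.integral_mono)
  show "integrable lborel (\<lambda>x. indicator {q..0} x *\<^sub>R h (\<zeta> t x))"
    "integrable lborel (\<lambda>x. indicator {r..0} x *\<^sub>R h (\<zeta> t x))"
    using h_zeta_integrable[OF t] by (auto simp: set_integrable_def)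
qed (use h_zeta_range[of t] assms in \<open>auto simp: indicator_def\<close>)

lemma F_tendsto:
  assumes t: "t > 0" and q: "Y t \<le> q"
  shows "((\<lambda>s. F s q) \<longlongrightarrow> F t q) (at t)"
  unfolding tendsto_at_iff_sequentially comp_def
proof (intro allI impI)
  fix s :: "nat \<Rightarrow> real" assume "\<forall>i. s i \<in> UNIV - {t}" and s: "s \<longlonglongrightarrow> t"
  have "\<forall>\<^sub>F i in sequentially. s i > 0" using s t by (simp add: order_tendsto_iff)
  then obtain N where N: "\<And>i. i \<ge> N \<Longrightarrow> s i > 0" by (auto simp: eventually_sequentially)
  have s': "(\<lambda>i. s (i + N)) \<longlonglongrightarrow> t" using s by (rule LIMSEQ_ignore_initial_segment)
  have "(\<lambda>i. LINT x|lborel. indicator {q..0} x *\<^sub>R h (\<zeta> (s (i + N)) x))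
    \<longlonglongrightarrow> (LINT x|lborel. indicator {q..0} x *\<^sub>R h (\<zeta> t x))"
  proof (rule integral_dominated_convergence[where w = "\<lambda>x. indicator {q..0} x *\<^sub>R h 1"])
    show "integrable lborel (\<lambda>x. indicator {q..0} x *\<^sub>R h 1)"
      by (intro integrable_scaleR_left integrable_real_indicator) (auto simp: emeasure_lborel_Icc_eq)
    show "AE x in lborel. (\<lambda>i. indicator {q..0} x *\<^sub>R h (\<zeta> (s (i + N)) x))
        \<longlonglongrightarrow> indicator {q..0} x *\<^sub>R h (\<zeta> t x)"
      using AE_lborel_singleton[of q]
    proof eventually_elim
      fix x assume x: "x \<noteq> q"
      show "(\<lambda>i. indicator {q..0} x *\<^sub>R h (\<zeta> (s (i + N)) x)) \<longlonglongrightarrow> indicator {q..0} x *\<^sub>R h (\<zeta> t x)"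
      proof (cases "x \<in> {q..0}")
        case True
        then have x': "Y t < x" "x \<le> 0" using x q by auto
        have "(\<lambda>i. h (\<zeta> (s (i + N)) x)) \<longlonglongrightarrow> h (\<zeta> t x)"
          by (rule isCont_tendsto_compose[OF isCont_h zeta_tendsto(1)[OF t x' s']])
            (use zeta_pos t x' in auto)
        then show ?thesis using True by simp
      qed simp
    qed
  qed (use h_zeta_measurable t N h_zeta_range in \<open>auto simp: indicator_def less_imp_le\<close>)
  then have "(\<lambda>i. F (s (i + N)) q) \<longlonglongrightarrow> F t q"
    unfolding Ffun_def set_lebesgue_integral_def by (rule tendsto_exp)
  then show "(\<lambda>i. F (s i) q) \<longlonglongrightarrow> F t q" by (rule LIMSEQ_offset)
qed

lemma front_state_at_0: "Y t = 0 \<Longrightarrow> zp t = 1"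
proof -
  assume "Y t = 0"
  moreover have "(\<zeta> t \<longlongrightarrow> 1) (at_right 0)"
    by (rule tendsto_eventually) (simp add: eventually_at_filter zeta_def)
  ultimately show ?thesis unfolding front_state_def by (simp add: tendsto_Lim)
qed

lemma front_state_tendsto:
  assumes t: "t > 0" and "Y t < 0"
  shows "(\<zeta> t \<longlongrightarrow> zp t) (at_right (Y t))"
proof -
  have "(\<zeta> t \<longlongrightarrow> Inf (\<zeta> t ` ({Y t<..} \<inter> {..0}))) (at (Y t) within ({Y t<..} \<inter> {..0}))"
    by (rule Lim_right_bound[where K = 0])
      (use zeta_mono[OF t] zeta_range[of t] t in auto)
  moreover have "at (Y t) within ({Y t<..} \<inter> {..0}) = at_right (Y t)"
    by (rule at_within_nhd[of _ "{..<0}"]) (use assms in auto)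
  ultimately show ?thesis unfolding front_state_def by (simp add: tendsto_Lim)
qed

lemma front_state_le:
  assumes t: "t > 0" and "Y t < q" "q \<le> 0"
  shows "zp t \<le> \<zeta> t q"
proof -
  have "\<forall>\<^sub>F r in at_right (Y t). \<zeta> t r \<le> \<zeta> t q"
    using eventually_at_right_less[of "Y t"] eventually_at_right_real[OF assms(2)]
    by eventually_elim (use zeta_mono[OF t] assms in auto)
  then show ?thesis
    using tendsto_upperbound[OF front_state_tendsto[OF t]] assms by auto
qed

lemma front_state_ge:
  assumes t: "t > 0" and "Y t < 0" and "\<And>q. Y t < q \<Longrightarrow> q < 0 \<Longrightarrow> c \<le> \<zeta> t q"
  shows "c \<le> zp t"
proof -
  have "\<forall>\<^sub>F r in at_right (Y t). c \<le> \<zeta> t r"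
    using eventually_at_right_real[OF assms(2)] by eventually_elim (use assms in auto)
  then show ?thesis
    using tendsto_lowerbound[OF front_state_tendsto[OF t]] assms by auto
qed

lemma front_state_range: "t > 0 \<Longrightarrow> 0 \<le> zp t \<and> zp t \<le> 1"
  using front_state_at_0[of t] front_state_ge[of t 0] front_state_le[of t 0] front_bounds[of t] zeta_range[of t]
  by (cases "Y t = 0") force+

lemma characteristic:
  assumes t: "t > 0" and q: "Y t < q" "q < 0" and v: "v < V (\<zeta> t q) * F t q" and \<eta>: "\<eta> > 0"
  shows "\<forall>\<^sub>F s in at_left t. \<exists>c. Y s < c \<and> c < 0 \<and> k s c = k t q \<and> q + v * (t - s) \<le> c \<and> c < q + \<eta>"
proof -
  have "\<exists>d>0. \<exists>c. c t = q \<and> (\<forall>s. \<bar>s - t\<bar> < d \<longrightarrow> s > 0 \<and> Y s < c s \<and> c s < 0 \<and>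
       (c has_real_derivative - (1 - \<zeta> s (c s))\<^sup>2 * deriv h (\<zeta> s (c s)) * F s (c s)) (at s) \<and>
       ((\<lambda>r. \<zeta> r (c r)) has_real_derivative - (1 - \<zeta> s (c s))\<^sup>2 * (h (\<zeta> s (c s)))\<^sup>2 * F s (c s)) (at s))"
    using smooth t q unfolding smooth_law_def by simp
  then obtain d c where d: "d > 0" and ct: "c t = q"
    and c: "\<And>s. \<bar>s - t\<bar> < d \<Longrightarrow> s > 0 \<and> Y s < c s \<and> c s < 0 \<and>
       (c has_real_derivative - (1 - \<zeta> s (c s))\<^sup>2 * deriv h (\<zeta> s (c s)) * F s (c s)) (at s) \<and>
       ((\<lambda>r. \<zeta> r (c r)) has_real_derivative - (1 - \<zeta> s (c s))\<^sup>2 * (h (\<zeta> s (c s)))\<^sup>2 * F s (c s)) (at s)"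
    by blast
  have state: "0 < \<zeta> s (c s)" "\<zeta> s (c s) < 1" "h (\<zeta> s (c s)) > 0" if "\<bar>s - t\<bar> < d" for s
    using zeta_pos[of s "c s"] zeta_less_1[of s "c s"] h_zeta_pos[of s "c s"] c[OF that] by auto
  have "((\<lambda>s. k s (c s)) has_real_derivative 0) (at s)" if s: "\<bar>s - t\<bar> < d" for s
  proof -
    let ?z = "\<zeta> s (c s)"
    define V' where "V' = (1 - ?z)\<^sup>2 * F s (c s)"
    define dh where "dh = deriv h ?z"
    have "((\<lambda>r. h (\<zeta> r (c r))) has_real_derivative dh * (- V' * (h ?z)\<^sup>2)) (at s)"
    proof (rule DERIV_chain2[where f = h])
      show "(h has_real_derivative dh) (at ?z)"
        using h_at[of ?z] deriv_h[of ?z] state[OF s] by (simp add: dh_def)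
      show "((\<lambda>r. \<zeta> r (c r)) has_real_derivative - V' * (h ?z)\<^sup>2) (at s)"
        using c[OF s] by (simp add: V'_def algebra_simps)
    qed
    moreover have "(c has_real_derivative - V' * dh) (at s)"
      using c[OF s] by (simp add: V'_def dh_def algebra_simps)
    ultimately show ?thesis
      unfolding k_def using state[OF s]
      by (auto intro!: derivative_eq_intros simp: field_simps power2_eq_square)
  qed
  then have "\<exists>C. \<forall>s\<in>{t - d<..<t + d}. k s (c s) = C"
    by (intro has_field_derivative_zero_constant) (auto intro: has_field_derivative_at_within)
  then have const: "k s (c s) = k t q" if "\<bar>s - t\<bar> < d" for s
    using that d ct by force
  have "(c has_real_derivative - (V (\<zeta> t q) * F t q)) (at t)"
    using c[of t] d ct state[of t] V_eq[of "\<zeta> t q"] by (simp add: algebra_simps)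
  then have "((\<lambda>s. (c s - q) / (s - t)) \<longlongrightarrow> - (V (\<zeta> t q) * F t q)) (at t)"
    by (simp add: has_field_derivative_iff ct)
  then have 1: "\<forall>\<^sub>F s in at t. (c s - q) / (s - t) < - v"
    using v by (simp add: order_tendsto_iff)
  have "isCont c t" using c[of t] d DERIV_isCont by auto
  then have 2: "\<forall>\<^sub>F s in at t. c s < q + \<eta>"
    using \<eta> ct by (simp add: isCont_def order_tendsto_iff)
  have 3: "\<forall>\<^sub>F s in at t. \<bar>s - t\<bar> < d"
    using d by (auto simp: eventually_at dist_real_def)
  have 4: "\<forall>\<^sub>F s in at_left t. s < t" by (simp add: eventually_at_filter)
  have "\<forall>\<^sub>F s in at_left t. (c s - q) / (s - t) < - v \<and> c s < q + \<eta> \<and> \<bar>s - t\<bar> < d"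
    using 1 2 3 by (auto simp: eventually_at_split intro: eventually_conj)
  then show ?thesis
    using 4
  proof eventually_elim
    fix s assume s: "(c s - q) / (s - t) < - v \<and> c s < q + \<eta> \<and> \<bar>s - t\<bar> < d" "s < t"
    then have "- v * (s - t) < c s - q" by (simp add: neg_divide_less_eq)
    then show "\<exists>c. Y s < c \<and> c < 0 \<and> k s c = k t q \<and> q + v * (t - s) \<le> c \<and> c < q + \<eta>"
      using s c[of s] const[of s] by (intro exI[of _ "c s"]) (auto simp: algebra_simps)
  qed
qed

end

section \<open>The lower bound on the Riemann invariant\<close>

context flow
begin

definition level_set :: "(real \<Rightarrow> real \<Rightarrow> real) \<Rightarrow> real \<Rightarrow> real set" where
  "level_set W t = {q. Y t < q \<and> q < 0 \<and> W t q \<le> 0}"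

definition level_top :: "(real \<Rightarrow> real \<Rightarrow> real) \<Rightarrow> real \<Rightarrow> real" where
  "level_top W t = Sup (insert (Y t) (level_set W t))"

definition jointly_continuous :: "(real \<Rightarrow> real \<Rightarrow> real) \<Rightarrow> bool" where
  "jointly_continuous W \<longleftrightarrow> (\<forall>t q s r. t > 0 \<and> Y t < q \<and> q \<le> 0 \<and> s \<longlonglongrightarrow> t \<and> r \<longlonglongrightarrow> q \<and> (\<forall>n::nat. r n \<le> 0)
     \<longrightarrow> (\<lambda>n. W (s n) (r n)) \<longlonglongrightarrow> W t q)"

lemma jointly_continuousD:
  assumes "jointly_continuous W" "t > 0" "Y t < q" "q \<le> 0" "s \<longlonglongrightarrow> t" "r \<longlonglongrightarrow> q" "\<And>n::nat. r n \<le> 0"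
  shows "(\<lambda>n. W (s n) (r n)) \<longlonglongrightarrow> W t q"
  using assms unfolding jointly_continuous_def by blast

lemma bdd_level: "bdd_above (insert (Y t) (level_set W t))"
  using front_bounds(2)[of t] by (auto simp: level_set_def intro!: bdd_aboveI[where M = 0])

lemma front_le_top: "Y t \<le> level_top W t"
  unfolding level_top_def by (rule cSup_upper[OF _ bdd_level]) simp

lemma level_le_top: "q \<in> level_set W t \<Longrightarrow> q \<le> level_top W t"
  unfolding level_top_def by (rule cSup_upper[OF _ bdd_level]) simp

lemma top_leI: "Y t \<le> w \<Longrightarrow> (\<And>q. q \<in> level_set W t \<Longrightarrow> q \<le> w) \<Longrightarrow> level_top W t \<le> w"
  unfolding level_top_def by (rule cSup_least) auto

lemma top_le_0: "level_top W t \<le> 0"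
  by (rule top_leI) (auto simp: level_set_def front_bounds)

lemma top_empty: "level_set W t = {} \<Longrightarrow> level_top W t = Y t"
  by (simp add: level_top_def)

lemma top_mem:
  assumes t: "t > 0" and W: "jointly_continuous W" "W t 0 > 0" and ne: "level_set W t \<noteq> {}"
  shows "level_top W t \<in> level_set W t" "W t (level_top W t) = 0"
proof -
  let ?A = "level_set W t" and ?p = "level_top W t"
  obtain p where p: "p \<in> ?A" using ne by blast
  have Yp: "Y t < ?p" using p level_le_top[OF p] by (auto simp: level_set_def)
  have "\<exists>a\<in>?A. ?p - 1 / real (Suc n) < a" for n
  proof -
    have "?p - 1 / real (Suc n) < Sup (insert (Y t) ?A)" by (simp add: level_top_def)
    then obtain a where "a \<in> insert (Y t) ?A" "?p - 1 / real (Suc n) < a"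
      using less_cSupD[of "insert (Y t) ?A"] by blast
    then show ?thesis using p by (auto simp: level_set_def intro: bexI[of _ p])
  qed
  then obtain r where r: "\<And>n. r n \<in> ?A" "\<And>n. ?p - 1 / real (Suc n) < r n" by metis
  have "r \<longlonglongrightarrow> ?p"
  proof (rule tendsto_sandwich[where f = "\<lambda>n. ?p + - inverse (real (Suc n))" and h = "\<lambda>n. ?p"])
    show "(\<lambda>n. ?p + - inverse (real (Suc n))) \<longlonglongrightarrow> ?p" by (rule LIMSEQ_inverse_real_of_nat_add_minus)
    show "\<forall>\<^sub>F n in sequentially. ?p + - inverse (real (Suc n)) \<le> r n"
      using less_imp_le[OF r(2)] by (simp add: inverse_eq_divide)
    show "\<forall>\<^sub>F n in sequentially. r n \<le> ?p" using level_le_top[OF r(1)] by simp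
  qed simp
  then have lim: "(\<lambda>n. W t (r n)) \<longlonglongrightarrow> W t ?p"
    by (intro jointly_continuousD[OF W(1) t Yp top_le_0 tendsto_const])
      (use r(1) in \<open>auto simp: level_set_def intro: less_imp_le\<close>)
  have le: "W t ?p \<le> 0"
    by (rule LIMSEQ_le_const2[OF lim]) (use r(1) in \<open>auto simp: level_set_def\<close>)
  then have neg: "?p < 0" using W(2) top_le_0[of W t] by (cases "?p = 0") auto
  with le Yp show mem: "?p \<in> ?A" by (simp add: level_set_def)
  show "W t ?p = 0"
  proof (rule ccontr)
    assume "W t ?p \<noteq> 0"
    with le have "W t ?p < 0" by simp
    define r where "r = (\<lambda>n. ?p * (1 + - inverse (real (Suc n))))"
    have "r \<longlonglongrightarrow> ?p * 1"
      unfolding r_def by (intro tendsto_mult_left LIMSEQ_inverse_real_of_nat_add_minus)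
    moreover have r0: "?p < r n" "r n \<le> 0" for n
      using neg by (auto simp: r_def field_simps mult_le_0_iff)
    ultimately have "(\<lambda>n. W t (r n)) \<longlonglongrightarrow> W t ?p"
      by (intro jointly_continuousD[OF W(1) t Yp top_le_0 tendsto_const]) auto
    then have "\<forall>\<^sub>F n in sequentially. W t (r n) < 0"
      using \<open>W t ?p < 0\<close> by (simp add: order_tendsto_iff)
    then obtain n where n: "W t (r n) < 0" using eventually_happens'[OF sequentially_bot] by blast
    then have "r n \<noteq> 0" using W(2) by auto
    then have "r n \<in> ?A" using n r0[of n] Yp by (auto simp: level_set_def)
    with level_le_top[OF this] r0(1)[of n] show False by simp
  qed
qed

lemma top_usc:
  assumes t: "t > 0" and W: "jointly_continuous W" "W t 0 > 0" and w: "level_top W t < w"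
  shows "\<forall>\<^sub>F s in nhds t. level_top W s < w"
proof -
  define w' where "w' = (level_top W t + w) / 2"
  have w': "level_top W t < w'" "w' < w" using w by (auto simp: w'_def)
  have "\<forall>\<^sub>F s in nhds t. \<forall>q\<in>level_set W s. q \<le> w'"
  proof (rule ccontr)
    assume "\<not> ?thesis"
    then have "\<exists>s q. dist s t < 1 / real (Suc n) \<and> q \<in> level_set W s \<and> w' < q" for n
      by (auto simp: eventually_nhds_metric not_le dest!: spec[of _ "1 / real (Suc n)"])
    then obtain s q where sq: "\<And>n. dist (s n) t < 1 / real (Suc n)"
      "\<And>n. q n \<in> level_set W (s n)" "\<And>n. w' < q n"
      by metis
    have "\<forall>n. q n \<in> {w'..0}" using sq(2,3) by (auto simp: level_set_def less_imp_le)
    then obtain l r where l: "l \<in> {w'..0}" and r: "strict_mono r" "(q \<circ> r) \<longlonglongrightarrow> l"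
      using compact_Icc[of w' "0::real"] unfolding compact_def by blast
    have "s \<longlonglongrightarrow> t"
      by (rule metric_tendsto_imp_tendsto[where f = "\<lambda>n. inverse (real (Suc n))" and a = 0])
        (use less_imp_le[OF sq(1)] LIMSEQ_inverse_real_of_nat in \<open>auto simp: inverse_eq_divide dist_real_def\<close>)
    then have "(s \<circ> r) \<longlonglongrightarrow> t" using r(1) by (rule LIMSEQ_subseq_LIMSEQ)
    have Yl: "Y t < l" using front_le_top[of t W] w' l by auto
    have "\<And>n. (q \<circ> r) n \<le> 0" using sq(2) by (auto simp: level_set_def less_imp_le)
    from jointly_continuousD[OF W(1) t Yl _ \<open>(s \<circ> r) \<longlonglongrightarrow> t\<close> r(2) this]
    have lim: "(\<lambda>n. W ((s \<circ> r) n) ((q \<circ> r) n)) \<longlonglongrightarrow> W t l" using l by simp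
    have "W t l \<le> 0"
      by (rule LIMSEQ_le_const2[OF lim]) (use sq(2) in \<open>auto simp: level_set_def\<close>)
    then have "l \<in> level_set W t" using l Yl W(2) by (cases "l = 0") (auto simp: level_set_def)
    with level_le_top[OF this] w' l show False by auto
  qed
  moreover have "\<forall>\<^sub>F s in nhds t. Y s < w'"
    by (rule front_usc[OF t]) (use front_le_top[of t W] w' in simp)
  ultimately show ?thesis
  proof eventually_elim
    fix s assume "\<forall>q\<in>level_set W s. q \<le> w'" "Y s < w'"
    then have "level_top W s \<le> w'" by (intro top_leI) auto
    then show "level_top W s < w" using w' by simp
  qed
qed

lemma eventually_at_left_nhds: "eventually P (nhds (t::real)) \<Longrightarrow> eventually P (at_left t)"
  and eventually_at_right_nhds: "eventually P (nhds (t::real)) \<Longrightarrow> eventually P (at_right t)"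
  by (auto simp: eventually_at_filter elim: eventually_mono)

lemma eventually_left_pick:
  assumes "\<forall>\<^sub>F s in at_left (t::real). P s" "t0 < t"
  shows "\<exists>s. t0 \<le> s \<and> s < t \<and> P s"
proof -
  have "\<forall>\<^sub>F s in at_left t. s \<in> {t0<..<t} \<and> P s"
    using eventually_at_left_real[OF assms(2)] assms(1) by eventually_elim auto
  then obtain s where "s \<in> {t0<..<t} \<and> P s"
    using eventually_happens'[OF trivial_limit_at_left_real] by blast
  then show ?thesis by (auto intro: less_imp_le)
qed

lemma zeta_le_iff_k:
  assumes "s > 0" "Y s < q" "q \<le> 0" "t > 0" "Y t < r" "r \<le> 0"
  shows "\<zeta> s q \<le> \<zeta> t r \<longleftrightarrow> k t r - r \<le> k s q - q"
proof -
  have "\<zeta> s q \<le> \<zeta> t r \<longleftrightarrow> h (\<zeta> s q) \<le> h (\<zeta> t r)"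
    using h_mono[of "\<zeta> s q" "\<zeta> t r"] h_strict_mono[of "\<zeta> t r" "\<zeta> s q"]
      zeta_range[of s q] zeta_range[of t r] assms by (cases "\<zeta> s q \<le> \<zeta> t r") auto
  also have "\<dots> \<longleftrightarrow> 1 / h (\<zeta> t r) \<le> 1 / h (\<zeta> s q)"
    using h_zeta_pos[of s q] h_zeta_pos[of t r] assms by (simp add: field_simps)
  finally show ?thesis by (simp add: k_def)
qed

lemma V_F_pos:
  assumes "t > 0" "Y t < q" "q < 0"
  shows "V (\<zeta> t q) * F t q > 0"
  using V_pos[of "\<zeta> t q"] zeta_range[of t q] zeta_less_1[of t q] F_ge_1[of t q] assms by simp

lemma V_F_ge:
  assumes "t > 0" "Y t < q" "q \<le> 0" "\<zeta> t q \<le> x" "x \<le> 1"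
  shows "V x \<le> V (\<zeta> t q) * F t q"
proof -
  have "V x * 1 \<le> V (\<zeta> t q) * F t q"
    using assms zeta_range[of t q] F_ge_1[of t q] by (intro mult_mono V_anti V_nonneg) auto
  then show ?thesis by simp
qed

lemma lower_level_reached:
  assumes B: "B < \<kappa>"
  shows "\<exists>t1\<ge>1. \<forall>q. Y t1 < q \<and> q < 0 \<longrightarrow> B \<le> k t1 q"
proof (rule ccontr)
  assume contra: "\<not> ?thesis"
  define W where "W = (\<lambda>t q. k t q - B)"
  have W: "jointly_continuous W" "\<And>t. W t 0 > 0"
    unfolding jointly_continuous_def W_def using B
    by (auto intro!: tendsto_diff k_tendsto)
  define f where "f = level_top W"
  have ne: "level_set W t \<noteq> {}" if "t \<ge> 1" for t
    using contra that by (fastforce simp: level_set_def W_def not_le)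
  have f: "Y t < f t" "f t < 0" "k t (f t) = B" if "t \<ge> 1" for t
    using top_mem[OF _ W ne[OF that]] that by (auto simp: f_def level_set_def W_def)
  have step: "\<exists>s. 1 \<le> s \<and> s < t \<and> f t + v * (t - s) \<le> f s"
    if "1 < t" "v < V (\<zeta> t (f t)) * F t (f t)" for t v
  proof (rule eventually_left_pick[OF _ that(1)])
    have t: "1 \<le> t" using that by simp
    show "\<forall>\<^sub>F s in at_left t. f t + v * (t - s) \<le> f s"
    proof (rule eventually_mono)
      show "\<forall>\<^sub>F s in at_left t. \<exists>c. Y s < c \<and> c < 0 \<and> k s c = k t (f t) \<and> f t + v * (t - s) \<le> c \<and> c < f t + 1"
        by (rule characteristic) (use f[of t] that in auto)
      fix s assume "\<exists>c. Y s < c \<and> c < 0 \<and> k s c = k t (f t) \<and> f t + v * (t - s) \<le> c \<and> c < f t + 1"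
      then obtain c where c: "Y s < c" "c < 0" "k s c = B" "f t + v * (t - s) \<le> c"
        using f(3)[of t] t by auto
      then have "c \<in> level_set W s" by (simp add: level_set_def W_def)
      from level_le_top[OF this] c show "f t + v * (t - s) \<le> f s" by (simp add: f_def)
    qed
  qed
  have usc: "\<forall>\<^sub>F \<tau> in at_right s. f \<tau> < w" if "1 \<le> s" "f s < w" for s w
    using eventually_at_right_nhds[OF top_usc[OF _ W]] that by (simp add: f_def)
  have bound: "f t \<ge> -D" for t
    using front_le_top[of t W] front_bounds(1)[of t] by (simp add: f_def)
  have dec: "f t \<le> f 1" if "t \<ge> 1" for t
  proof -
    have "f t + 0 * (t - 1) \<le> f 1"
    proof (rule backward_growth[where ylow = "- D - 1"])
      fix \<tau> :: real assume "1 < \<tau>"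
      then show "\<exists>s\<ge>1. s < \<tau> \<and> f \<tau> + 0 * (\<tau> - s) \<le> f s"
        using step[of \<tau> 0] V_F_pos[of \<tau> "f \<tau>"] f[of \<tau>] by auto
    qed (use usc bound[of t] that in auto)
    then show ?thesis by simp
  qed
  define x where "x = \<zeta> 1 (f 1)"
  have x: "0 < x" "x < 1" using zeta_pos[of 1 "f 1"] zeta_less_1[of 1 "f 1"] f[of 1] by (auto simp: x_def)
  define v where "v = V x / 2"
  have v: "v > 0" using V_pos[of x] x by (simp add: v_def)
  have rate: "v < V (\<zeta> t (f t)) * F t (f t)" if "t \<ge> 1" for t
  proof -
    have "\<zeta> t (f t) \<le> x"
      unfolding x_def using zeta_le_iff_k[of t "f t" 1 "f 1"] f[of t] f[of 1] dec[OF that] that by simp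
    then show ?thesis using V_F_ge[of t "f t" x] v f[of t] x that by (simp add: v_def)
  qed
  define T where "T = 1 + (D + 1) / v"
  have T: "T \<ge> 1" "v * (T - 1) = D + 1" using v D_pos by (auto simp: T_def)
  have "f T + v * (T - 1) \<le> f 1"
    by (rule backward_growth[where ylow = "- D - 1"])
      (use usc step rate v bound[of T] T in auto)
  then show False using T bound[of T] f(2)[of 1] by simp
qed

lemma front_speed:
  assumes t: "t > 0" and "Y t > -D" "zp t > 0"
  obtains \<sigma> where "(Y has_real_derivative \<sigma>) (at t)"
    "\<sigma> = F t (Y t) * ((1 - zp t) / zp t) * (psi g (Y t + D) - h (zp t))"
    "- (V (zp t) * F t (Y t)) \<le> \<sigma>"
proof -
  define \<sigma> where "\<sigma> = F t (Y t) * ((1 - zp t) / zp t) * (psi g (Y t + D) - h (zp t))"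
  have d: "(Y has_real_derivative \<sigma>) (at t)"
    using law assms unfolding front_law_def \<sigma>_def by blast
  have L: "h (zp t) - zp t * (1 - zp t) * deriv h (zp t) \<le> psi g (Y t + D)"
    using lax assms unfolding front_lax_def by blast
  have r: "zp t \<le> 1" using front_state_range[OF t] by simp
  have "- V (zp t) \<le> ((1 - zp t) / zp t) * (psi g (Y t + D) - h (zp t))"
  proof (cases "zp t = 1")
    case False
    have "- V (zp t) = ((1 - zp t) / zp t) * (- (zp t * (1 - zp t) * deriv h (zp t)))"
      using V_eq[of "zp t"] False assms by (simp add: power2_eq_square)
    also have "\<dots> \<le> ((1 - zp t) / zp t) * (psi g (Y t + D) - h (zp t))"
      by (rule mult_left_mono) (use L r assms in auto)
    finally show ?thesis .
  qed simp
  then have "F t (Y t) * - V (zp t) \<le> F t (Y t) * (((1 - zp t) / zp t) * (psi g (Y t + D) - h (zp t)))"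
    using F_ge_1[of t "Y t"] t by (intro mult_left_mono) auto
  also have "\<dots> = \<sigma>" by (simp add: \<sigma>_def)
  finally show thesis using that[OF d \<sigma>_def] by (simp add: mult.commute)
qed

text \<open>A minimum of \<open>k\<close> could only be created at the front. There the Lax condition makes the
  front at least as fast as the characteristics, and as \<open>\<zeta>\<close> is increasing, \<open>k\<close> grows at most with
  slope one in \<open>q\<close>; hence tilting the level slightly downwards in time gives a contradiction.\<close>

lemma lower_level_persists:
  assumes t1: "t1 > 0" and B: "B < \<kappa>" and init: "\<And>q. Y t1 < q \<Longrightarrow> q < 0 \<Longrightarrow> B \<le> k t1 q"
    and T: "t1 \<le> T" and q0: "Y T < q0" "q0 < 0"
  shows "B \<le> k T q0"
proof (rule ccontr)
  assume "\<not> B \<le> k T q0"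
  then have q0B: "k T q0 < B" by simp
  define \<epsilon> where "\<epsilon> = (B - k T q0) / (1 + (T - t1))"
  have e: "\<epsilon> > 0" using q0B T by (simp add: \<epsilon>_def)
  define b where "b = (\<lambda>t. B - \<epsilon> * (1 + (t - t1)))"
  have bT: "b T = k T q0" using T by (simp add: b_def \<epsilon>_def)
  have b_diff: "b s = b t + \<epsilon> * (t - s)" for s t by (simp add: b_def algebra_simps)
  define W where "W = (\<lambda>t q. k t q - b t)"
  have cont: "jointly_continuous W"
    unfolding jointly_continuous_def W_def b_def
    by (auto intro!: tendsto_diff k_tendsto tendsto_intros)
  have W0: "W t 0 > 0" if "t \<ge> t1" for t
  proof -
    have "\<epsilon> * (1 + (t - t1)) \<ge> 0" using that e by simp
    then show ?thesis using B by (simp add: W_def b_def)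
  qed
  define f where "f = level_top W"
  have f: "Y t < f t" "f t < 0" "k t (f t) = b t" if "t \<ge> t1" "level_set W t \<noteq> {}" for t
    using top_mem[OF _ cont W0 that(2)] that t1 by (auto simp: f_def level_set_def W_def)
  have backwards: "\<forall>\<^sub>F s in at_left t. f t + (v + \<epsilon>) * (t - s) \<le> f s \<and> level_set W s \<noteq> {}"
    if t: "t \<ge> t1" "level_set W t \<noteq> {}" and v: "v < V (\<zeta> t (f t)) * F t (f t)" for t v
  proof -
    define \<eta> where "\<eta> = - f t / 2"
    have \<eta>: "\<eta> > 0" using f(2)[OF t] by (simp add: \<eta>_def)
    have "((\<lambda>s. \<epsilon> * (t - s)) \<longlongrightarrow> \<epsilon> * (t - t)) (at_left t)" by (intro tendsto_intros)
    then have "\<forall>\<^sub>F s in at_left t. \<epsilon> * (t - s) < \<eta>" using \<eta> by (simp add: order_tendsto_iff)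
    moreover have "\<forall>\<^sub>F s in at_left t. s \<in> {0<..<t}" using t t1 by (intro eventually_at_left_real) simp
    moreover have "\<forall>\<^sub>F s in at_left t. \<exists>c. Y s < c \<and> c < 0 \<and> k s c = k t (f t) \<and> f t + v * (t - s) \<le> c \<and> c < f t + \<eta>"
      by (rule characteristic) (use t t1 f[OF t] v \<eta> in auto)
    ultimately show ?thesis
    proof eventually_elim
      fix s assume s: "\<epsilon> * (t - s) < \<eta>" "s \<in> {0<..<t}"
        "\<exists>c. Y s < c \<and> c < 0 \<and> k s c = k t (f t) \<and> f t + v * (t - s) \<le> c \<and> c < f t + \<eta>"
      then obtain c where c: "Y s < c" "c < 0" "k s c = b t" "f t + v * (t - s) \<le> c" "c < f t + \<eta>"
        using f(3)[OF t] by auto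
      define c' where "c' = c + \<epsilon> * (t - s)"
      have c': "c \<le> c'" "c' < 0" using s c e by (auto simp: c'_def \<eta>_def)
      have "k s c' \<le> k s c + (c' - c)" by (rule k_shift) (use s c c' in auto)
      also have "\<dots> = b s" using c(3) b_diff[of s t] by (simp add: c'_def)
      finally have "c' \<in> level_set W s" using c c' by (simp add: level_set_def W_def)
      with level_le_top[OF this] c show "f t + (v + \<epsilon>) * (t - s) \<le> f s \<and> level_set W s \<noteq> {}"
        by (auto simp: f_def c'_def algebra_simps)
    qed
  qed
  define S where "S = {s. t1 \<le> s \<and> s \<le> T \<and> level_set W s = {}}"
  define i where "i = Sup S"
  have "b t1 < B" using e by (simp add: b_def)
  then have t1S: "t1 \<in> S" using init T by (fastforce simp: S_def level_set_def W_def)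
  have bdd: "bdd_above S" by (auto simp: S_def intro!: bdd_aboveI[of _ T])
  have i: "t1 \<le> i" "i \<le> T"
    unfolding i_def by (rule cSup_upper[OF t1S bdd] cSup_least; use t1S in \<open>auto simp: S_def\<close>)+
  have i_pos: "i > 0" using i t1 by simp
  have iS: "level_set W i = {}"
  proof (rule ccontr)
    assume ne: "level_set W i \<noteq> {}"
    with t1S i have "t1 < i" by (cases "t1 = i") (auto simp: S_def)
    have "\<forall>\<^sub>F s in at_left i. level_set W s \<noteq> {}"
      using backwards[OF i(1) ne, of "V (\<zeta> i (f i)) * F i (f i) - 1"] by (auto elim: eventually_mono)
    then obtain a where a: "a < i" "\<And>s. a < s \<Longrightarrow> s < i \<Longrightarrow> level_set W s \<noteq> {}"
      by (auto simp: eventually_at_left_field)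
    obtain s where "s \<in> S" "a < s" using less_cSupD[of S a] t1S a by (auto simp: i_def)
    moreover have "s \<le> i" using cSup_upper[OF \<open>s \<in> S\<close> bdd] by (simp add: i_def)
    ultimately show False using a(2)[of s] ne by (cases "s = i") (auto simp: S_def)
  qed
  have TA: "level_set W T \<noteq> {}" using q0 bT by (auto simp: level_set_def W_def)
  with iS i have iT: "i < T" by (cases "i = T") auto
  have ne: "level_set W s \<noteq> {}" if "i < s" "s \<le> T" for s
    using cSup_upper[OF _ bdd, of s] that i by (fastforce simp: S_def i_def)
  have usc: "\<forall>\<^sub>F \<tau> in at_right s. f \<tau> < w" if "i \<le> s" "f s < w" for s w
    using eventually_at_right_nhds[OF top_usc[OF _ cont W0]] that i t1 by (simp add: f_def)
  have grow: "f t + (v + \<epsilon>) * (t - s) \<le> f s"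
    if "i \<le> s" "s \<le> t" "t \<le> T" "v + \<epsilon> \<ge> 0"
      and v: "\<And>\<tau>. i < \<tau> \<Longrightarrow> \<tau> \<le> t \<Longrightarrow> v < V (\<zeta> \<tau> (f \<tau>)) * F \<tau> (f \<tau>)" for s t v
  proof (rule backward_growth[where ylow = "f t - 1"])
    fix \<tau> assume \<tau>: "s < \<tau>" "\<tau> \<le> t"
    have "\<forall>\<^sub>F s in at_left \<tau>. f \<tau> + (v + \<epsilon>) * (\<tau> - s) \<le> f s"
      by (rule eventually_mono[OF backwards[of \<tau> v]]) (use ne[of \<tau>] v[of \<tau>] \<tau> that i in auto)
    then show "\<exists>s'\<ge>s. s' < \<tau> \<and> f \<tau> + (v + \<epsilon>) * (\<tau> - s') \<le> f s'"
      using eventually_left_pick[OF _ \<tau>(1)] by blast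
  qed (use that usc in auto)
  have grow0: "f t + \<epsilon> * (t - s) \<le> f s" if "i \<le> s" "s \<le> t" "t \<le> T" for s t
    using grow[OF that, of 0] e V_F_pos f ne that i t1 by auto
  have fi: "f i = Y i" using top_empty[OF iS] by (simp add: f_def)
  have f_le: "f t \<le> Y i" if "i \<le> t" "t \<le> T" for t
  proof -
    have "\<epsilon> * (t - i) \<ge> 0" using e that by simp
    then show ?thesis using grow0[of i t] that fi by simp
  qed
  define x where "x = \<zeta> T (f T)"
  have x: "x > 0" unfolding x_def using zeta_pos[of T "f T"] f[of T] TA T t1 by auto
  have zx: "x \<le> \<zeta> s (f s)" if "i < s" "s \<le> T" for s
    unfolding x_def
    using zeta_le_iff_k[of T "f T" s "f s"] f[of s] f[of T] TA ne[OF that] that i t1 T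
      grow0[of s T] b_diff[of s T] by auto
  have YD: "Y i > -D"
  proof -
    have "Y i \<ge> f T" using f_le[of T] iT by simp
    moreover have "f T > Y T" using f(1)[of T] TA T by simp
    ultimately show ?thesis using front_bounds(1)[of T] by linarith
  qed
  have near: "\<forall>\<^sub>F s in at_right i. i < s \<and> s \<le> T"
    using eventually_at_right_real[OF iT] by eventually_elim auto
  have lim_zeta: "((\<lambda>s. \<zeta> s q) \<longlongrightarrow> \<zeta> i q) (at_right i)" if "Y i < q" "q < 0" for q
    by (rule zeta_tendsto(1)) (use that i_pos in auto)
  have le_zeta: "\<zeta> s (f s) \<le> \<zeta> s q" if "Y i < q" "q < 0" "i < s" "s \<le> T" for s q
    by (rule zeta_mono) (use f[of s] ne[of s] f_le[of s] that i t1 in auto)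
  have zpos: "zp i > 0"
  proof (cases "Y i = 0")
    case True
    then show ?thesis by (simp add: front_state_at_0)
  next
    case False
    then have neg: "Y i < 0" using front_bounds(2)[of i] by simp
    have "x \<le> zp i"
    proof (rule front_state_ge[OF i_pos neg])
      fix q assume q: "Y i < q" "q < 0"
      have "\<forall>\<^sub>F s in at_right i. x \<le> \<zeta> s q"
        using near by eventually_elim (use zx le_zeta q in force)
      then show "x \<le> \<zeta> i q" using tendsto_lowerbound[OF lim_zeta[OF q]] by simp
    qed
    then show ?thesis using x by simp
  qed
  obtain \<sigma> where \<sigma>: "(Y has_real_derivative \<sigma>) (at i)" "- (V (zp i) * F i (Y i)) \<le> \<sigma>"
    using front_speed[OF i_pos YD zpos] by metis
  define R where "R = V (zp i) * F i (Y i)"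
  have R: "R \<ge> 0"
    using V_nonneg[of "zp i"] front_state_range[OF i_pos] F_ge_1[of i "Y i"] i_pos by (simp add: R_def)
  have rate: "\<forall>\<^sub>F t in at_right i. R - \<epsilon> / 2 < V (\<zeta> t (f t)) * F t (f t)"
  proof (cases "Y i = 0")
    case True
    then have "R = 0" by (simp add: R_def front_state_at_0)
    show ?thesis
      using near
    proof eventually_elim
      fix t assume t: "i < t \<and> t \<le> T"
      have "0 < V (\<zeta> t (f t)) * F t (f t)" by (rule V_F_pos) (use t f[of t] ne[of t] i t1 in auto)
      then show "R - \<epsilon> / 2 < V (\<zeta> t (f t)) * F t (f t)" using \<open>R = 0\<close> e by linarith
    qed
  next
    case False
    then have neg: "Y i < 0" using front_bounds(2)[of i] by simp
    have "((\<lambda>q. V (\<zeta> i q) * F i (Y i)) \<longlongrightarrow> R) (at_right (Y i))"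
      unfolding R_def
      by (intro tendsto_mult_right isCont_tendsto_compose[OF isCont_V front_state_tendsto] zpos i_pos neg)
    then have "\<forall>\<^sub>F q in at_right (Y i). R - \<epsilon> / 2 < V (\<zeta> i q) * F i (Y i)"
      using e by (simp add: order_tendsto_iff)
    then have "\<forall>\<^sub>F q in at_right (Y i). q \<in> {Y i<..<0} \<and> R - \<epsilon> / 2 < V (\<zeta> i q) * F i (Y i)"
      using eventually_at_right_real[OF neg] by eventually_elim auto
    then obtain q where q: "Y i < q" "q < 0" "R - \<epsilon> / 2 < V (\<zeta> i q) * F i (Y i)"
      using eventually_happens'[OF trivial_limit_at_right_real] by fastforce
    have "((\<lambda>t. V (\<zeta> t q) * F t (Y i)) \<longlongrightarrow> V (\<zeta> i q) * F i (Y i)) (at_right i)"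
    proof (intro tendsto_mult isCont_tendsto_compose[OF isCont_V lim_zeta] q)
      show "0 < \<zeta> i q" by (rule zeta_pos) (use q i_pos in auto)
      show "((\<lambda>t. F t (Y i)) \<longlongrightarrow> F i (Y i)) (at_right i)"
        by (rule tendsto_within_subset[OF F_tendsto]) (use i_pos in auto)
    qed
    then have "\<forall>\<^sub>F t in at_right i. R - \<epsilon> / 2 < V (\<zeta> t q) * F t (Y i)"
      using q(3) by (simp add: order_tendsto_iff)
    then show ?thesis
      using near
    proof eventually_elim
      fix t assume t: "R - \<epsilon> / 2 < V (\<zeta> t q) * F t (Y i)" "i < t \<and> t \<le> T"
      have "V (\<zeta> t q) * F t (Y i) \<le> V (\<zeta> t (f t)) * F t (f t)"
      proof (rule mult_mono)
        show "V (\<zeta> t q) \<le> V (\<zeta> t (f t))"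
          using le_zeta[of q t] zeta_range[of t] q t i_pos by (intro V_anti) auto
        show "F t (Y i) \<le> F t (f t)" by (rule F_anti) (use t i_pos f_le in auto)
        show "0 \<le> V (\<zeta> t (f t))" using V_nonneg zeta_range[of t "f t"] t i_pos by auto
        show "0 \<le> F t (Y i)" using F_ge_1[of t "Y i"] t i_pos by simp
      qed
      then show "R - \<epsilon> / 2 < V (\<zeta> t (f t)) * F t (f t)" using t by simp
    qed
  qed
  then obtain c where c: "i < c" "\<And>t. i < t \<Longrightarrow> t < c \<Longrightarrow> R - \<epsilon> / 2 < V (\<zeta> t (f t)) * F t (f t)"
    by (auto simp: eventually_at_right_field)
  have "\<forall>\<^sub>F t in at_right i. t \<in> {i<..<min c T}"
    by (rule eventually_at_right_real) (use c iT in simp)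
  then have ev: "\<forall>\<^sub>F t in at_right i. (Y t - Y i) / (t - i) \<le> - (R + \<epsilon> / 2)"
  proof eventually_elim
    fix t assume t: "t \<in> {i<..<min c T}"
    have "f t + (R - \<epsilon> / 2 + \<epsilon>) * (t - i) \<le> f i"
      by (rule grow) (use t c R e in auto)
    moreover have "Y t < f t" using f(1)[of t] ne[of t] t i by auto
    ultimately have "Y t - Y i \<le> - (R + \<epsilon> / 2) * (t - i)"
      using fi by (simp add: algebra_simps)
    then show "(Y t - Y i) / (t - i) \<le> - (R + \<epsilon> / 2)" using t by (simp add: pos_divide_le_eq)
  qed
  have "((\<lambda>t. (Y t - Y i) / (t - i)) \<longlongrightarrow> \<sigma>) (at_right i)"
    using \<sigma>(1) tendsto_within_subset[of _ _ i UNIV "{i<..}"] by (simp add: has_field_derivative_iff)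
  from tendsto_upperbound[OF this ev] have "\<sigma> \<le> - (R + \<epsilon> / 2)" by simp
  then show False using \<sigma>(2) e by (simp add: R_def)
qed

end

section \<open>The flux in physical variables\<close>

lemma pos_part_sq_deriv: "((\<lambda>y. (max 0 y)\<^sup>2) has_real_derivative 2 * max 0 y) (at (y::real))"
proof (cases y "0::real" rule: linorder_cases)
  case less
  have "\<forall>\<^sub>F x in nhds y. (max 0 x)\<^sup>2 = 0"
    using order_tendstoD(2)[OF tendsto_ident_at less, of UNIV] less
    by (intro eventually_mono[OF eventually_nhds_in_open[of "{..<0}"]]) auto
  then show ?thesis using less DERIV_cong_ev[OF refl, of "\<lambda>x. (max 0 x)\<^sup>2" "\<lambda>x. 0" y] by simp
next
  case greater
  have "\<forall>\<^sub>F x in nhds y. (max 0 x)\<^sup>2 = x\<^sup>2"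
    using greater by (intro eventually_mono[OF eventually_nhds_in_open[of "{0<..}"]]) auto
  moreover have "((\<lambda>y. y\<^sup>2) has_real_derivative 2 * y) (at y)"
    by (auto intro!: derivative_eq_intros)
  ultimately show ?thesis using greater DERIV_cong_ev[OF refl, of "\<lambda>x. (max 0 x)\<^sup>2" "\<lambda>x. x\<^sup>2" y] by simp
next
  case equal
  have "((\<lambda>x::real. (max 0 x)\<^sup>2 / x) \<longlongrightarrow> 0) (at 0)"
  proof (rule tendsto_rabs_zero_cancel, rule tendsto_sandwich[where f = "\<lambda>x. 0" and h = "\<lambda>x. \<bar>x\<bar>"])
    show "((\<lambda>x::real. \<bar>x\<bar>) \<longlongrightarrow> 0) (at 0)" by (intro tendsto_rabs_zero tendsto_ident_at)
  qed (auto simp: eventually_at_filter max_def power2_eq_square)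
  then show ?thesis using equal by (simp add: has_field_derivative_iff)
qed

lemma smooth_step:
  fixes a b :: real
  assumes ab: "a < b"
  obtains S S' where "\<And>u. (S has_real_derivative S' u) (at u)" "continuous_on UNIV S'"
    "\<And>u. 0 \<le> S' u" "\<And>u. u \<notin> {a<..<b} \<Longrightarrow> S' u = 0"
    "\<And>u. u \<le> a \<Longrightarrow> S u = 0" "\<And>u. b \<le> u \<Longrightarrow> S u = 1" "\<And>u. 0 \<le> S u" "\<And>u. S u \<le> 1"
    "integrable lborel S'" "(LINT u|lborel. S' u) = 1"
proof -
  define p where "p = (\<lambda>y::real. (max 0 y)\<^sup>2)"
  define P where "P = (\<lambda>y. 2 * (p y - 2 * p (y - 1 / 2) + p (y - 1)))"
  define P' where "P' = (\<lambda>y::real. 4 * (max 0 y - 2 * max 0 (y - 1 / 2) + max 0 (y - 1)))"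
  have p: "(p has_real_derivative 2 * max 0 y) (at y)" for y
    unfolding p_def by (rule pos_part_sq_deriv)
  have P: "(P has_real_derivative P' y) (at y)" for y
    unfolding P_def P'_def
    by (auto intro!: derivative_eq_intros DERIV_chain2[OF p] p)
  define S where "S = (\<lambda>u. P ((u - a) / (b - a)))"
  define S' where "S' = (\<lambda>u. P' ((u - a) / (b - a)) / (b - a))"
  have S: "(S has_real_derivative S' u) (at u)" for u
  proof -
    have "((\<lambda>u. (u - a) / (b - a)) has_real_derivative 1 / (b - a)) (at u)"
      using ab by (auto intro!: derivative_eq_intros)
    from DERIV_chain2[OF P this] show ?thesis by (simp add: S_def S'_def)
  qed
  have cont: "continuous_on UNIV S'"
    unfolding S'_def P'_def using ab by (intro continuous_intros) auto
  have nonneg: "0 \<le> S' u" for u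
  proof -
    have "0 \<le> P' w" for w by (auto simp: P'_def max_def)
    then show ?thesis unfolding S'_def using ab by (intro divide_nonneg_pos) auto
  qed
  have zero: "S' u = 0" if "u \<notin> {a<..<b}" for u
  proof -
    have "P' w = 0" if "w \<le> 0 \<or> 1 \<le> w" for w
      using that by (auto simp: P'_def max_def)
    moreover have "(u - a) / (b - a) \<le> 0 \<or> 1 \<le> (u - a) / (b - a)"
      using that ab by (auto simp: divide_nonpos_pos not_less)
    ultimately show ?thesis by (simp add: S'_def)
  qed
  have left: "S u = 0" if "u \<le> a" for u
  proof -
    have "(u - a) / (b - a) \<le> 0" using that ab by (intro divide_nonpos_pos) auto
    then show ?thesis by (simp add: S_def P_def p_def)
  qed
  have right: "S u = 1" if "b \<le> u" for u
  proof -
    have "(u - a) / (b - a) \<ge> 1" using that ab by simp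
    moreover have "P w = 1" if "w \<ge> 1" for w
      using that by (simp add: P_def p_def max_def power2_eq_square algebra_simps)
    ultimately show ?thesis by (simp add: S_def)
  qed
  have mono: "S u \<le> S v" if "u \<le> v" for u v
    by (rule DERIV_nonneg_imp_nondecreasing[OF that]) (use S nonneg in blast)
  have range: "0 \<le> S u" "S u \<le> 1" for u
    using mono[of "min u a" u] left[of "min u a"] mono[of u "max u b"] right[of "max u b"] by auto
  have fund: "has_bochner_integral lborel (\<lambda>x. S' x * indicator {a..b} x) (S b - S a)"
    by (rule has_bochner_integral_FTC_Icc_nonneg)
      (use ab S nonneg borel_measurable_continuous_onI[OF cont] in auto)
  have "(\<lambda>x. S' x * indicator {a..b} x) = S'"
  proof
    fix x show "S' x * indicator {a..b} x = S' x"
      using zero[of x] by (cases "x \<in> {a<..<b}") (auto simp: indicator_def)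
  qed
  with fund left right have "has_bochner_integral lborel S' 1" by simp
  then show thesis using that[OF S cont nonneg zero left right range] by (auto simp: has_bochner_integral_iff)
qed

lemma integrable_compact_support_pair:
  fixes f :: "real \<times> real \<Rightarrow> real"
  assumes "f \<in> borel_measurable borel" "\<And>p. \<bar>f p\<bar> \<le> K" "\<And>t u. \<bar>t\<bar> > R \<or> \<bar>u\<bar> > R \<Longrightarrow> f (t, u) = 0"
  shows "integrable lborel f"
proof (rule integrableI_bounded_set[where A = "cbox (-R, -R) (R, R)" and B = K])
  show "emeasure lborel (cbox (- R, - R) (R, R)) < \<infinity>"
    by (rule emeasure_bounded_finite) (rule bounded_cbox)
  show "AE x in lborel. x \<notin> cbox (- R, - R) (R, R) \<longrightarrow> f x = 0"
  proof (intro AE_I2 impI)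
    fix p :: "real \<times> real" assume p: "p \<notin> cbox (- R, - R) (R, R)"
    show "f p = 0"
      by (cases p) (use p assms(3) in \<open>force simp: cbox_Pair_eq\<close>)
  qed
qed (use assms in auto)

lemma integral_lborel_iterated:
  fixes f :: "real \<times> real \<Rightarrow> real"
  assumes "integrable lborel f"
  shows "integrable lborel (\<lambda>t. LINT u|lborel. f (t, u))"
    and "(LINT p|lborel. f p) = (LINT t|lborel. LINT u|lborel. f (t, u))"
proof -
  have *: "integrable (lborel \<Otimes>\<^sub>M lborel) f" using assms by (simp add: lborel_prod)
  show "integrable lborel (\<lambda>t. LINT u|lborel. f (t, u))"
    by (rule lborel_pair.integrable_fst'[OF *])
  show "(LINT p|lborel. f p) = (LINT t|lborel. LINT u|lborel. f (t, u))"
    using lborel_pair.integral_fst'[OF *] by (simp add: lborel_prod)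
qed

lemma is_interval_borel:
  fixes S :: "real set"
  assumes "is_interval S"
  shows "S \<in> sets borel"
proof -
  define l r :: "real \<Rightarrow> real"
    where "l = (\<lambda>x. of_bool (\<exists>a\<in>S. a \<le> x))" and "r = (\<lambda>x. - of_bool (\<exists>b\<in>S. x \<le> b))"
  have "mono l" "mono r"
    unfolding l_def r_def by (auto intro!: monoI simp: of_bool_def) (meson order_trans)+
  then have [measurable]: "l \<in> borel_measurable borel" "r \<in> borel_measurable borel"
    by (auto intro: borel_measurable_mono)
  have "S = {x. l x = 1 \<and> r x = - 1}"
    using mem_is_interval_1_I[OF assms] by (auto simp: l_def r_def)
  also have "\<dots> \<in> sets borel" by measurable
  finally show ?thesis .
qed

context flow
begin

definition \<Phi> :: "real \<Rightarrow> real \<Rightarrow> real" where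
  "\<Phi> t u = exp (LINT v:{u..}|lborel. g (z t v))"

abbreviation proj where "proj \<equiv> projected_flux g z"

lemma flux_eq: "flux g z t u = g (z t u) * \<Phi> t u"
  by (simp add: flux_def \<Phi>_def)

definition gc :: "real \<Rightarrow> real" where "gc x = g (max 0 x)"

lemma gc_measurable [measurable]: "gc \<in> borel_measurable borel"
  unfolding gc_def
  by (intro borel_measurable_continuous_onI continuous_on_compose2[OF cont_g] continuous_intros) auto

lemma gc_z: "t \<ge> 0 \<Longrightarrow> gc (z t u) = g (z t u)"
  using z_range[of t u] by (simp add: gc_def max_def)

lemma g_z_range: "t \<ge> 0 \<Longrightarrow> 0 \<le> g (z t u) \<and> g (z t u) \<le> h 1 * (1 - z t u)"
  using z_range[of t u] h_nonneg[of "z t u"] h_mono[of "z t u" 1] g_eq[of "z t u"]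
  by (auto intro!: mult_right_mono)

lemma g_z_le: "t \<ge> 0 \<Longrightarrow> g (z t u) \<le> h 1"
  using g_z_range[of t u] z_range[of t u] h_1_pos mult_left_mono[of "1 - z t u" 1 "h 1"] by linarith

lemma z_measurable: "t \<ge> 0 \<Longrightarrow> z t \<in> borel_measurable borel"
  using borel_measurable_integrable[OF z_integrable[of t]] borel_measurable_add[of "\<lambda>u. z t u - 1" lborel "\<lambda>u. 1"]
  by simp

lemma g_z_measurable: "t \<ge> 0 \<Longrightarrow> (\<lambda>u. g (z t u)) \<in> borel_measurable borel"
  using measurable_compose[OF z_measurable gc_measurable, of t] by (simp add: gc_z)

lemma g_z_integrable:
  assumes t: "t \<ge> 0"
  shows "integrable lborel (\<lambda>u. g (z t u))"
proof (rule Bochner_Integration.integrable_bound)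
  show "integrable lborel (\<lambda>u. h 1 * (1 - z t u))"
    by (rule integrable_mult_right) (rule compl_integrable[OF t])
  show "AE u in lborel. norm (g (z t u)) \<le> norm (h 1 * (1 - z t u))"
    using g_z_range[OF t] h_1_pos z_range[OF t] by (auto simp: abs_mult)
qed (use g_z_measurable[OF t] in simp)

lemma g_z_set_integrable: "t \<ge> 0 \<Longrightarrow> A \<in> sets borel \<Longrightarrow> set_integrable lborel A (\<lambda>u. g (z t u))"
  unfolding set_integrable_def using g_z_integrable by (intro integrable_mult_indicator) auto

lemma \<Phi>_split:
  assumes "t \<ge> 0" "u \<le> v"
  shows "\<Phi> t u = \<Phi> t v * exp (LINT x:{u..<v}|lborel. g (z t x))"
proof -
  have "(LINT x:{u..<v} \<union> {v..}|lborel. g (z t x))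
      = (LINT x:{u..<v}|lborel. g (z t x)) + (LINT x:{v..}|lborel. g (z t x))"
    by (rule set_integral_Un) (auto intro: g_z_set_integrable assms)
  moreover have "{u..<v} \<union> {v..} = {u..}" using assms by auto
  ultimately show ?thesis by (simp add: \<Phi>_def exp_add mult.commute)
qed

lemma \<Phi>_ge_1: "t \<ge> 0 \<Longrightarrow> \<Phi> t u \<ge> 1"
  unfolding \<Phi>_def set_lebesgue_integral_def using g_z_range[of t]
  by (simp add: Bochner_Integration.integral_nonneg indicator_def)

lemma \<Phi>_ge:
  assumes t: "t \<ge> 0" and "u \<le> v" and c: "AE x in lborel. x \<in> {u<..<v} \<longrightarrow> c \<le> g (z t x)"
  shows "\<Phi> t v * (1 + c * (v - u)) \<le> \<Phi> t u"
proof -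
  have "(LINT x:{u..<v}|lborel. c) \<le> (LINT x:{u..<v}|lborel. g (z t x))"
  proof (rule set_integral_mono_AE)
    show "AE x\<in>{u..<v} in lborel. c \<le> g (z t x)"
      using c AE_lborel_singleton[of u] by eventually_elim auto
    show "set_integrable lborel {u..<v} (\<lambda>x. c)"
      using assms unfolding set_integrable_def
      by (intro integrable_scaleR_left integrable_real_indicator) auto
  qed (use t g_z_set_integrable in auto)
  moreover have "(LINT x:{u..<v}|lborel. c) = c * (v - u)"
    using assms by (simp add: set_lebesgue_integral_def)
  ultimately have "1 + c * (v - u) \<le> exp (LINT x:{u..<v}|lborel. g (z t x))"
    using exp_ge_add_one_self[of "LINT x:{u..<v}|lborel. g (z t x)"] by linarith
  then show ?thesis
    unfolding \<Phi>_split[OF assms(1,2)] using \<Phi>_ge_1[OF t, of v] by (intro mult_left_mono) auto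
qed

lemma \<Phi>_anti: "t \<ge> 0 \<Longrightarrow> u \<le> v \<Longrightarrow> \<Phi> t v \<le> \<Phi> t u"
  using \<Phi>_ge[of t u v 0] g_z_range[of t] by simp

lemma \<Phi>_le: "t \<ge> 0 \<Longrightarrow> \<Phi> t u \<le> exp (h 1 * D)"
proof -
  assume t: "t \<ge> 0"
  have "(LINT v:{u..}|lborel. g (z t v)) \<le> (LINT v|lborel. h 1 * (1 - z t v))"
    unfolding set_lebesgue_integral_def
    by (rule Bochner_Integration.integral_mono)
      (use g_z_set_integrable[OF t, of "{u..}"] compl_integrable[OF t] g_z_range[OF t] z_range[OF t] h_1_pos
        in \<open>auto simp: set_integrable_def indicator_def\<close>)
  also have "\<dots> = h 1 * D" using compl_integral[OF t] by simp
  finally show ?thesis by (simp add: \<Phi>_def)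
qed

lemma flux_range: "t \<ge> 0 \<Longrightarrow> 0 \<le> flux g z t u \<and> flux g z t u \<le> h 1 * exp (h 1 * D)"
  unfolding flux_eq using g_z_range[of t u] g_z_le[of t u] \<Phi>_ge_1[of t u] \<Phi>_le[of t u] h_1_pos
  by (auto intro!: mult_mono)

lemma \<Phi>_measurable: "t \<ge> 0 \<Longrightarrow> \<Phi> t \<in> borel_measurable borel"
proof -
  assume t: "t \<ge> 0"
  have "mono (\<lambda>u. - \<Phi> t u)" by (rule monoI) (use \<Phi>_anti[OF t] in simp)
  then have "(\<lambda>u. - \<Phi> t u) \<in> borel_measurable borel" by (rule borel_measurable_mono)
  then show ?thesis by simp
qed

lemma flux_measurable: "t \<ge> 0 \<Longrightarrow> flux g z t \<in> borel_measurable borel"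
proof -
  assume t: "t \<ge> 0"
  have "(\<lambda>u. g (z t u) * \<Phi> t u) \<in> borel_measurable borel"
    using g_z_measurable[OF t] \<Phi>_measurable[OF t] by measurable
  then show ?thesis by (simp add: flux_eq[abs_def])
qed

lemma plateau_borel: "plateau z t u \<in> sets borel"
proof -
  have "is_interval (plateau z t u)"
    unfolding plateau_def is_interval_connected_1 by (rule connected_connected_component)
  then show ?thesis by (rule is_interval_borel)
qed

lemma proj_bounded: "t \<ge> 0 \<Longrightarrow> \<bar>proj t u\<bar> \<le> h 1 * exp (h 1 * D)"
proof (cases "z t u = 0 \<and> measure lborel (plateau z t u) > 0")
  case False
  moreover assume "t \<ge> 0"
  ultimately show ?thesis using flux_range[of t u] by (auto simp: projected_flux_def)
next
  case True
  assume t: "t \<ge> 0"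
  let ?P = "plateau z t u" and ?M = "h 1 * exp (h 1 * D)"
  have fin: "emeasure lborel ?P < \<infinity>"
    using True by (auto simp: measure_def top.not_eq_extremum[symmetric])
  have i: "integrable lborel (\<lambda>v. indicator ?P v *\<^sub>R flux g z t v)"
    by (rule integrableI_bounded_set_indicator[where B = ?M])
      (use fin flux_range[OF t] flux_measurable[OF t] plateau_borel in auto)
  have "(LINT v:?P|lborel. flux g z t v) \<le> (LINT v:?P|lborel. ?M)"
    unfolding set_lebesgue_integral_def
  proof (rule Bochner_Integration.integral_mono[OF i])
    show "integrable lborel (\<lambda>v. indicator ?P v *\<^sub>R ?M)"
      using fin plateau_borel by (intro integrable_scaleR_left integrable_real_indicator) auto
  qed (use flux_range[OF t] in \<open>auto simp: indicator_def\<close>)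
  also have "\<dots> = ?M * measure lborel ?P"
    using plateau_borel by (simp add: set_lebesgue_integral_def)
  finally have "(LINT v:?P|lborel. flux g z t v) \<le> ?M * measure lborel ?P" .
  moreover have "0 \<le> (LINT v:?P|lborel. flux g z t v)"
    unfolding set_lebesgue_integral_def
    by (rule Bochner_Integration.integral_nonneg) (use flux_range[OF t] in \<open>auto simp: indicator_def\<close>)
  ultimately show ?thesis using True by (simp add: projected_flux_def field_simps)
qed

lemma z_jointly_measurable:
  "(\<lambda>p. indicator ({0..} \<times> UNIV) p * z (fst p) (snd p)) \<in> borel_measurable borel"
  "(\<lambda>p. indicator ({0..} \<times> UNIV) p * proj (fst p) (snd p)) \<in> borel_measurable borel"
  using solution unfolding weak_solution_def set_borel_measurable_def by auto

lemma flux_jointly_measurable: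
  "(\<lambda>p. indicator ({0..} \<times> UNIV) p * flux g z (fst p) (snd p)) \<in> borel_measurable borel"
proof -
  define Z where "Z = (\<lambda>p. indicator ({0..} \<times> UNIV) p * z (fst p) (snd p))"
  have Z [measurable]: "Z \<in> borel_measurable (borel \<Otimes>\<^sub>M borel)"
    using z_jointly_measurable(1) by (simp add: Z_def borel_prod)
  have [measurable]: "(\<lambda>p. LINT v|lborel. (if snd p \<le> v then gc (Z (fst p, v)) else 0))
      \<in> borel_measurable (borel \<Otimes>\<^sub>M borel)"
    by measurable
  have S [measurable]: "{0::real..} \<times> (UNIV :: real set) \<in> sets (borel \<Otimes>\<^sub>M borel)"
    by (intro pair_measureI) auto
  have "(\<lambda>p. indicator ({0..} \<times> UNIV) p * flux g z (fst p) (snd p)) =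
    (\<lambda>p. indicator ({0..} \<times> UNIV) p * (gc (Z p) * exp (LINT v|lborel. (if snd p \<le> v then gc (Z (fst p, v)) else 0))))"
    by (auto simp: fun_eq_iff indicator_def flux_def Z_def gc_z set_lebesgue_integral_def
        intro!: arg_cong[where f = exp] Bochner_Integration.integral_cong)
  also have "\<dots> \<in> borel_measurable (borel \<Otimes>\<^sub>M borel)" by measurable
  finally show ?thesis by (simp add: borel_prod)
qed

lemma weak_equation_product:
  assumes \<alpha>: "\<And>t. (\<alpha> has_real_derivative \<alpha>' t) (at t)" "continuous_on UNIV \<alpha>'"
    and \<beta>: "\<And>u. (\<beta> has_real_derivative \<beta>' u) (at u)" "continuous_on UNIV \<beta>'"
    and \<alpha>0: "\<And>t. \<bar>t\<bar> > R \<or> t \<le> 0 \<Longrightarrow> \<alpha> t = 0 \<and> \<alpha>' t = 0"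
    and \<beta>0: "\<And>u. \<bar>u\<bar> > R \<Longrightarrow> \<beta> u = 0 \<and> \<beta>' u = 0"
  shows "integrable lborel (\<lambda>t. \<alpha>' t * (LINT u|lborel. z t u * \<beta> u))"
    and "integrable lborel (\<lambda>t. \<alpha> t * (LINT u|lborel. proj t u * \<beta>' u))"
    and "(LINT t|lborel. \<alpha>' t * (LINT u|lborel. z t u * \<beta> u))
      = (LINT t|lborel. \<alpha> t * (LINT u|lborel. proj t u * \<beta>' u))"
proof -
  let ?S = "{0..} \<times> (UNIV :: real set)"
  let ?I = "\<lambda>p. indicator ?S p :: real"
  have cont: "continuous_on UNIV \<alpha>" "continuous_on UNIV \<beta>"
    using \<alpha>(1) \<beta>(1) by (auto intro!: continuous_at_imp_continuous_on DERIV_isCont)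
  have c: "continuous_on UNIV (\<lambda>p. \<alpha> (fst p) * \<beta>' (snd p))" "continuous_on UNIV (\<lambda>p. \<alpha>' (fst p) * \<beta> (snd p))"
    by (auto intro!: continuous_intros continuous_on_compose2[OF cont(1)] continuous_on_compose2[OF cont(2)]
        continuous_on_compose2[OF \<alpha>(2)] continuous_on_compose2[OF \<beta>(2)])
  have int: "integrable lborel (\<lambda>p. ?I p * m p * w p)"
    if m: "(\<lambda>p. ?I p * m p) \<in> borel_measurable borel" "\<And>t u. t \<ge> 0 \<Longrightarrow> \<bar>m (t, u)\<bar> \<le> M"
      and w: "continuous_on UNIV w" "\<And>t u. \<bar>t\<bar> > R \<or> \<bar>u\<bar> > R \<Longrightarrow> w (t, u) = 0"
    for m w :: "real \<times> real \<Rightarrow> real" and M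
  proof -
    have "compact (w ` cbox (-R, -R) (R, R))"
      by (intro compact_continuous_image continuous_on_subset[OF w(1)] compact_cbox) auto
    then have "bounded (w ` cbox (-R, -R) (R, R))" by (rule compact_imp_bounded)
    then obtain K where K: "\<And>p. p \<in> cbox (-R, -R) (R, R) \<Longrightarrow> \<bar>w p\<bar> \<le> K"
      by (auto simp: bounded_iff)
    have K': "\<bar>w p\<bar> \<le> \<bar>K\<bar>" for p
    proof (cases "p \<in> cbox (-R, -R) (R, R)")
      case False
      then have "w p = 0" by (cases p) (use w(2) in \<open>force simp: cbox_Pair_eq\<close>)
      then show ?thesis by simp
    qed (use K[of p] in linarith)
    show ?thesis
    proof (rule integrable_compact_support_pair[where R = R])
      show "(\<lambda>p. ?I p * m p * w p) \<in> borel_measurable borel"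
        using m(1) borel_measurable_continuous_onI[OF w(1)] by (rule borel_measurable_times)
      show "\<bar>?I p * m p * w p\<bar> \<le> \<bar>M\<bar> * \<bar>K\<bar>" for p
      proof (cases "fst p \<ge> 0")
        case True
        then have "\<bar>m p\<bar> \<le> \<bar>M\<bar>" using m(2)[of "fst p" "snd p"] by simp
        then show ?thesis using K'[of p] by (auto simp: indicator_def abs_mult intro!: mult_mono)
      qed (auto simp: indicator_def)
    qed (use w(2) in auto)
  qed
  have w0: "\<alpha> t * \<beta>' u = 0" "\<alpha>' t * \<beta> u = 0" "\<alpha> t * \<beta> u = 0" if "\<bar>t\<bar> > R \<or> \<bar>u\<bar> > R" for t u
    using that \<alpha>0[of t] \<beta>0[of u] by auto
  have zi: "integrable lborel (\<lambda>p. ?I p * z (fst p) (snd p) * (\<alpha>' (fst p) * \<beta> (snd p)))"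
    by (rule int[of _ 1]) (use z_jointly_measurable z_range w0 c in auto)
  have pi: "integrable lborel (\<lambda>p. ?I p * proj (fst p) (snd p) * (\<alpha> (fst p) * \<beta>' (snd p)))"
    by (rule int[of _ "h 1 * exp (h 1 * D)"]) (use z_jointly_measurable proj_bounded w0 c in auto)
  have fi: "integrable lborel (\<lambda>p. ?I p * flux g z (fst p) (snd p) * (\<alpha> (fst p) * \<beta>' (snd p)))"
    by (rule int[of _ "h 1 * exp (h 1 * D)"]) (use flux_jointly_measurable flux_range w0 c in auto)
  have test: "test_function (\<lambda>t u. \<alpha> t * \<beta> u) (\<lambda>t u. \<alpha>' t * \<beta> u) (\<lambda>t u. \<alpha> t * \<beta>' u)"
    unfolding test_function_def
  proof (intro conjI allI exI[of _ R] impI)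
    show "((\<lambda>s. \<alpha> s * \<beta> u) has_real_derivative \<alpha>' t * \<beta> u) (at t)"
      "((\<lambda>v. \<alpha> t * \<beta> v) has_real_derivative \<alpha> t * \<beta>' u) (at u)" for t u
      by (auto intro!: derivative_eq_intros \<alpha>(1) \<beta>(1))
    show "\<alpha> t * \<beta> u = 0" if "R < \<bar>t\<bar> \<or> R < \<bar>u\<bar>" for t u
      by (rule w0(3)) (use that in auto)
  qed (use c in \<open>simp_all add: case_prod_beta\<close>)
  have "- (LINT p:?S|lborel. z (fst p) (snd p) * (\<alpha>' (fst p) * \<beta> (snd p)))
        - (LINT u|lborel. z 0 u * (\<alpha> 0 * \<beta> u))
        + (LINT p:?S|lborel. flux g z (fst p) (snd p) * (\<alpha> (fst p) * \<beta>' (snd p)))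
        = - (LINT p:?S|lborel. (proj (fst p) (snd p) - flux g z (fst p) (snd p)) * (\<alpha> (fst p) * \<beta>' (snd p)))"
    using solution test unfolding weak_solution_def weak_equation_def mu_pairing_def by blast
  moreover have "(LINT p:?S|lborel. (proj (fst p) (snd p) - flux g z (fst p) (snd p)) * (\<alpha> (fst p) * \<beta>' (snd p)))
    = (LINT p:?S|lborel. proj (fst p) (snd p) * (\<alpha> (fst p) * \<beta>' (snd p)))
      - (LINT p:?S|lborel. flux g z (fst p) (snd p) * (\<alpha> (fst p) * \<beta>' (snd p)))"
    unfolding set_lebesgue_integral_def
    using Bochner_Integration.integral_diff[OF pi fi] by (simp add: algebra_simps)
  moreover have "\<alpha> 0 = 0" using \<alpha>0[of 0] by simp
  ultimately have eq: "(LINT p|lborel. ?I p * z (fst p) (snd p) * (\<alpha>' (fst p) * \<beta> (snd p)))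
    = (LINT p|lborel. ?I p * proj (fst p) (snd p) * (\<alpha> (fst p) * \<beta>' (snd p)))"
    by (simp add: set_lebesgue_integral_def mult.assoc)
  have z1: "(LINT u|lborel. ?I (t, u) * z (fst (t, u)) (snd (t, u)) * (\<alpha>' (fst (t, u)) * \<beta> (snd (t, u))))
      = \<alpha>' t * (LINT u|lborel. z t u * \<beta> u)" for t
  proof (cases "t > 0")
    case True
    then show ?thesis
      by (subst Bochner_Integration.integral_mult_right_zero[symmetric])
        (auto simp: indicator_def algebra_simps intro!: Bochner_Integration.integral_cong)
  next
    case False
    then show ?thesis using \<alpha>0[of t] by simp
  qed
  have p1: "(LINT u|lborel. ?I (t, u) * proj (fst (t, u)) (snd (t, u)) * (\<alpha> (fst (t, u)) * \<beta>' (snd (t, u))))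
      = \<alpha> t * (LINT u|lborel. proj t u * \<beta>' u)" for t
  proof (cases "t > 0")
    case True
    then show ?thesis
      by (subst Bochner_Integration.integral_mult_right_zero[symmetric])
        (auto simp: indicator_def algebra_simps intro!: Bochner_Integration.integral_cong)
  next
    case False
    then show ?thesis using \<alpha>0[of t] by simp
  qed
  note iz = integral_lborel_iterated[OF zi, unfolded z1]
  note ip = integral_lborel_iterated[OF pi, unfolded p1]
  show "integrable lborel (\<lambda>t. \<alpha>' t * (LINT u|lborel. z t u * \<beta> u))" by (rule iz(1))
  show "integrable lborel (\<lambda>t. \<alpha> t * (LINT u|lborel. proj t u * \<beta>' u))" by (rule ip(1))
  show "(LINT t|lborel. \<alpha>' t * (LINT u|lborel. z t u * \<beta> u))
      = (LINT t|lborel. \<alpha> t * (LINT u|lborel. proj t u * \<beta>' u))"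
    using eq iz(2) ip(2) by simp
qed

text \<open>If the flux through a window on the left exceeds the flux through a window on the right,
  then \<open>z\<close> loses mass in between; being non-negative, it cannot do so for long.\<close>

lemma mass_decay:
  assumes t12: "0 < t1" "t1 < t2" and pr: "p1 < p2" "p2 \<le> r1" "r1 < r2" and c: "c \<ge> 0"
    and gap: "\<And>t. t1 \<le> t \<Longrightarrow> t \<le> t2 \<Longrightarrow> \<exists>A. (AE u in lborel. u \<in> {p1<..<p2} \<longrightarrow> A + c \<le> proj t u) \<and>
      (AE u in lborel. u \<in> {r1<..<r2} \<longrightarrow> proj t u \<le> A)"
  shows "c * (t2 - t1) \<le> (LINT u:{p1..r2}|lborel. z t1 u)"
proof -
  obtain S S' where S: "\<And>u. (S has_real_derivative S' u) (at u)" "continuous_on UNIV S'"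
    "\<And>u. 0 \<le> S' u" "\<And>u. u \<notin> {p1<..<p2} \<Longrightarrow> S' u = 0"
    "\<And>u. u \<le> p1 \<Longrightarrow> S u = 0" "\<And>u. p2 \<le> u \<Longrightarrow> S u = 1" "\<And>u. 0 \<le> S u" "\<And>u. S u \<le> 1"
    "integrable lborel S'" "(LINT u|lborel. S' u) = 1"
    using smooth_step[OF pr(1)] by metis
  obtain Z Z' where Z: "\<And>u. (Z has_real_derivative Z' u) (at u)" "continuous_on UNIV Z'"
    "\<And>u. 0 \<le> Z' u" "\<And>u. u \<notin> {r1<..<r2} \<Longrightarrow> Z' u = 0"
    "\<And>u. u \<le> r1 \<Longrightarrow> Z u = 0" "\<And>u. r2 \<le> u \<Longrightarrow> Z u = 1" "\<And>u. 0 \<le> Z u" "\<And>u. Z u \<le> 1"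
    "integrable lborel Z'" "(LINT u|lborel. Z' u) = 1"
    using smooth_step[OF pr(3)] by metis
  define \<beta> where "\<beta> = (\<lambda>u. S u - Z u)"
  define \<beta>' where "\<beta>' = (\<lambda>u. S' u - Z' u)"
  have \<beta>_range: "0 \<le> \<beta> u" "\<beta> u \<le> indicator {p1..r2} u" for u
    using S(5-8)[of u] Z(5-8)[of u] pr
    by (cases "p2 \<le> u"; auto simp: \<beta>_def indicator_def)+
  have \<beta>_meas: "\<beta> \<in> borel_measurable borel"
    unfolding \<beta>_def using S(1) Z(1)
    by (intro borel_measurable_continuous_onI continuous_at_imp_continuous_on ballI continuous_diff)
      (auto intro: DERIV_isCont)
  define m where "m = (\<lambda>t. LINT u|lborel. z t u * \<beta> u)"
  define n where "n = (\<lambda>t. LINT u|lborel. proj t u * \<beta>' u)"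
  define M where "M = (LINT u:{p1..r2}|lborel. z t1 u)"
  obtain L where L: "L > 0" "\<forall>s\<in>{0..t2}. \<forall>t\<in>{0..t2}. (LINT u|lborel. \<bar>z t u - z s u\<bar>) \<le> L * \<bar>t - s\<bar>"
    using Q_time_lipschitz[of t2] t12 by auto
  have ind: "integrable lborel (\<lambda>u. indicator {p1..r2} u :: real)"
    by (intro integrable_real_indicator) (auto simp: emeasure_lborel_Icc_eq)
  have zb: "integrable lborel (\<lambda>u. z t u * \<beta> u)" if "t \<ge> 0" for t
    by (rule Bochner_Integration.integrable_bound[OF ind])
      (use that z_measurable[OF that] \<beta>_meas \<beta>_range z_range[OF that] in
        \<open>auto simp: abs_mult intro!: AE_I2 order_trans[OF mult_left_le_one_le]\<close>)
  have m_nonneg: "m t \<ge> 0" if "t \<ge> 0" for t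
    unfolding m_def using z_range[OF that] \<beta>_range by (intro Bochner_Integration.integral_nonneg) auto
  have "m t1 \<le> M"
    unfolding m_def M_def set_lebesgue_integral_def
  proof (rule Bochner_Integration.integral_mono)
    show "integrable lborel (\<lambda>u. indicator {p1..r2} u *\<^sub>R z t1 u)"
      by (rule integrableI_bounded_set_indicator[where B = 1])
        (use z_measurable[of t1] z_range[of t1] t12 in \<open>auto simp: emeasure_lborel_Icc_eq\<close>)
    show "z t1 u * \<beta> u \<le> indicator {p1..r2} u *\<^sub>R z t1 u" for u
      using \<beta>_range(2)[of u] z_range[of t1 u] t12 mult_left_mono[OF \<beta>_range(2)[of u], of "z t1 u"]
      by (simp add: mult.commute)
  qed (use zb t12 in auto)
  have m_le: "m t \<le> M + L * (t - t1)" if "t1 \<le> t" "t \<le> t2" for t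
  proof -
    have d: "integrable lborel (\<lambda>u. z t u - z t1 u)"
      using Bochner_Integration.integrable_diff[OF z_integrable[of t] z_integrable[of t1]] that t12 by simp
    have "m t - m t1 = (LINT u|lborel. z t u * \<beta> u - z t1 u * \<beta> u)"
      unfolding m_def using zb that t12 by simp
    also have "\<dots> \<le> (LINT u|lborel. \<bar>z t u - z t1 u\<bar>)"
    proof (rule Bochner_Integration.integral_mono)
      fix u
      have "z t u * \<beta> u - z t1 u * \<beta> u = (z t u - z t1 u) * \<beta> u" by (simp add: algebra_simps)
      also have "\<dots> \<le> \<bar>z t u - z t1 u\<bar> * 1"
        using \<beta>_range(1)[of u] order_trans[OF \<beta>_range(2)[of u] indicator_le_1]
        by (intro mult_mono) auto
      finally show "z t u * \<beta> u - z t1 u * \<beta> u \<le> \<bar>z t u - z t1 u\<bar>" by simp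
    qed (use zb d that t12 in auto)
    also have "\<dots> \<le> L * (t - t1)" using L(2)[rule_format, of t1 t] that t12 by simp
    finally show ?thesis using \<open>m t1 \<le> M\<close> by simp
  qed
  have n_ge: "c \<le> n t" if t: "t1 \<le> t" "t \<le> t2" for t
  proof -
    obtain A where A: "AE u in lborel. u \<in> {p1<..<p2} \<longrightarrow> A + c \<le> proj t u"
      "AE u in lborel. u \<in> {r1<..<r2} \<longrightarrow> proj t u \<le> A"
      using gap[OF t] by blast
    have "(LINT u|lborel. (A + c) * S' u - A * Z' u) = c"
      using S(9,10) Z(9,10) by simp
    moreover have "(LINT u|lborel. (A + c) * S' u - A * Z' u) \<le> n t"
      unfolding n_def
    proof (rule integral_mono_AE)
      show "integrable lborel (\<lambda>u. (A + c) * S' u - A * Z' u)" using S(9) Z(9) by simp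
      have t0: "t \<ge> 0" using t t12 by simp
      have pm: "(\<lambda>u. proj t u) \<in> borel_measurable borel"
        using measurable_compose[OF measurable_Pair1' z_jointly_measurable(2)[folded borel_prod], of t] t0
        by (simp add: comp_def)
      show "integrable lborel (\<lambda>u. proj t u * \<beta>' u)"
      proof (rule Bochner_Integration.integrable_bound)
        show "integrable lborel (\<lambda>u. h 1 * exp (h 1 * D) * (S' u + Z' u))" using S(9) Z(9) by simp
        show "AE u in lborel. norm (proj t u * \<beta>' u) \<le> norm (h 1 * exp (h 1 * D) * (S' u + Z' u))"
        proof (rule AE_I2)
          fix u
          have "\<bar>\<beta>' u\<bar> \<le> S' u + Z' u" using S(3)[of u] Z(3)[of u] by (simp add: \<beta>'_def)
          then have "\<bar>proj t u\<bar> * \<bar>\<beta>' u\<bar> \<le> h 1 * exp (h 1 * D) * (S' u + Z' u)"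
            using proj_bounded[OF t0, of u] by (intro mult_mono) (auto simp: h_1_pos less_imp_le)
          then show "norm (proj t u * \<beta>' u) \<le> norm (h 1 * exp (h 1 * D) * (S' u + Z' u))"
            using S(3)[of u] Z(3)[of u] h_1_pos by (simp add: abs_mult)
        qed
        have "\<beta>' \<in> borel_measurable borel"
          unfolding \<beta>'_def by (intro borel_measurable_diff borel_measurable_continuous_onI S(2) Z(2))
        with pm show "(\<lambda>u. proj t u * \<beta>' u) \<in> borel_measurable lborel"
          by simp
      qed
      show "AE u in lborel. (A + c) * S' u - A * Z' u \<le> proj t u * \<beta>' u"
        using A
      proof eventually_elim
        fix u assume a: "u \<in> {p1<..<p2} \<longrightarrow> A + c \<le> proj t u" "u \<in> {r1<..<r2} \<longrightarrow> proj t u \<le> A"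
        have "(A + c) * S' u \<le> proj t u * S' u"
          using a(1) S(3,4)[of u] by (cases "u \<in> {p1<..<p2}") (auto intro: mult_right_mono)
        moreover have "proj t u * Z' u \<le> A * Z' u"
          using a(2) Z(3,4)[of u] by (cases "u \<in> {r1<..<r2}") (auto intro: mult_right_mono)
        ultimately show "(A + c) * S' u - A * Z' u \<le> proj t u * \<beta>' u" by (simp add: \<beta>'_def algebra_simps)
      qed
    qed
    ultimately show ?thesis by simp
  qed
  have approx: "c * (t2 - t1 - 2 * e) \<le> M + L * e" if e: "0 < e" "2 * e < t2 - t1" for e
  proof -
    obtain P P' where P: "\<And>u. (P has_real_derivative P' u) (at u)" "continuous_on UNIV P'"
      "\<And>u. 0 \<le> P' u" "\<And>u. u \<notin> {t1<..<t1 + e} \<Longrightarrow> P' u = 0"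
      "\<And>u. u \<le> t1 \<Longrightarrow> P u = 0" "\<And>u. t1 + e \<le> u \<Longrightarrow> P u = 1" "\<And>u. 0 \<le> P u" "\<And>u. P u \<le> 1"
      "integrable lborel P'" "(LINT u|lborel. P' u) = 1"
      using smooth_step[of t1 "t1 + e"] e by (metis less_add_same_cancel1)
    obtain R R' where R: "\<And>u. (R has_real_derivative R' u) (at u)" "continuous_on UNIV R'"
      "\<And>u. 0 \<le> R' u" "\<And>u. u \<notin> {t2 - e<..<t2} \<Longrightarrow> R' u = 0"
      "\<And>u. u \<le> t2 - e \<Longrightarrow> R u = 0" "\<And>u. t2 \<le> u \<Longrightarrow> R u = 1" "\<And>u. 0 \<le> R u" "\<And>u. R u \<le> 1"
      "integrable lborel R'" "(LINT u|lborel. R' u) = 1"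
      using smooth_step[of "t2 - e" t2] e by (metis diff_less_eq less_add_same_cancel1)
    define \<alpha> where "\<alpha> = (\<lambda>t. P t - R t)"
    define \<alpha>' where "\<alpha>' = (\<lambda>t. P' t - R' t)"
    define b where "b = Max {\<bar>t2\<bar>, \<bar>p1\<bar>, \<bar>r2\<bar>}"
    have b: "\<bar>t2\<bar> \<le> b" "\<bar>p1\<bar> \<le> b" "\<bar>r2\<bar> \<le> b" by (auto simp: b_def)
    have \<alpha>0: "\<alpha> t = 0 \<and> \<alpha>' t = 0" if "t \<le> t1 \<or> t2 \<le> t" for t
      using that P(4-6)[of t] R(4-6)[of t] e by (auto simp: \<alpha>_def \<alpha>'_def)
    have \<beta>0: "\<beta> u = 0 \<and> \<beta>' u = 0" if "u \<le> p1 \<or> r2 \<le> u" for u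
      using that S(4-6)[of u] Z(4-6)[of u] pr by (auto simp: \<beta>_def \<beta>'_def)
    have prod: "integrable lborel (\<lambda>t. \<alpha>' t * m t)" "integrable lborel (\<lambda>t. \<alpha> t * n t)"
      "(LINT t|lborel. \<alpha>' t * m t) = (LINT t|lborel. \<alpha> t * n t)"
    proof -
      have d: "\<And>t. (\<alpha> has_real_derivative \<alpha>' t) (at t)" "continuous_on UNIV \<alpha>'"
        "\<And>u. (\<beta> has_real_derivative \<beta>' u) (at u)" "continuous_on UNIV \<beta>'"
        unfolding \<alpha>_def \<alpha>'_def \<beta>_def \<beta>'_def
        by (intro DERIV_diff P R S Z continuous_on_diff)+
      have a: "\<alpha> t = 0 \<and> \<alpha>' t = 0" if "\<bar>t\<bar> > b \<or> t \<le> 0" for t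
        by (rule \<alpha>0) (use that b t12 in auto)
      have b: "\<beta> u = 0 \<and> \<beta>' u = 0" if "\<bar>u\<bar> > b" for u
        by (rule \<beta>0) (use that b in auto)
      show "integrable lborel (\<lambda>t. \<alpha>' t * m t)" "integrable lborel (\<lambda>t. \<alpha> t * n t)"
        "(LINT t|lborel. \<alpha>' t * m t) = (LINT t|lborel. \<alpha> t * n t)"
        unfolding m_def n_def using weak_equation_product[OF d a b] by auto
    qed
    have "(LINT t|lborel. \<alpha>' t * m t) \<le> (LINT t|lborel. (M + L * e) * P' t)"
    proof (rule Bochner_Integration.integral_mono[OF prod(1)])
      fix t
      have "P' t * m t \<le> P' t * (M + L * e)"
      proof (cases "t \<in> {t1<..<t1 + e}")
        case True
        then have "m t \<le> M + L * (t - t1)" using m_le[of t] e by simp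
        also have "\<dots> \<le> M + L * e" using True L(1) by simp
        finally show ?thesis using P(3)[of t] by (rule mult_left_mono)
      qed (use P(4)[of t] in simp)
      moreover have "0 \<le> R' t * m t"
      proof (cases "t \<in> {t2 - e<..<t2}")
        case True
        then show ?thesis using R(3)[of t] m_nonneg[of t] e t12 by simp
      qed (use R(4)[of t] in simp)
      ultimately show "\<alpha>' t * m t \<le> (M + L * e) * P' t" by (simp add: \<alpha>'_def algebra_simps)
    qed (use P(9) in simp)
    also have "\<dots> = M + L * e" using P(10) by simp
    finally have 1: "(LINT t|lborel. \<alpha>' t * m t) \<le> M + L * e" .
    have "(LINT t|lborel. c * indicator {t1 + e..t2 - e} t) \<le> (LINT t|lborel. \<alpha> t * n t)"
    proof (rule Bochner_Integration.integral_mono[OF _ prod(2)])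
      show "integrable lborel (\<lambda>t. c * indicator {t1 + e..t2 - e} t)"
        by (intro integrable_mult_right integrable_real_indicator) (auto simp: emeasure_lborel_Icc_eq)
      fix t
      show "c * indicator {t1 + e..t2 - e} t \<le> \<alpha> t * n t"
      proof (cases "t \<in> {t1..t2}")
        case True
        have "indicator {t1 + e..t2 - e} t \<le> \<alpha> t"
          using P(5-8)[of t] R(5-8)[of t] e by (auto simp: \<alpha>_def indicator_def)
        then show ?thesis
          using n_ge[of t] True c mult_mono[of "indicator {t1 + e..t2 - e} t" "\<alpha> t" c "n t"]
          by (simp add: mult.commute order_trans[OF indicator_pos_le])
      next
        case False
        then show ?thesis using \<alpha>0[of t] e by (auto simp: indicator_def)
      qed
    qed
    moreover have "(LINT t|lborel. c * indicator {t1 + e..t2 - e} t) = c * (t2 - t1 - 2 * e)"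
      using e by simp
    ultimately show ?thesis using 1 prod(3) by linarith
  qed
  show ?thesis
    unfolding M_def[symmetric]
  proof (rule tendsto_le[of "at_right (0::real)"])
    show "((\<lambda>e. M + L * e) \<longlongrightarrow> M) (at_right 0)" by (auto intro!: tendsto_eq_intros)
    show "((\<lambda>e. c * (t2 - t1 - 2 * e)) \<longlongrightarrow> c * (t2 - t1)) (at_right 0)" by (auto intro!: tendsto_eq_intros)
    show "\<forall>\<^sub>F e in at_right 0. c * (t2 - t1 - 2 * e) \<le> M + L * e"
      using eventually_at_right_real[of 0 "(t2 - t1) / 2"] t12
      by (auto elim!: eventually_mono intro!: approx)
  qed simp
qed

end

section \<open>The front next to the state zero\<close>

lemma bounded_interval_between:
  fixes P :: "real set"
  assumes P: "is_interval P" and pos: "measure lborel P > 0"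
  obtains a b where "a < b" "{a<..<b} \<subseteq> P" "P \<subseteq> {a..b}" "measure lborel P = b - a"
proof -
  have borel: "P \<in> sets lborel" using is_interval_borel[OF P] by simp
  have fin: "emeasure lborel P \<noteq> \<infinity>" using pos by (auto simp: measure_def)
  have ne: "P \<noteq> {}" using pos by auto
  then obtain p where p: "p \<in> P" by blast
  have mid: "x \<in> P" if "u \<in> P" "v \<in> P" "u \<le> x" "x \<le> v" for u v x
    using mem_is_interval_1_I[OF P that(1,2)] that by auto
  define m where "m = measure lborel P"
  have len: "v - u \<le> m" if "u \<in> P" "v \<in> P" "u \<le> v" for u v
  proof -
    have "{u..v} \<subseteq> P" using mid[OF that(1,2)] by auto
    then have "emeasure lborel {u..v} \<le> emeasure lborel P"
      using borel by (rule emeasure_mono)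
    then have "ennreal (v - u) \<le> ennreal m"
      using that fin by (simp add: m_def emeasure_eq_ennreal_measure)
    then show ?thesis by (simp add: m_def)
  qed
  have bdd: "bdd_above P" "bdd_below P"
  proof -
    have m0: "m \<ge> 0" by (simp add: m_def)
    have "x \<le> p + m \<and> p - m \<le> x" if "x \<in> P" for x
      using len[OF p that] len[OF that p] m0 by (cases "p \<le> x") auto
    then show "bdd_above P" "bdd_below P" by (auto intro!: bdd_aboveI bdd_belowI)
  qed
  define a b where "a = Inf P" and "b = Sup P"
  have sub: "P \<subseteq> {a..b}" using bdd by (auto simp: a_def b_def intro: cInf_lower cSup_upper)
  have sup: "{a<..<b} \<subseteq> P"
  proof
    fix x assume x: "x \<in> {a<..<b}"
    obtain u where "u \<in> P" "u < x" using cInf_lessD[OF ne, of x] x by (auto simp: a_def)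
    moreover obtain v where "v \<in> P" "x < v" using less_cSupD[OF ne, of x] x by (auto simp: b_def)
    ultimately show "x \<in> P" using mid[of u v x] by simp
  qed
  have ab: "a \<le> b" using sub p by auto
  have "emeasure lborel {a<..<b} \<le> emeasure lborel P" "emeasure lborel P \<le> emeasure lborel {a..b}"
    using sub sup borel by (auto intro: emeasure_mono)
  then have "emeasure lborel P = ennreal (b - a)" using ab by (simp add: antisym)
  then have meas: "measure lborel P = b - a" using ab by (simp add: measure_def)
  then have "a < b" using pos by simp
  then show thesis using that sup sub meas by blast
qed

context flow
begin

lemma projected_flux_ge:
  assumes t: "t \<ge> 0" and u: "u1 < u2" "z t u2 > 0" and c: "0 \<le> c" "c \<le> g 0"
    and 1: "z t u1 = 0 \<or> c \<le> g (z t u1)"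
    and g: "AE v in lborel. v \<in> {u1<..<u2} \<longrightarrow> c \<le> g (z t v)"
  shows "c * (\<Phi> t u2 * (1 + c * ((u2 - u1) / 2))) \<le> proj t u1"
proof (cases "z t u1 = 0 \<and> measure lborel (plateau z t u1) > 0")
  case False
  have "c * (\<Phi> t u2 * (1 + c * ((u2 - u1) / 2))) \<le> g (z t u1) * \<Phi> t u1"
  proof (rule mult_mono)
    show "c \<le> g (z t u1)" using 1 c by auto
    have "\<Phi> t u2 * (1 + c * ((u2 - u1) / 2)) \<le> \<Phi> t u2 * (1 + c * (u2 - u1))"
      using u c \<Phi>_ge_1[OF t, of u2] by (intro mult_left_mono add_mono) auto
    also have "\<dots> \<le> \<Phi> t u1" by (rule \<Phi>_ge) (use t u g in auto)
    finally show "\<Phi> t u2 * (1 + c * ((u2 - u1) / 2)) \<le> \<Phi> t u1" .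
    show "0 \<le> \<Phi> t u2 * (1 + c * ((u2 - u1) / 2))"
      using \<Phi>_ge_1[OF t, of u2] u c by (intro mult_nonneg_nonneg) auto
  qed (use c 1 in auto)
  then show ?thesis using False by (auto simp: projected_flux_def flux_eq)
next
  case True
  define P where "P = plateau z t u1"
  have P: "is_interval P"
    unfolding P_def plateau_def is_interval_connected_1 by (rule connected_connected_component)
  have z0: "z t v = 0" if "v \<in> P" for v
    using connected_component_subset[of "{v. z t v = 0}" u1] that by (auto simp: P_def plateau_def)
  have u1P: "u1 \<in> P" using True by (simp add: P_def plateau_def connected_component_refl)
  obtain a b where ab: "a < b" "{a<..<b} \<subseteq> P" "P \<subseteq> {a..b}" "measure lborel P = b - a"
    using bounded_interval_between[OF P] True by (auto simp: P_def)
  have u2: "u2 \<notin> P" using z0 u by auto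
  have left: "v < u2" if "v \<in> P" for v
    using mem_is_interval_1_I[OF P u1P that, of u2] u u2 by force
  have "b \<le> u2"
  proof (rule ccontr)
    assume "\<not> b \<le> u2"
    then obtain v where "max a u2 < v" "v < b" using dense[of "max a u2" b] ab(1) by auto
    then show False using left[of v] ab(2) by auto
  qed
  have "a \<le> u1" using ab(3) u1P by auto
  define K where "K = g 0 * \<Phi> t u2"
  have K: "K \<ge> c * \<Phi> t u2" "K \<ge> 0"
    using c \<Phi>_ge_1[OF t, of u2] by (auto simp: K_def intro: mult_right_mono)
  have lower: "K * (1 + c * (u2 - v)) \<le> flux g z t v" if v: "v \<in> P" for v
  proof -
    have "\<Phi> t u2 * (1 + c * (u2 - v)) \<le> \<Phi> t v"
    proof (rule \<Phi>_ge[OF t])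
      show "v \<le> u2" using left[OF v] by simp
      show "AE x in lborel. x \<in> {v<..<u2} \<longrightarrow> c \<le> g (z t x)"
        using g
      proof (eventually_elim, intro impI)
        fix x assume x: "x \<in> {u1<..<u2} \<longrightarrow> c \<le> g (z t x)" "x \<in> {v<..<u2}"
        show "c \<le> g (z t x)"
        proof (cases "u1 < x")
          case False
          then have "x \<in> P" using mem_is_interval_1_I[OF P v u1P, of x] x by auto
          then show ?thesis using z0 c by simp
        qed (use x in auto)
      qed
    qed
    then have "g 0 * (\<Phi> t u2 * (1 + c * (u2 - v))) \<le> g 0 * \<Phi> t v"
      using g_0 by (intro mult_left_mono) auto
    then show ?thesis using z0[OF v] by (simp add: flux_eq K_def algebra_simps)
  qed
  have fundamental: "has_bochner_integral lborel (\<lambda>v. K * (1 + c * (u2 - v)) * indicator {a..b} v)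
      (K * ((1 + c * u2) * b - c * b\<^sup>2 / 2) - K * ((1 + c * u2) * a - c * a\<^sup>2 / 2))"
    using ab(1) by (intro has_bochner_integral_FTC_Icc_real)
      (auto intro!: derivative_eq_intros continuous_intros simp: algebra_simps)
  have val: "K * ((1 + c * u2) * b - c * b\<^sup>2 / 2) - K * ((1 + c * u2) * a - c * a\<^sup>2 / 2)
      = K * (1 + c * (u2 - (a + b) / 2)) * (b - a)"
    by (simp add: field_simps power2_eq_square)
  have "(LINT v|lborel. K * (1 + c * (u2 - v)) * indicator {a..b} v)
      \<le> (LINT v|lborel. indicator P v *\<^sub>R flux g z t v)"
  proof (rule integral_mono_AE)
    show "integrable lborel (\<lambda>v. K * (1 + c * (u2 - v)) * indicator {a..b} v)"
      using fundamental by (simp add: has_bochner_integral_iff)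
    show "integrable lborel (\<lambda>v. indicator P v *\<^sub>R flux g z t v)"
    proof (rule integrableI_bounded_set_indicator[where B = "h 1 * exp (h 1 * D)"])
      show "P \<in> sets lborel" using is_interval_borel[OF P] by simp
      show "emeasure lborel P < \<infinity>"
        using emeasure_mono[OF ab(3), of lborel] ab(1) by (auto simp: le_less_trans)
    qed (use flux_range[OF t] flux_measurable[OF t] in auto)
    show "AE v in lborel. K * (1 + c * (u2 - v)) * indicator {a..b} v \<le> indicator P v *\<^sub>R flux g z t v"
      using AE_lborel_singleton[of a] AE_lborel_singleton[of b]
    proof eventually_elim
      fix v assume v: "v \<noteq> a" "v \<noteq> b"
      show "K * (1 + c * (u2 - v)) * indicator {a..b} v \<le> indicator P v *\<^sub>R flux g z t v"
      proof (cases "v \<in> P")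
        case True
        then show ?thesis using lower[OF True] ab(3) by (auto simp: indicator_def)
      next
        case False
        then have "v \<notin> {a..b}" using ab(2) v by (auto simp: subset_eq)
        then show ?thesis using False by simp
      qed
    qed
  qed
  then have "K * (1 + c * (u2 - (a + b) / 2)) * (b - a) \<le> (LINT v:P|lborel. flux g z t v)"
    using has_bochner_integral_integral_eq[OF fundamental] val by (simp add: set_lebesgue_integral_def)
  then have "K * (1 + c * (u2 - (a + b) / 2)) \<le> proj t u1"
    using True ab(1,4) by (simp add: projected_flux_def P_def[symmetric] pos_le_divide_eq)
  moreover have "c * \<Phi> t u2 * (1 + c * ((u2 - u1) / 2)) \<le> K * (1 + c * (u2 - (a + b) / 2))"
  proof (rule mult_mono[OF K(1) _ K(2)])
    have "(u2 - u1) / 2 \<le> u2 - (a + b) / 2" using \<open>b \<le> u2\<close> \<open>a \<le> u1\<close> by (simp add: field_simps)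
    then show "1 + c * ((u2 - u1) / 2) \<le> 1 + c * (u2 - (a + b) / 2)"
      by (intro add_left_mono mult_left_mono c)
    show "0 \<le> 1 + c * ((u2 - u1) / 2)" using u c by simp
  qed
  ultimately show ?thesis by (simp add: mult.assoc)
qed

text \<open>The front law is silent when the state on the right of the front is \<open>0\<close>. In that case the
  mean flux over the plateau exceeds the flux just to the right of it, so that the conservation
  law itself forces the front to move to the right with infinite speed.\<close>

lemma front_advances:
  assumes h0: "h 0 > 0" and t: "t > 0" and f: "-D < Y t" "Y t < 0" and zp: "zp t = 0"
    and C: "C \<ge> 0" and T: "t < T"
  shows "\<exists>s. t < s \<and> s \<le> T \<and> Y t + C * (s - t) \<le> Y s"
proof (rule ccontr)
  assume contra: "\<not> ?thesis"
  define f where "f = Y t"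
  define \<rho> where "\<rho> = (f + D) / 2"
  have \<rho>: "\<rho> > 0" "f - \<rho> = - D + \<rho>" using f by (auto simp: \<rho>_def f_def field_simps)
  obtain L where L: "L > 0" "\<forall>s\<in>{0..t + 1}. \<forall>t'\<in>{0..t + 1}. \<forall>u. \<bar>Q t' u - Q s u\<bar> \<le> L * \<bar>t' - s\<bar>"
    using Q_time_lipschitz[of "t + 1"] t by auto
  define \<omega> where "\<omega> = min (g 0 / 2) ((g 0)\<^sup>2 * \<rho> / 64)"
  define c where "c = (g 0)\<^sup>2 * \<rho> / 32"
  have g0: "g 0 > 0" using h0 by (simp add: h_0)
  have \<omega>: "\<omega> > 0" "\<omega> \<le> g 0 / 2" "2 * \<omega> \<le> c" "c > 0" using g0 \<rho> by (auto simp: \<omega>_def c_def)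
  have gap: "g 0 + \<omega> + c \<le> (g 0 - \<omega>) * (1 + (g 0 - \<omega>) * (\<rho> / 4))"
  proof -
    have "(g 0 / 2)\<^sup>2 * (\<rho> / 4) \<le> (g 0 - \<omega>)\<^sup>2 * (\<rho> / 4)"
      using \<omega> g0 \<rho> by (intro mult_right_mono power_mono) auto
    then have "2 * c \<le> (g 0 - \<omega>)\<^sup>2 * (\<rho> / 4)" by (simp add: c_def power2_eq_square)
    then show ?thesis using \<omega> by (simp add: algebra_simps power2_eq_square)
  qed
  have "\<forall>\<^sub>F x in at 0 within {0..}. dist (g x) (g 0) < \<omega>"
    using cont_g \<omega>(1) by (auto simp: continuous_on_def intro: tendstoD)
  then obtain \<delta>0 where \<delta>0: "\<delta>0 > 0" "\<And>x. x \<ge> 0 \<Longrightarrow> x < \<delta>0 \<Longrightarrow> x \<noteq> 0 \<Longrightarrow> \<bar>g x - g 0\<bar> < \<omega>"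
    by (auto simp: eventually_at dist_real_def)
  define \<delta> where "\<delta> = min (\<delta>0 / 2) (1 / 2)"
  have \<delta>: "\<delta> > 0" "\<delta> \<le> 1 / 2" "\<And>x. 0 \<le> x \<Longrightarrow> x \<le> \<delta> \<Longrightarrow> g 0 - \<omega> \<le> g x \<and> g x \<le> g 0 + \<omega>"
  proof -
    show "\<delta> > 0" "\<delta> \<le> 1 / 2" using \<delta>0 by (auto simp: \<delta>_def)
    fix x assume "0 \<le> x" "x \<le> \<delta>"
    then show "g 0 - \<omega> \<le> g x \<and> g x \<le> g 0 + \<omega>"
      using \<delta>0(1) \<delta>0(2)[of x] \<omega> by (cases "x = 0") (auto simp: \<delta>_def abs_less_iff)
  qed
  define M where "M = 2 * (L + C)"
  have M: "M > 0" using L C by (simp add: M_def)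
  define \<mu> where "\<mu> = min (\<delta> / 2) (c / (4 * M))"
  have \<mu>: "\<mu> > 0" "\<mu> \<le> \<delta> / 2" "4 * M * \<mu> \<le> c"
    using \<delta> \<omega> M by (auto simp: \<mu>_def min_def field_simps)
  have "\<forall>\<^sub>F q in at_right f. \<zeta> t q < \<mu>"
    using front_state_tendsto[OF t f(2)] zp \<mu>(1) by (simp add: f_def order_tendsto_iff)
  moreover have "\<forall>\<^sub>F q in at_right f. q \<in> {f<..<0}"
    using f by (intro eventually_at_right_real) (simp add: f_def)
  ultimately have "\<forall>\<^sub>F q in at_right f. \<zeta> t q < \<mu> \<and> q \<in> {f<..<0}" by eventually_elim auto
  then obtain q0 where q0: "\<zeta> t q0 < \<mu>" "f < q0" "q0 < 0"
    using eventually_happens'[OF trivial_limit_at_right_real] by fastforce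
  define \<theta> where "\<theta> = min ((q0 - f) / 2) \<rho>"
  have \<theta>: "\<theta> > 0" "f + 2 * \<theta> \<le> q0" "\<theta> \<le> \<rho>" using q0 \<rho> by (auto simp: \<theta>_def min_def field_simps)
  have y\<theta>: "y t (f + 2 * \<theta>) \<le> \<mu>"
    using y_mono[OF t, of "f + 2 * \<theta>" q0] \<theta> q0 by (auto simp: y_def f_def)
  obtain d where d: "d > 0" "d < t"
    "\<And>s q. \<bar>s - t\<bar> < d \<Longrightarrow> -D + \<theta> \<le> q \<Longrightarrow> q + \<theta> < 0 \<Longrightarrow> y s q \<le> y t (q + \<theta>) + \<delta> / 2"
    using y_shift[OF t \<theta>(1), of "\<delta> / 2"] \<delta>(1) by (metis half_gt_zero)
  define \<tau> where "\<tau> = Min {T - t, d / 2, 1, \<theta> / (2 * M + L), \<rho> / (2 * L)}"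
  have "\<tau> \<in> {T - t, d / 2, 1, \<theta> / (2 * M + L), \<rho> / (2 * L)}" unfolding \<tau>_def by (rule Min_in) auto
  then have \<tau>0: "\<tau> > 0" using T d \<theta> M L \<rho> by auto
  have \<tau>1: "\<tau> \<le> T - t" "\<tau> \<le> d / 2" "\<tau> \<le> 1" "\<tau> \<le> \<theta> / (2 * M + L)" "\<tau> \<le> \<rho> / (2 * L)"
    unfolding \<tau>_def by (rule Min_le; simp)+
  have \<tau>2: "2 * M * \<tau> + L * \<tau> \<le> \<theta>" "L * \<tau> \<le> \<rho> / 2"
    using \<tau>1(4,5) M L by (simp_all add: pos_le_divide_eq algebra_simps)
  define x where "x = M * \<tau>"
  have x: "x > 0" "2 * x + L * \<tau> \<le> \<theta>" "C * \<tau> = x / 2 - L * \<tau>"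
  proof -
    show "x > 0" using M \<tau>0 by (simp add: x_def)
    show "2 * x + L * \<tau> \<le> \<theta>" using \<tau>2(1) by (simp add: x_def mult.assoc)
    show "C * \<tau> = x / 2 - L * \<tau>" by (simp add: x_def M_def algebra_simps)
  qed
  obtain ub where ub: "Q t ub = f" using Q_attains[of t f] t f by (auto simp: f_def)
  have drift: "\<bar>Q s u - Q t u\<bar> \<le> L * (s - t)" "L * (s - t) \<le> L * \<tau>" if "t \<le> s" "s \<le> t + \<tau>" for s u
  proof -
    have "\<forall>u. \<bar>Q s u - Q t u\<bar> \<le> L * \<bar>s - t\<bar>"
      by (rule bspec[OF bspec[OF L(2)]]) (use that t \<tau>1 in auto)
    then have "\<bar>Q s u - Q t u\<bar> \<le> L * \<bar>s - t\<bar>" by blast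
    then show "\<bar>Q s u - Q t u\<bar> \<le> L * (s - t)" using that by simp
    show "L * (s - t) \<le> L * \<tau>" using that L(1) by simp
  qed
  have Qb: "-D < Q s u" "Q s u \<le> f + \<theta>" "Q s u < 0"
    if s: "t \<le> s" "s \<le> t + \<tau>" and u: "ub - \<rho> \<le> u" "u \<le> ub + 2 * x" for s u
  proof -
    have "f - \<rho> \<le> Q t u"
      using Q_lipschitz[of t u ub] Q_mono[of t ub u] ub u t \<rho> by (cases "u \<le> ub") auto
    then show "-D < Q s u" using drift(1)[OF s, of u] drift(2)[OF s] \<tau>2 \<rho> by linarith
    have "Q t u \<le> f + 2 * x"
      using Q_lipschitz[of t ub u] Q_mono[of t u ub] ub u t x by (cases "u \<le> ub") auto
    then show "Q s u \<le> f + \<theta>" using drift(1)[OF s, of u] drift(2)[OF s] x by linarith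
    then show "Q s u < 0" using \<theta> q0 by linarith
  qed
  have small: "AE u in lborel. u \<in> {ub - \<rho>..ub + 2 * x} \<longrightarrow> z s u \<le> \<delta>"
    if s: "t \<le> s" "s \<le> t + \<tau>" for s
  proof -
    have "s > 0" using s t by simp
    from z_eq_y[OF this] show ?thesis
    proof (eventually_elim, intro impI)
      fix u assume u: "-D < Q s u \<and> Q s u < 0 \<longrightarrow> z s u = y s (Q s u)" "u \<in> {ub - \<rho>..ub + 2 * x}"
      then have b: "-D < Q s u" "Q s u \<le> f + \<theta>" "Q s u < 0" using Qb[OF s, of u] by auto
      then have "z s u = y s (Q s u)" using u(1) by simp
      also have "\<dots> \<le> y s (f + \<theta>)"
      proof (rule y_mono)
        show "s > 0" using s t by simp
        show "f + \<theta> \<le> 0" using \<theta> q0 by linarith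
      qed (rule b)
      also have "\<dots> \<le> y t (f + \<theta> + \<theta>) + \<delta> / 2"
      proof (rule d(3))
        show "\<bar>s - t\<bar> < d" using s \<tau>1(2) d(1) by simp
        show "-D + \<theta> \<le> f + \<theta>" using f(1) unfolding f_def by linarith
        show "f + \<theta> + \<theta> < 0" using \<theta>(2) q0(3) by linarith
      qed
      also have "\<dots> \<le> \<delta>"
      proof -
        have *: "f + \<theta> + \<theta> = f + 2 * \<theta>" by simp
        show ?thesis unfolding * using y\<theta> \<mu>(2) by linarith
      qed
      finally show "z s u \<le> \<delta>" .
    qed
  qed
  have pos: "z s u > 0" if s: "t \<le> s" "s \<le> t + \<tau>" and u: "ub + x \<le> u" "u \<le> ub + 2 * x" for s u
  proof (rule ccontr)
    assume "\<not> z s u > 0"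
    then have "z s u = 0" using z_range[of s u] s t by simp
    have b: "-D < Q s u" "Q s u < 0" using Qb[OF s, of u] u x \<rho> by auto
    then have "\<zeta> s (Q s u) = 0" using zeta_Q[of s u] \<open>z s u = 0\<close> s t by simp
    then have Ys: "Q s u \<le> Y s" using zeta_0_le_front b by blast
    have "1 / 2 * ((ub + x) - ub) \<le> Q t (ub + x) - Q t ub"
    proof (rule Q_diff_ge)
      show "AE v in lborel. v \<in> {ub<..<ub + x} \<longrightarrow> 1 / 2 \<le> 1 - z t v"
        using small[OF order_refl less_imp_le[OF less_add_same_cancel1[THEN iffD2, OF \<tau>0]]]
      proof (eventually_elim, intro impI)
        fix v assume "v \<in> {ub - \<rho>..ub + 2 * x} \<longrightarrow> z t v \<le> \<delta>" "v \<in> {ub<..<ub + x}"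
        then have "z t v \<le> \<delta>" using x(1) \<rho>(1) by auto
        then show "1 / 2 \<le> 1 - z t v" using \<delta>(2) by simp
      qed
    qed (use t x in auto)
    then have Qt: "f + x / 2 \<le> Q t u" using ub Q_mono[of t "ub + x" u] u t by simp
    show False
    proof (cases "s = t")
      case True
      then show False using Ys Qt x by (simp add: f_def)
    next
      case False
      have "f + x / 2 - L * \<tau> \<le> Y s" using drift(1)[OF s, of u] drift(2)[OF s] Qt Ys by linarith
      moreover have "C * (s - t) \<le> C * \<tau>" using C s by (intro mult_left_mono) auto
      ultimately have "Y t + C * (s - t) \<le> Y s" using x(3) by (simp add: f_def)
      moreover have "t < s" "s \<le> T" using False s \<tau>1 by auto
      ultimately show False using contra by blast
    qed
  qed
  have "c * (t + \<tau> - t) \<le> (LINT u:{ub - \<rho>..ub + 2 * x}|lborel. z t u)"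
  proof (rule mass_decay[where ?p2.0 = "ub - \<rho> / 2" and ?r1.0 = "ub + x"])
    fix s assume s: "t \<le> s" "s \<le> t + \<tau>"
    have s0: "s \<ge> 0" using s t by simp
    let ?B = "\<Phi> s (ub + x)"
    have B: "?B \<ge> 1" by (rule \<Phi>_ge_1[OF s0])
    show "\<exists>A. (AE u in lborel. u \<in> {ub - \<rho><..<ub - \<rho> / 2} \<longrightarrow> A + c \<le> proj s u) \<and>
      (AE u in lborel. u \<in> {ub + x<..<ub + 2 * x} \<longrightarrow> proj s u \<le> A)"
    proof (intro exI[of _ "(g 0 + \<omega>) * ?B"] conjI)
      show "AE u in lborel. u \<in> {ub + x<..<ub + 2 * x} \<longrightarrow> proj s u \<le> (g 0 + \<omega>) * ?B"
        using small[OF s]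
      proof (eventually_elim, intro impI)
        fix u assume u: "u \<in> {ub - \<rho>..ub + 2 * x} \<longrightarrow> z s u \<le> \<delta>" "u \<in> {ub + x<..<ub + 2 * x}"
        have "z s u > 0" "z s u \<le> \<delta>" using pos[OF s, of u] u \<rho> x by auto
        then have "proj s u = g (z s u) * \<Phi> s u" "g (z s u) \<le> g 0 + \<omega>"
          using \<delta>(3)[of "z s u"] by (auto simp: projected_flux_def flux_eq)
        moreover have "g (z s u) * \<Phi> s u \<le> (g 0 + \<omega>) * ?B"
          using \<Phi>_anti[OF s0, of "ub + x" u] \<Phi>_ge_1[OF s0, of u] calculation(2) u g0 \<omega>
          by (intro mult_mono) auto
        ultimately show "proj s u \<le> (g 0 + \<omega>) * ?B" by simp
      qed
      show "AE u in lborel. u \<in> {ub - \<rho><..<ub - \<rho> / 2} \<longrightarrow> (g 0 + \<omega>) * ?B + c \<le> proj s u"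
        using small[OF s]
      proof (eventually_elim, intro impI)
        fix u assume u: "u \<in> {ub - \<rho>..ub + 2 * x} \<longrightarrow> z s u \<le> \<delta>" "u \<in> {ub - \<rho><..<ub - \<rho> / 2}"
        have z: "0 \<le> z s u" "z s u \<le> \<delta>" using z_range[OF s0, of u] u \<rho> x by auto
        have "(g 0 - \<omega>) * (?B * (1 + (g 0 - \<omega>) * ((ub + x - u) / 2))) \<le> proj s u"
        proof (rule projected_flux_ge[OF s0])
          show "z s (ub + x) > 0" by (rule pos[OF s]) (use x in auto)
          show "AE v in lborel. v \<in> {u<..<ub + x} \<longrightarrow> g 0 - \<omega> \<le> g (z s v)"
            using small[OF s]
            by eventually_elim (use u x \<delta>(3) z_range[OF s0] in auto)
        qed (use u x \<rho> \<omega> g0 z \<delta>(3)[of "z s u"] in auto)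
        moreover have "?B * ((g 0 - \<omega>) * (1 + (g 0 - \<omega>) * (\<rho> / 4)))
            \<le> ?B * ((g 0 - \<omega>) * (1 + (g 0 - \<omega>) * ((ub + x - u) / 2)))"
          using u x \<rho> \<omega> g0 B by (intro mult_left_mono add_left_mono) auto
        moreover have "?B * (g 0 + \<omega> + c) \<le> ?B * ((g 0 - \<omega>) * (1 + (g 0 - \<omega>) * (\<rho> / 4)))"
          using gap B by (intro mult_left_mono) auto
        moreover have "1 * c \<le> ?B * c" using B \<omega> by (intro mult_right_mono) auto
        moreover have "?B * (g 0 + \<omega> + c) = (g 0 + \<omega>) * ?B + ?B * c" by (simp add: algebra_simps)
        moreover have "(g 0 - \<omega>) * (?B * (1 + (g 0 - \<omega>) * ((ub + x - u) / 2)))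
            = ?B * ((g 0 - \<omega>) * (1 + (g 0 - \<omega>) * ((ub + x - u) / 2)))"
          by (rule mult.left_commute)
        ultimately show "(g 0 + \<omega>) * ?B + c \<le> proj s u" by linarith
      qed
    qed
  qed (use t \<tau>0 \<rho> x \<omega> in auto)
  moreover have "(LINT u:{ub - \<rho>..ub + 2 * x}|lborel. z t u) \<le> (LINT u:{ub..ub + 2 * x}|lborel. \<mu>)"
    unfolding set_lebesgue_integral_def
  proof (rule integral_mono_AE)
    show "integrable lborel (\<lambda>u. indicator {ub - \<rho>..ub + 2 * x} u *\<^sub>R z t u)"
      by (rule integrableI_bounded_set_indicator[where B = 1])
        (use z_measurable[of t] z_range[of t] t in \<open>auto simp: emeasure_lborel_Icc_eq\<close>)
    show "integrable lborel (\<lambda>u. indicator {ub..ub + 2 * x} u *\<^sub>R \<mu>)"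
      by (intro integrable_scaleR_left integrable_real_indicator) (auto simp: emeasure_lborel_Icc_eq)
    show "AE u in lborel. indicator {ub - \<rho>..ub + 2 * x} u *\<^sub>R z t u \<le> indicator {ub..ub + 2 * x} u *\<^sub>R \<mu>"
      using z_eq_y[OF t]
    proof eventually_elim
      fix u assume u: "-D < Q t u \<and> Q t u < 0 \<longrightarrow> z t u = y t (Q t u)"
      show "indicator {ub - \<rho>..ub + 2 * x} u *\<^sub>R z t u \<le> indicator {ub..ub + 2 * x} u *\<^sub>R \<mu>"
      proof (cases "u \<in> {ub - \<rho>..ub + 2 * x}")
        case True
        then have b: "-D < Q t u" "Q t u \<le> f + \<theta>" "Q t u < 0" using Qb[of t u] \<tau>0 by auto
        then have z: "z t u = y t (Q t u)" using u by simp
        show ?thesis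
        proof (cases "u < ub")
          case True
          then have "Q t u \<le> f" using Q_mono[of t u ub] ub t by simp
          then show ?thesis using z True by (simp add: y_def f_def)
        next
          case False
          have "f + 2 * \<theta> \<le> 0" "Q t u \<le> f + 2 * \<theta>" using b(2) \<theta> q0(3) by linarith+
          then have "y t (Q t u) \<le> y t (f + 2 * \<theta>)" by (intro y_mono[OF t])
          then show ?thesis using z y\<theta> False True by auto
        qed
      next
        case False
        then show ?thesis using \<mu> by (auto simp: indicator_def)
      qed
    qed
  qed
  moreover have "(LINT u:{ub..ub + 2 * x}|lborel. \<mu>) = 2 * x * \<mu>"
    using x by (simp add: set_lebesgue_integral_def)
  ultimately have "c * \<tau> \<le> 2 * x * \<mu>" by simp
  also have "\<dots> = (4 * M * \<mu>) * \<tau> / 2" by (simp add: x_def)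
  also have "\<dots> \<le> c * \<tau> / 2" using \<mu>(3) \<tau>0 by (intro divide_right_mono mult_right_mono) auto
  also have "\<dots> < c * \<tau>" using \<omega> \<tau>0 by simp
  finally show False by simp
qed

end

section \<open>Motion of the front\<close>

lemma deriv_right_growth:
  fixes f :: "real \<Rightarrow> real"
  assumes "(f has_real_derivative \<sigma>) (at t)" "v < \<sigma>"
  shows "\<forall>\<^sub>F s in at_right t. f t + v * (s - t) \<le> f s"
proof -
  have "((\<lambda>s. (f s - f t) / (s - t)) \<longlongrightarrow> \<sigma>) (at_right t)"
    using assms(1) tendsto_within_subset[of _ _ t UNIV "{t<..}"] by (simp add: has_field_derivative_iff)
  then have "\<forall>\<^sub>F s in at_right t. v < (f s - f t) / (s - t)"
    using assms(2) by (simp add: order_tendsto_iff)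
  then show ?thesis
    using eventually_at_right_less[of t]
    by eventually_elim (simp add: pos_less_divide_eq algebra_simps)
qed

lemma deriv_left_growth:
  fixes f :: "real \<Rightarrow> real"
  assumes "(f has_real_derivative \<sigma>) (at t)" "\<sigma> < - v"
  shows "\<forall>\<^sub>F s in at_left t. f t + v * (t - s) \<le> f s"
proof -
  have "((\<lambda>s. (f s - f t) / (s - t)) \<longlongrightarrow> \<sigma>) (at_left t)"
    using assms(1) tendsto_within_subset[of _ _ t UNIV "{..<t}"] by (simp add: has_field_derivative_iff)
  then have "\<forall>\<^sub>F s in at_left t. (f s - f t) / (s - t) < - v"
    using assms(2) by (simp add: order_tendsto_iff)
  moreover have "\<forall>\<^sub>F s in at_left t. s < t" by (simp add: eventually_at_filter)
  ultimately show ?thesis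
    by eventually_elim (simp add: neg_divide_less_eq algebra_simps)
qed

lemma exp_gt_add_one:
  fixes x :: real
  assumes "x \<noteq> 0"
  shows "1 + x < exp x"
proof (cases "x \<le> -1")
  case True
  then show ?thesis using exp_gt_zero[of x] by linarith
next
  case False
  have "(1 + x / 2)\<^sup>2 \<le> (exp (x / 2))\<^sup>2"
    using exp_ge_add_one_self[of "x / 2"] False by (intro power_mono) auto
  also have "\<dots> = exp x" by (simp add: power2_eq_square flip: exp_add)
  finally have "1 + x + x\<^sup>2 / 4 \<le> exp x" by (simp add: power2_eq_square field_simps)
  moreover have "x\<^sup>2 > 0" using assms by simp
  ultimately show ?thesis by linarith
qed

lemma below_value_at_1:
  fixes f :: "real \<Rightarrow> real"
  assumes "continuous_on {0..} f" "w < f 1"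
  obtains \<eta> where "\<eta> > 0" "\<eta> \<le> 1" "\<And>x. 0 \<le> x \<Longrightarrow> x \<le> 1 \<Longrightarrow> f x \<le> w \<Longrightarrow> \<eta> \<le> 1 - x"
proof -
  have "(f \<longlongrightarrow> f 1) (at 1 within {0..})" using assms(1) by (simp add: continuous_on_def)
  then have "\<forall>\<^sub>F x in at 1 within {0..}. w < f x" using assms(2) by (simp add: order_tendsto_iff)
  then obtain d where d: "d > 0" "\<And>x. x \<ge> 0 \<Longrightarrow> x \<noteq> 1 \<Longrightarrow> \<bar>x - 1\<bar> < d \<Longrightarrow> w < f x"
    by (auto simp: eventually_at dist_real_def)
  show thesis
  proof (rule that[of "min d 1"])
    fix x assume x: "0 \<le> x" "x \<le> 1" "f x \<le> w"
    then have "x \<noteq> 1" using assms(2) by auto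
    with d(2)[of x] x have "d \<le> 1 - x" by (cases "1 - x < d") auto
    then show "min d 1 \<le> 1 - x" by simp
  qed (use d in auto)
qed

context erosion
begin

context
  assumes h0: "h 0 > 0"
begin

lemma psi_deriv:
  assumes s: "s > 0"
  shows "(psi g has_real_derivative (exp (h 0 * s) * (h 0 * s) - (exp (h 0 * s) - 1)) / s\<^sup>2) (at s)"
proof -
  have "((\<lambda>s. (exp (h 0 * s) - 1) / s) has_real_derivative
      (exp (h 0 * s) * (h 0 * s) - (exp (h 0 * s) - 1)) / s\<^sup>2) (at s)"
    using s by (auto intro!: derivative_eq_intros simp: power2_eq_square)
  moreover have "\<forall>\<^sub>F x in nhds s. (exp (h 0 * x) - 1) / x = psi g x"
    using s by (intro eventually_mono[OF eventually_nhds_in_open[of "{0<..}"]]) (auto simp: psi_def)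
  ultimately show ?thesis using DERIV_cong_ev[OF refl, of "\<lambda>s. (exp (h 0 * s) - 1) / s" "psi g" s] by simp
qed

lemma psi_cont: "continuous_on {0..} (psi g)"
  unfolding continuous_on_eq_continuous_within
proof
  fix s :: real assume "s \<in> {0..}"
  then consider "s > 0" | "s = 0" by fastforce
  then show "continuous (at s within {0..}) (psi g)"
  proof cases
    case 1
    then show ?thesis using psi_deriv[OF 1] by (meson DERIV_isCont continuous_at_imp_continuous_within)
  next
    case 2
    have "((\<lambda>s. exp (h 0 * s)) has_real_derivative h 0) (at 0)"
      by (auto intro!: derivative_eq_intros)
    then have "((\<lambda>s. (exp (h 0 * s) - 1) / s) \<longlongrightarrow> h 0) (at 0)"
      by (simp add: has_field_derivative_iff)
    moreover have "\<forall>\<^sub>F s in at 0. (exp (h 0 * s) - 1) / s = psi g s"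
      by (auto simp: eventually_at_filter psi_def)
    ultimately have "(psi g \<longlongrightarrow> psi g 0) (at 0)"
      by (simp add: psi_def[of g 0] Lim_transform_eventually)
    then have "(psi g \<longlongrightarrow> psi g 0) (at 0 within {0..})" by (rule tendsto_within_subset) simp
    then show ?thesis using 2 by (simp add: continuous_within)
  qed
qed

lemma psi_strict_mono:
  assumes "0 \<le> s" "s < r"
  shows "psi g s < psi g r"
proof (rule DERIV_pos_imp_increasing_open[OF assms(2)])
  fix x assume x: "s < x" "x < r"
  define w where "w = h 0 * x"
  have w: "w > 0" using x assms h0 by (simp add: w_def)
  then have "1 + - w < exp (- w)" using exp_gt_add_one[of "- w"] by simp
  then have "exp w * (1 - w) < exp w * exp (- w)" by (intro mult_strict_left_mono) auto
  then have "0 < exp w * w - (exp w - 1)" by (simp add: exp_minus algebra_simps)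
  then show "\<exists>d. (psi g has_real_derivative d) (at x) \<and> d > 0"
    using psi_deriv[of x] x assms by (intro exI conjI) (auto simp: w_def)
qed (use assms continuous_on_subset[OF psi_cont] in auto)

lemma psi_mono: "0 \<le> s \<Longrightarrow> s \<le> r \<Longrightarrow> psi g s \<le> psi g r"
  using psi_strict_mono[of s r] by (cases "s = r") auto

lemma psi_ge: "0 \<le> s \<Longrightarrow> h 0 \<le> psi g s"
  using psi_mono[of 0 s] by (simp add: psi_def)

lemma D_ss_less_iff:
  assumes "D > 0"
  shows "D < D_ss g \<longleftrightarrow> psi g D < h 1"
proof -
  define r where "r = 2 * h 1 / (h 0)\<^sup>2"
  have r: "r > 0" using h0 h_1_pos by (simp add: r_def)
  have "1 + h 0 * r + (h 0 * r)\<^sup>2 / 2 \<le> exp (h 0 * r)"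
    using r h0 by (intro exp_lower_Taylor_quadratic) simp
  then have "(h 0 + (h 0)\<^sup>2 * r / 2) * r \<le> exp (h 0 * r) - 1"
    by (simp add: power2_eq_square algebra_simps)
  then have "h 0 + (h 0)\<^sup>2 * r / 2 \<le> psi g r"
    using r by (simp add: psi_def pos_le_divide_eq)
  moreover have "(h 0)\<^sup>2 * r / 2 = h 1" using h0 by (simp add: r_def)
  ultimately have "h 1 \<le> psi g r" using h0 by linarith
  moreover have h01: "psi g 0 < h 1" using h_strict_mono[of 0 1] by (simp add: psi_def)
  ultimately obtain s where s: "0 \<le> s" "s \<le> r" "psi g s = h 1"
    using IVT'[of "psi g" 0 "h 1" r] r continuous_on_subset[OF psi_cont, of "{0..r}"] by auto
  have "s > 0" using s h01 by (cases "s = 0") auto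
  have "D_ss g = s"
    unfolding D_ss_def
  proof (rule the_equality)
    fix x assume "x > 0 \<and> psi g x = h 1"
    then show "x = s" using psi_strict_mono[of x s] psi_strict_mono[of s x] s
      by (cases x s rule: linorder_cases) auto
  qed (use s \<open>s > 0\<close> in simp)
  moreover have "D < s \<longleftrightarrow> psi g D < psi g s"
    using psi_strict_mono[of D s] psi_mono[of s D] assms s by (cases "D < s") auto
  ultimately show ?thesis using s by simp
qed

end

end

context flow
begin

text \<open>On the line \<open>k = E q\<close> a front located at \<open>q\<close> is at rest.\<close>

definition E :: "real \<Rightarrow> real" where "E q = q + 1 / psi g (q + D)"

lemma E_cont:
  assumes h0: "h 0 > 0"
  shows "continuous_on {-D..} E"
  unfolding E_def
proof (intro continuous_intros continuous_on_compose2[OF psi_cont[OF h0]])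
  show "\<forall>q\<in>{-D..}. psi g (q + D) \<noteq> 0"
  proof
    fix q assume "q \<in> {-D..}"
    then have "psi g (q + D) \<ge> h 0" by (intro psi_ge[OF h0]) simp
    then show "psi g (q + D) \<noteq> 0" using h0 by simp
  qed
qed auto

lemma E_strict_mono:
  assumes h0: "h 0 > 0" and "-D \<le> q" "q < r"
  shows "E q < E r"
proof (rule DERIV_pos_imp_increasing_open[OF assms(3)])
  fix x assume x: "q < x" "x < r"
  define s where "s = x + D"
  have s: "s > 0" using x assms by (simp add: s_def)
  define w where "w = h 0 * s"
  have w: "w > 0" using s h0 by (simp add: w_def)
  then have e: "exp w > 1 + w" using exp_gt_add_one[of w] by simp
  define P where "P = exp w - 1"
  have P: "P > w" "exp w = P + 1" using e by (auto simp: P_def)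
  have psi: "psi g s = P / s" using s by (simp add: psi_def P_def w_def)
  have d: "(psi g has_real_derivative ((P + 1) * w - P) / s\<^sup>2) (at s)"
    using psi_deriv[OF h0 s] by (simp add: P_def w_def)
  have "((\<lambda>x. psi g (x + D)) has_real_derivative ((P + 1) * w - P) / s\<^sup>2 * 1) (at x)"
    by (rule DERIV_chain2[where f = "psi g"]) (use d in \<open>auto intro!: derivative_eq_intros simp: s_def\<close>)
  then have "(E has_real_derivative 1 - ((P + 1) * w - P) / s\<^sup>2 / (psi g s)\<^sup>2) (at x)"
    unfolding E_def using psi P w s
    by (auto intro!: derivative_eq_intros simp: s_def[symmetric] power2_eq_square minus_divide_left)
  moreover have "((P + 1) * w - P) / s\<^sup>2 / (psi g s)\<^sup>2 = ((P + 1) * w - P) / P\<^sup>2"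
    using s P w by (simp add: psi power_divide)
  moreover have "((P + 1) * w - P) / P\<^sup>2 < 1"
  proof -
    have "(P + 1) * w < (P + 1) * P" using P w by (intro mult_strict_left_mono) auto
    then show ?thesis using P w by (simp add: power2_eq_square algebra_simps)
  qed
  ultimately show "\<exists>d. (E has_real_derivative d) (at x) \<and> d > 0" by auto
qed (use assms continuous_on_subset[OF E_cont[OF h0]] in auto)

lemma E_mono: "h 0 > 0 \<Longrightarrow> -D \<le> q \<Longrightarrow> q \<le> r \<Longrightarrow> E q \<le> E r"
  using E_strict_mono[of q r] by (cases "q = r") auto

lemma front_h_tendsto:
  assumes t: "t > 0" and Y: "Y t < 0"
  shows "((\<lambda>q. h (\<zeta> t q)) \<longlongrightarrow> h (zp t)) (at_right (Y t))"
  by (rule continuous_on_tendsto_compose[OF cont_h front_state_tendsto[OF t Y]])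
    (use front_state_range[OF t] zeta_range[of t] t in auto)

lemma front_k_tendsto:
  assumes t: "t > 0" and Y: "Y t < 0" and "h (zp t) > 0"
  shows "(k t \<longlongrightarrow> Y t + 1 / h (zp t)) (at_right (Y t))"
  unfolding k_def[abs_def] by (intro tendsto_intros front_h_tendsto) (use assms in auto)

lemma front_k_ge:
  assumes t: "t > 0" and Y: "Y t < 0" "h (zp t) > 0" and B: "\<And>q. Y t < q \<Longrightarrow> q < 0 \<Longrightarrow> B \<le> k t q"
  shows "B \<le> Y t + 1 / h (zp t)"
proof -
  have "\<forall>\<^sub>F q in at_right (Y t). B \<le> k t q"
    using eventually_at_right_real[OF Y(1)] by eventually_elim (use B in auto)
  then show ?thesis using tendsto_lowerbound[OF front_k_tendsto[OF t Y]] by simp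
qed

lemma front_k_le:
  assumes t: "t > 0" and Y: "Y t < 0" "h (zp t) > 0" and B: "\<And>q. Y t < q \<Longrightarrow> q < 0 \<Longrightarrow> k t q \<le> B"
  shows "Y t + 1 / h (zp t) \<le> B"
proof -
  have "\<forall>\<^sub>F q in at_right (Y t). k t q \<le> B"
    using eventually_at_right_real[OF Y(1)] by eventually_elim (use B in auto)
  then show ?thesis using tendsto_upperbound[OF front_k_tendsto[OF t Y]] by simp
qed

lemma speed_factor:
  assumes h0: "h 0 > 0" and q: "-D \<le> q" and x: "0 \<le> x" "x \<le> 1"
  shows "psi g (q + D) - h x = psi g (q + D) * h x * (q + 1 / h x - E q)"
    and "(h 0)\<^sup>2 \<le> psi g (q + D) * h x" and "0 \<le> psi g (q + D) * h x"
proof -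
  have p: "psi g (q + D) \<ge> h 0" using q by (intro psi_ge[OF h0]) simp
  have hx: "h x \<ge> h 0" by (rule h_mono) (use x in auto)
  show "psi g (q + D) - h x = psi g (q + D) * h x * (q + 1 / h x - E q)"
    using p hx h0 by (simp add: E_def field_simps)
  show "(h 0)\<^sup>2 \<le> psi g (q + D) * h x"
    unfolding power2_eq_square using p hx h0 by (intro mult_mono) auto
  show "0 \<le> psi g (q + D) * h x" using p hx h0 by simp
qed

lemma speed_ge:
  assumes t: "t \<ge> 0" and x: "0 < x" "x \<le> 1" "\<eta> \<le> 1 - x" and w: "0 \<le> w" "w \<le> r" and "0 \<le> \<eta>"
  shows "\<eta> * w \<le> F t q * ((1 - x) / x) * r"
proof -
  have "(1 - x) * x \<le> (1 - x) * 1" using x by (intro mult_left_mono) auto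
  then have "1 - x \<le> (1 - x) / x" using x by (simp add: pos_le_divide_eq)
  then have "\<eta> \<le> (1 - x) / x" using x by simp
  then have "1 * \<eta> \<le> F t q * ((1 - x) / x)"
    using F_ge_1[OF t, of q] assms by (intro mult_mono) auto
  then show ?thesis using w assms by (intro mult_mono) auto
qed

lemma front_eventually_ge:
  assumes h0: "h 0 > 0" and lo: "-D < lo" "lo < 0" "E lo < \<kappa>"
  shows "\<exists>T\<ge>1. \<forall>t\<ge>T. lo \<le> Y t"
proof -
  define B where "B = (max (E lo) (\<kappa> + lo) + \<kappa>) / 2"
  have B: "E lo < B" "\<kappa> + lo < B" "B < \<kappa>" using lo by (auto simp: B_def)
  obtain t1 where t1: "t1 \<ge> 1" "\<forall>q. Y t1 < q \<and> q < 0 \<longrightarrow> B \<le> k t1 q"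
    using lower_level_reached[OF B(3)] by blast
  have kB: "B \<le> k t q" if "t \<ge> t1" "Y t < q" "q < 0" for t q
    by (rule lower_level_persists[of t1]) (use t1 B that in auto)
  have YD: "Y t > - D" if t: "t \<ge> t1" for t
  proof (rule ccontr)
    assume "\<not> Y t > -D"
    then have Y: "Y t = -D" using front_bounds(1)[of t] by simp
    define q where "q = min (lo / 2) (- D + (B - E lo))"
    have q: "-D < q" "q < 0" "q \<le> -D + (B - E lo)" using lo B by (auto simp: q_def min_def)
    have "h 0 \<le> h (\<zeta> t q)" using zeta_range[of t q] t t1 by (intro h_mono) auto
    then have "k t q \<le> q + 1 / h 0" using h0 by (simp add: k_def frac_le)
    moreover have "E (-D) = -D + 1 / h 0" by (simp add: E_def psi_def)
    moreover have "E (-D) < E lo" using lo by (intro E_strict_mono h0) auto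
    ultimately have "k t q < B" using q by linarith
    then show False using kB[OF t] q Y by force
  qed
  have "1 / (B - lo) < 1 / \<kappa>" using B \<kappa>_pos by (intro divide_strict_left_mono mult_pos_pos) auto
  then have "1 / (B - lo) < h 1" by (simp add: \<kappa>_def)
  then obtain \<eta> where \<eta>: "\<eta> > 0" "\<And>x. 0 \<le> x \<Longrightarrow> x \<le> 1 \<Longrightarrow> h x \<le> 1 / (B - lo) \<Longrightarrow> \<eta> \<le> 1 - x"
    using below_value_at_1[OF cont_h] by metis
  define w where "w = (h 0)\<^sup>2 * (B - E lo)"
  have w: "w > 0" using h0 B by (simp add: w_def)
  define v where "v = \<eta> * w / 2"
  have v: "v > 0" "v < \<eta> * w" using \<eta> w by (auto simp: v_def)
  have speed: "\<exists>\<sigma>. (Y has_real_derivative \<sigma>) (at t) \<and> v < \<sigma>"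
    if t: "t \<ge> t1" and le: "Y t \<le> lo" and zp: "zp t > 0" for t
  proof -
    have t0: "t > 0" "t \<ge> 0" using t t1 by auto
    have zr: "zp t \<le> 1" using front_state_range[OF t0(1)] by simp
    have hz: "h (zp t) > 0" using zp zr by (rule h_pos)
    have kz: "B \<le> Y t + 1 / h (zp t)" by (rule front_k_ge) (use t0 le lo hz kB[OF t] in auto)
    have "B - lo > 0" using B \<kappa>_pos by simp
    moreover have "B - lo \<le> 1 / h (zp t)" using kz le by simp
    ultimately have "h (zp t) \<le> 1 / (B - lo)" using hz by (simp add: field_simps)
    then have "\<eta> \<le> 1 - zp t" using \<eta>(2) zp zr by simp
    have "E (Y t) \<le> E lo" using front_bounds(1) le by (intro E_mono h0)
    then have "w \<le> psi g (Y t + D) * h (zp t) * (Y t + 1 / h (zp t) - E (Y t))"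
      unfolding w_def using kz B h0 speed_factor(2,3)[OF h0 front_bounds(1), of "zp t" t] zp zr
      by (intro mult_mono) auto
    then have "w \<le> psi g (Y t + D) - h (zp t)"
      using speed_factor(1)[OF h0 front_bounds(1), of "zp t" t] zp zr by simp
    then have "\<eta> * w \<le> F t (Y t) * ((1 - zp t) / zp t) * (psi g (Y t + D) - h (zp t))"
      using t0 zp zr w \<eta>(1) \<open>\<eta> \<le> 1 - zp t\<close> by (intro speed_ge) auto
    then show ?thesis using front_speed[OF t0(1) YD[OF t] zp] v by (metis less_le_trans)
  qed
  have pick: "\<exists>s. t < s \<and> s \<le> T \<and> P s" if "\<forall>\<^sub>F s in at_right t. P s" "t < T" for t T :: real and P
  proof -
    have "\<forall>\<^sub>F s in at_right t. s \<in> {t<..<T} \<and> P s"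
      using eventually_at_right_real[OF that(2)] that(1) by eventually_elim auto
    then obtain s where "s \<in> {t<..<T} \<and> P s"
      using eventually_happens'[OF trivial_limit_at_right_real] by blast
    then show ?thesis by (auto intro: less_imp_le)
  qed
  have main: "min lo (Y t1 + v * (T - t1)) \<le> Y T" if T: "t1 \<le> T" for T
  proof (rule forward_growth[OF _ _ _ T])
    show "\<forall>\<^sub>F \<tau> in at_left s. Y \<tau> < w" if "t1 < s" "Y s < w" for s w
      using eventually_at_left_nhds[OF front_usc] that t1 by simp
    have grow: "\<exists>s>t. s \<le> T \<and> Y t + v * (s - t) \<le> Y s" if t: "t1 \<le> t" "t < T" "Y t \<le> lo" for t
    proof (cases "zp t > 0")
      case True
      then obtain \<sigma> where "(Y has_real_derivative \<sigma>) (at t)" "v < \<sigma>" using speed[of t] t by blast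
      from pick[OF deriv_right_growth[OF this] t(2)] show ?thesis .
    next
      case False
      then have "zp t = 0" using front_state_range[of t] t t1 by simp
      then show ?thesis using front_advances[OF h0, of t v T] YD[of t] t lo t1 v by auto
    qed
    show "\<exists>s>t. s \<le> T \<and> Y t + v * (s - t) \<le> Y s" if "t1 \<le> t" "t < T" "Y t < lo" for t
      using grow that by simp
    show "\<exists>s>t. s \<le> T \<and> lo \<le> Y s" if t: "t1 \<le> t" "t < T" "lo \<le> Y t" for t
    proof (cases "Y t = lo")
      case True
      then obtain s where s: "s > t" "s \<le> T" "Y t + v * (s - t) \<le> Y s" using grow t by auto
      moreover have "v * (s - t) \<ge> 0" using v s by simp
      ultimately show ?thesis using True by (intro exI[of _ s]) auto
    next
      case False
      have t0: "t > 0" using t t1 by simp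
      show ?thesis
      proof (cases "zp t > 0")
        case True
        obtain \<sigma> where "(Y has_real_derivative \<sigma>) (at t)"
          using front_speed[OF t0 YD[OF t(1)] True] by metis
        then have "isCont Y t" by (rule DERIV_isCont)
        then have "(Y \<longlongrightarrow> Y t) (at t)" by (simp add: isCont_def)
        then have "(Y \<longlongrightarrow> Y t) (at_right t)" by (rule tendsto_within_subset) simp
        then have "\<forall>\<^sub>F s in at_right t. lo < Y s" using False t by (simp add: order_tendsto_iff)
        then have "\<forall>\<^sub>F s in at_right t. lo \<le> Y s" by eventually_elim simp
        then show ?thesis using t by (intro pick)
      next
        case False
        then have zp: "zp t = 0" using front_state_range[OF t0] by simp
        then have "Y t < 0" using front_state_at_0[of t] front_bounds(2)[of t] by (cases "Y t = 0") auto
        then show ?thesis using front_advances[OF h0 t0 YD[OF t(1)] _ zp, of 0 T] t by auto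
      qed
    qed
  qed
  show ?thesis
  proof (intro exI[of _ "t1 + D / v"] conjI allI impI)
    show "1 \<le> t1 + D / v" using t1 D_pos v by (simp add: add_increasing2)
    fix T assume T: "t1 + D / v \<le> T"
    then have "D / v \<le> T - t1" by simp
    then have "D \<le> v * (T - t1)" using v by (simp add: pos_divide_le_eq mult.commute)
    moreover have "t1 \<le> T" using T D_pos v by (smt (verit) divide_pos_pos)
    ultimately show "lo \<le> Y T" using main[of T] front_bounds(1)[of t1] lo by simp
  qed
qed

lemma front_state_no_erosion:
  assumes h0: "h 0 = 0" and t: "t > 0" and Y: "Y t > -D"
  shows "zp t = 0"
proof (rule ccontr)
  assume "zp t \<noteq> 0"
  then have zp: "zp t > 0" using front_state_range[OF t] by simp
  have "h (zp t) - zp t * (1 - zp t) * deriv h (zp t) \<le> psi g (Y t + D)"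
    using lax t Y unfolding front_lax_def by blast
  then have "G (zp t) \<le> 0" using G_eq[OF zp] by (simp add: psi_def h0 split: if_splits)
  moreover have "G 0 < G (zp t)" by (rule G_strict_mono) (use zp in auto)
  moreover have "G 0 = 0" using h0 by (simp add: G_def h_0)
  ultimately show False by simp
qed

text \<open>New values of \<open>k\<close> may be emitted by the front, but a value above the equilibrium line is
  emitted only while the front moves to the left. Hence the right end of the region \<open>k \<ge> B\<close>,
  continued by the front when this region is empty, always moves to the left.\<close>

lemma upper_level_eventually:
  assumes hi: "-D < hi" "hi < 0" and B: "\<kappa> < B"
    and cases: "h 0 = 0 \<or> h 0 > 0 \<and> psi g D < h 1 \<and> B < E hi"
  shows "\<exists>T\<ge>1. \<forall>t\<ge>T. Y t \<le> hi \<and> (\<forall>q. hi < q \<and> q < 0 \<longrightarrow> k t q < B)"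
proof -
  define W where "W = (\<lambda>t q. B - k t q)"
  have W: "jointly_continuous W" "\<And>t. W t 0 > 0"
    unfolding jointly_continuous_def W_def using B
    by (auto intro!: tendsto_diff k_tendsto)
  define f where "f = level_top W"
  have f: "Y t < f t" "f t < 0" "k t (f t) = B" if "t \<ge> 1" "level_set W t \<noteq> {}" for t
    using top_mem[OF _ W that(2)] that(1) by (auto simp: f_def level_set_def W_def)
  have "1 / B < 1 / \<kappa>" using B \<kappa>_pos by (intro divide_strict_left_mono) auto
  then have "1 / B < h 1" by (simp add: \<kappa>_def)
  then obtain \<eta>1 where \<eta>1: "\<eta>1 > 0" "\<eta>1 \<le> 1" "\<And>x. 0 \<le> x \<Longrightarrow> x \<le> 1 \<Longrightarrow> h x \<le> 1 / B \<Longrightarrow> \<eta>1 \<le> 1 - x"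
    using below_value_at_1[OF cont_h] by metis
  define v1 where "v1 = V (1 - \<eta>1) / 2"
  have v1: "v1 > 0" using V_pos[of "1 - \<eta>1"] \<eta>1 by (simp add: v1_def)
  obtain v2 where v2: "v2 > 0" "\<And>t. t \<ge> 1 \<Longrightarrow> level_set W t = {} \<Longrightarrow> hi < Y t \<Longrightarrow>
      \<exists>\<sigma>. (Y has_real_derivative \<sigma>) (at t) \<and> \<sigma> < - v2"
  proof (cases "h 0 = 0")
    case True
    have False if t: "t \<ge> 1" and ne: "level_set W t = {}" and Y: "hi < Y t" for t
    proof -
      have t0: "t > 0" using t by simp
      have zp: "zp t = 0" using front_state_no_erosion[OF True t0] Y hi by simp
      then have Y0: "Y t < 0" using front_state_at_0[of t] front_bounds(2)[of t] by (cases "Y t = 0") auto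
      have "1 / (B + D) \<le> h (\<zeta> t q)" if q: "Y t < q" "q < 0" for q
      proof -
        have "k t q < B" using ne q by (force simp: level_set_def W_def)
        then have "1 / h (\<zeta> t q) < B + D" using q front_bounds(1)[of t] by (simp add: k_def)
        then show ?thesis using h_zeta_pos[OF t0 q(1)] q D_pos B \<kappa>_pos by (simp add: field_simps)
      qed
      then have "\<forall>\<^sub>F q in at_right (Y t). 1 / (B + D) \<le> h (\<zeta> t q)"
        using eventually_at_right_real[OF Y0] by (auto elim!: eventually_mono)
      then have "1 / (B + D) \<le> h (zp t)"
        using tendsto_lowerbound[OF front_h_tendsto[OF t0 Y0]] by simp
      moreover have "1 / (B + D) > 0" using D_pos B \<kappa>_pos by simp
      ultimately show False using zp True by simp
    qed
    then show thesis using that[of 1] by auto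
  next
    case False
    then have h0: "h 0 > 0" and psiD: "psi g D < h 1" and BE: "B < E hi" using cases by auto
    have "psi g D < G 1" using psiD by (simp add: G_def g_1 h_1)
    then obtain \<eta>2 where \<eta>2: "\<eta>2 > 0" "\<And>x. 0 \<le> x \<Longrightarrow> x \<le> 1 \<Longrightarrow> G x \<le> psi g D \<Longrightarrow> \<eta>2 \<le> 1 - x"
      using below_value_at_1[OF cont_G] by metis
    define w where "w = (h 0)\<^sup>2 * (E hi - B)"
    have w: "w > 0" using h0 BE by (simp add: w_def)
    have "\<exists>\<sigma>. (Y has_real_derivative \<sigma>) (at t) \<and> \<sigma> < - (\<eta>2 * w / 2)"
      if t: "t \<ge> 1" and ne: "level_set W t = {}" and Y: "hi < Y t" for t
    proof -
      have t0: "t > 0" "t \<ge> 0" using t by auto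
      have YD: "Y t > -D" using Y hi by simp
      have kB: "k t q \<le> B" if "Y t < q" "q < 0" for q
        using ne that by (force simp: level_set_def W_def)
      have lx: "h (zp t) - zp t * (1 - zp t) * deriv h (zp t) \<le> psi g (Y t + D)"
        using lax t0 YD unfolding front_lax_def by blast
      have psi_le: "psi g (Y t + D) \<le> psi g D"
        using YD front_bounds(2)[of t] by (intro psi_mono[OF h0]) auto
      have zr: "0 \<le> zp t" "zp t \<le> 1" using front_state_range[OF t0(1)] by auto
      have Y0: "Y t < 0"
      proof (rule ccontr)
        assume "\<not> Y t < 0"
        then have "zp t = 1" using front_state_at_0 front_bounds(2)[of t] by force
        then show False using lx psi_le psiD by simp
      qed
      have hz: "h (zp t) > 0" using h_mono[of 0 "zp t"] zr h0 by simp
      have kz: "Y t + 1 / h (zp t) \<le> B" by (rule front_k_le[OF t0(1) Y0 hz kB])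
      have EY: "E hi < E (Y t)" using hi Y by (intro E_strict_mono h0) auto
      have zp: "zp t > 0"
      proof (rule ccontr)
        assume "\<not> zp t > 0"
        then have "zp t = 0" using zr by simp
        moreover have "1 / psi g (Y t + D) \<le> 1 / h 0"
          using psi_ge[OF h0, of "Y t + D"] YD h0 by (simp add: frac_le)
        ultimately show False using kz EY BE by (simp add: E_def)
      qed
      have "G (zp t) \<le> psi g D" using lx psi_le G_eq[OF zp] by simp
      then have eta: "\<eta>2 \<le> 1 - zp t" using \<eta>2(2) zr by simp
      have "w \<le> psi g (Y t + D) * h (zp t) * (E (Y t) - (Y t + 1 / h (zp t)))"
        unfolding w_def using kz BE EY h0 speed_factor(2,3)[OF h0 front_bounds(1), of "zp t" t] zr
        by (intro mult_mono) auto
      also have "\<dots> = - (psi g (Y t + D) * h (zp t) * (Y t + 1 / h (zp t) - E (Y t)))"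
        by (simp add: algebra_simps)
      also have "\<dots> = - (psi g (Y t + D) - h (zp t))"
        using speed_factor(1)[OF h0 front_bounds(1), of "zp t" t] zr by simp
      finally have "\<eta>2 * w \<le> F t (Y t) * ((1 - zp t) / zp t) * - (psi g (Y t + D) - h (zp t))"
        using t0 zp zr w \<eta>2(1) eta by (intro speed_ge) auto
      then have "F t (Y t) * ((1 - zp t) / zp t) * (psi g (Y t + D) - h (zp t)) \<le> - (\<eta>2 * w)"
        unfolding mult_minus_right by linarith
      moreover have "\<eta>2 * w > 0" using \<eta>2 w by simp
      ultimately have "F t (Y t) * ((1 - zp t) / zp t) * (psi g (Y t + D) - h (zp t)) < - (\<eta>2 * w / 2)"
        by linarith
      then show ?thesis using front_speed[OF t0(1) YD zp] by metis
    qed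
    then show thesis using that[of "\<eta>2 * w / 2"] \<eta>2 w by simp
  qed
  define v where "v = min v1 v2 / 2"
  have v: "v > 0" "v < v1" "v < v2" using v1 v2 by (auto simp: v_def min_def)
  have step: "\<exists>s. 1 \<le> s \<and> s < t \<and> f t + v * (t - s) \<le> f s" if t: "1 < t" "hi < f t" for t
  proof (rule eventually_left_pick[OF _ t(1)])
    show "\<forall>\<^sub>F s in at_left t. f t + v * (t - s) \<le> f s"
    proof (cases "level_set W t = {}")
      case True
      then have fY: "f t = Y t" by (simp add: f_def top_empty)
      then obtain \<sigma> where "(Y has_real_derivative \<sigma>) (at t)" "\<sigma> < - v2" using v2(2)[of t] t True by auto
      then have "\<forall>\<^sub>F s in at_left t. Y t + v * (t - s) \<le> Y s" using v by (intro deriv_left_growth) auto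
      then show ?thesis
      proof eventually_elim
        fix s assume "Y t + v * (t - s) \<le> Y s"
        then show "f t + v * (t - s) \<le> f s" using fY front_le_top[of s W] by (simp add: f_def)
      qed
    next
      case False
      have t1: "t \<ge> 1" using t by simp
      note ft = f[OF t1 False]
      have t0: "t > 0" using t by simp
      have "B \<le> 1 / h (\<zeta> t (f t))" using ft by (simp add: k_def)
      then have "h (\<zeta> t (f t)) \<le> 1 / B"
        using h_zeta_pos[OF t0 ft(1)] ft B \<kappa>_pos by (simp add: field_simps)
      then have "\<zeta> t (f t) \<le> 1 - \<eta>1" using \<eta>1(3)[of "\<zeta> t (f t)"] zeta_range[of t "f t"] t0 by simp
      then have "V (1 - \<eta>1) \<le> V (\<zeta> t (f t)) * F t (f t)"
        using ft t0 \<eta>1 by (intro V_F_ge) auto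
      then have "v < V (\<zeta> t (f t)) * F t (f t)" using v v1 by (simp add: v1_def)
      then have "\<forall>\<^sub>F s in at_left t. \<exists>c. Y s < c \<and> c < 0 \<and> k s c = k t (f t) \<and> f t + v * (t - s) \<le> c \<and> c < f t + 1"
        using ft t0 by (intro characteristic) auto
      then show ?thesis
      proof eventually_elim
        fix s assume "\<exists>c. Y s < c \<and> c < 0 \<and> k s c = k t (f t) \<and> f t + v * (t - s) \<le> c \<and> c < f t + 1"
        then obtain c where c: "Y s < c" "c < 0" "k s c = B" "f t + v * (t - s) \<le> c"
          using ft(3) by auto
        then have "c \<in> level_set W s" by (simp add: level_set_def W_def)
        from level_le_top[OF this] c show "f t + v * (t - s) \<le> f s" by (simp add: f_def)
      qed
    qed
  qed
  have usc: "\<forall>\<^sub>F \<tau> in at_right s. f \<tau> < w" if "1 \<le> s" "f s < w" for s w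
    using eventually_at_right_nhds[OF top_usc[OF _ W]] that by (simp add: f_def)
  have main: "f T \<le> hi" if T: "T \<ge> 1 + D / v" for T
  proof (rule ccontr)
    assume "\<not> f T \<le> hi"
    then have "hi < f T" by simp
    have T1: "1 \<le> T" using T D_pos v by (smt (verit) divide_pos_pos)
    have "f T + v * (T - 1) \<le> f 1"
      by (rule backward_growth[where ylow = hi]) (use usc step v T1 \<open>hi < f T\<close> in auto)
    moreover have "D / v \<le> T - 1" using T by simp
    then have "D \<le> v * (T - 1)" using v by (simp add: pos_divide_le_eq mult.commute)
    ultimately show False using \<open>hi < f T\<close> hi top_le_0[of W 1] by (simp add: f_def)
  qed
  show ?thesis
  proof (intro exI[of _ "1 + D / v"] conjI allI impI)
    show "1 \<le> 1 + D / v" using D_pos v by simp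
    fix t assume t: "1 + D / v \<le> t"
    from main[OF t] show Yt: "Y t \<le> hi" using front_le_top[of t W] by (simp add: f_def)
    fix q assume q: "hi < q \<and> q < 0"
    show "k t q < B"
    proof (rule ccontr)
      assume "\<not> k t q < B"
      then have "q \<in> level_set W t" using q Yt by (simp add: level_set_def W_def)
      from level_le_top[OF this] main[OF t] q show False by (simp add: f_def)
    qed
  qed
qed

end

section \<open>Convergence to the profile\<close>

context flow
begin

lemma lower_level_eventually:
  assumes "B < \<kappa>"
  shows "\<exists>T\<ge>1. \<forall>t\<ge>T. \<forall>q. Y t < q \<and> q < 0 \<longrightarrow> B \<le> k t q"
proof -
  obtain T where "T \<ge> 1" "\<forall>q. Y T < q \<and> q < 0 \<longrightarrow> B \<le> k T q"
    using lower_level_reached[OF assms] by blast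
  then show ?thesis using lower_level_persists[of T B] assms by (intro exI[of _ T]) auto
qed

lemma phi_state:
  assumes q: "q \<le> 0" "h 0 > 0 \<Longrightarrow> \<kappa> - 1 / h 0 \<le> q"
  shows "0 \<le> phi g q" "phi g q \<le> 1" "h (phi g q) = 1 / (\<kappa> - q)"
proof -
  have pos: "\<kappa> - q > 0" using q \<kappa>_pos by simp
  have "- D_hk g \<le> ereal q"
    using q by (auto simp: D_hk_def \<kappa>_def)
  moreover have "h 1 / (1 - h 1 * q) = 1 / (\<kappa> - q)"
    using h_1_pos by (simp add: \<kappa>_def field_simps)
  ultimately have phi: "phi g q = the_inv_into {0..} h (1 / (\<kappa> - q))"
    by (simp add: phi_def)
  have "1 / (\<kappa> - q) \<le> 1 / \<kappa>" using q \<kappa>_pos by (intro divide_left_mono) auto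
  then have le: "1 / (\<kappa> - q) \<le> h 1" by (simp add: \<kappa>_def)
  have ge: "h 0 \<le> 1 / (\<kappa> - q)"
  proof (cases "h 0 > 0")
    case True
    then have "\<kappa> - q \<le> 1 / h 0" using q by simp
    then show ?thesis using True pos by (simp add: field_simps)
  next
    case False
    then show ?thesis using h_0_nonneg pos by simp
  qed
  obtain x where x: "0 \<le> x" "x \<le> 1" "h x = 1 / (\<kappa> - q)" using h_surj[OF ge le] .
  then have "phi g q = x" using h_inverse[of x] phi by simp
  then show "0 \<le> phi g q" "phi g q \<le> 1" "h (phi g q) = 1 / (\<kappa> - q)" using x by auto
qed

lemma phi_mono:
  assumes "h 0 > 0 \<Longrightarrow> \<kappa> - 1 / h 0 \<le> q" "q \<le> r" "r \<le> 0"
  shows "phi g q \<le> phi g r"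
proof -
  have q: "0 \<le> phi g q" "phi g q \<le> 1" "h (phi g q) = 1 / (\<kappa> - q)"
    by (rule phi_state; use assms in simp)+
  have r: "0 \<le> phi g r" "phi g r \<le> 1" "h (phi g r) = 1 / (\<kappa> - r)"
    by (rule phi_state; use assms in force)+
  have "1 / (\<kappa> - q) \<le> 1 / (\<kappa> - r)" using assms \<kappa>_pos by (intro divide_left_mono) auto
  then have "h (phi g q) \<le> h (phi g r)" using q r by simp
  then show ?thesis using h_strict_mono[of "phi g r" "phi g q"] q r by (cases "phi g q \<le> phi g r") auto
qed

lemma zeta_near_phi:
  assumes m: "m > 0" "\<And>a b. 0 \<le> a \<Longrightarrow> a \<le> b \<Longrightarrow> b \<le> 1 \<Longrightarrow> m * (b - a) \<le> h b - h a"
    and q: "t > 0" "Y t < q" "q < 0" "h 0 > 0 \<Longrightarrow> \<kappa> - 1 / h 0 \<le> q"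
    and close: "\<kappa> - \<eta> \<le> k t q" "k t q \<le> \<kappa> + \<eta>"
  shows "\<bar>\<zeta> t q - phi g q\<bar> \<le> (h 1)\<^sup>2 / m * \<eta>"
proof (rule inverse_h_diff[OF m])
  have p: "0 \<le> phi g q" "phi g q \<le> 1" "h (phi g q) = 1 / (\<kappa> - q)"
    by (rule phi_state; use q in simp)+
  then show "0 \<le> phi g q" "phi g q \<le> 1" "h (phi g q) > 0" using q \<kappa>_pos by auto
  show "0 \<le> \<zeta> t q" "\<zeta> t q \<le> 1" "h (\<zeta> t q) > 0"
    using zeta_range[of t q] h_zeta_pos[of t q] q by auto
  show "\<bar>1 / h (\<zeta> t q) - 1 / h (phi g q)\<bar> \<le> \<eta>"
    using close p(3) by (simp add: k_def abs_le_iff)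
qed

text \<open>The transition point \<open>p\<close> of the profile is the only place where convergence is not uniform.\<close>

lemma L1_convergence:
  assumes mono: "mono_on {-D<..<0} P" and P: "\<And>q. -D < q \<Longrightarrow> q < 0 \<Longrightarrow> 0 \<le> P q \<and> P q \<le> 1"
    and K: "K \<ge> 0"
    and conv: "\<And>\<epsilon>. \<epsilon> > 0 \<Longrightarrow> \<exists>T\<ge>1. \<forall>t\<ge>T. \<forall>q. -D < q \<and> q < 0 \<and> \<epsilon> < \<bar>q - p\<bar> \<longrightarrow> \<bar>\<zeta> t q - P q\<bar> \<le> K * \<epsilon>"
  shows "\<exists>C. \<forall>\<epsilon>>0. \<exists>T\<ge>0. \<forall>t\<ge>T.
           set_integrable lborel {-D<..<0} (\<lambda>q. \<zeta> t q - P q) \<and>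
           (LINT q:{-D<..<0}|lborel. \<bar>\<zeta> t q - P q\<bar>) \<le> C * \<epsilon>"
proof (rule exI[of _ "2 + K * D"], intro allI impI)
  fix \<epsilon> :: real assume \<epsilon>: "\<epsilon> > 0"
  obtain T where T: "T \<ge> 1"
    "\<And>t q. t \<ge> T \<Longrightarrow> -D < q \<Longrightarrow> q < 0 \<Longrightarrow> \<epsilon> < \<bar>q - p\<bar> \<Longrightarrow> \<bar>\<zeta> t q - P q\<bar> \<le> K * \<epsilon>"
    using conv[OF \<epsilon>] by blast
  let ?A = "{-D<..<0}"
  have Pm: "(\<lambda>q. indicator ?A q *\<^sub>R P q) \<in> borel_measurable borel"
    using borel_measurable_mono_on_fnc[OF mono] by (subst (asm) borel_measurable_restrict_space_iff) auto
  have main: "set_integrable lborel ?A (\<lambda>q. \<zeta> t q - P q) \<and> (LINT q:?A|lborel. \<bar>\<zeta> t q - P q\<bar>) \<le> (2 + K * D) * \<epsilon>"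
    if t: "t \<ge> T" for t
  proof
    have t0: "t > 0" using t T by simp
    have "(\<lambda>q. indicator ?A q *\<^sub>R \<zeta> t q - indicator ?A q *\<^sub>R P q) \<in> borel_measurable borel"
      using zeta_measurable[OF t0] Pm by measurable
    then have meas: "(\<lambda>q. indicator ?A q *\<^sub>R (\<zeta> t q - P q)) \<in> borel_measurable borel"
      by (simp add: algebra_simps)
    have diff: "\<bar>\<zeta> t q - P q\<bar> \<le> 1" if "q \<in> ?A" for q
      using zeta_range[of t q] P[of q] t0 that by (auto simp: abs_le_iff)
    have int: "integrable lborel (\<lambda>q. indicator ?A q *\<^sub>R (\<zeta> t q - P q))"
      by (rule integrableI_bounded_set[where A = ?A and B = 1])
        (use meas diff D_pos in \<open>auto simp: indicator_def\<close>)
    then show "set_integrable lborel ?A (\<lambda>q. \<zeta> t q - P q)" by (simp add: set_integrable_def)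
    have bi: "has_bochner_integral lborel (\<lambda>q. indicator {p - \<epsilon>..p + \<epsilon>} q + K * \<epsilon> * indicator ?A q) (2 * \<epsilon> + K * \<epsilon> * D)"
    proof (intro has_bochner_integral_add has_bochner_integral_mult_right)
      have "has_bochner_integral lborel (indicator {p - \<epsilon>..p + \<epsilon>} :: real \<Rightarrow> real) (measure lborel {p - \<epsilon>..p + \<epsilon>})"
        by (rule has_bochner_integral_real_indicator) (auto simp: emeasure_lborel_Icc_eq)
      then show "has_bochner_integral lborel (indicator {p - \<epsilon>..p + \<epsilon>} :: real \<Rightarrow> real) (2 * \<epsilon>)" using \<epsilon> by simp
      have "has_bochner_integral lborel (indicator ?A :: real \<Rightarrow> real) (measure lborel ?A)"
        by (rule has_bochner_integral_real_indicator) (use D_pos in auto)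
      then show "has_bochner_integral lborel (indicator ?A :: real \<Rightarrow> real) D" using D_pos by simp
    qed
    have "(LINT q:?A|lborel. \<bar>\<zeta> t q - P q\<bar>)
        \<le> (LINT q|lborel. indicator {p - \<epsilon>..p + \<epsilon>} q + K * \<epsilon> * indicator ?A q)"
      unfolding set_lebesgue_integral_def
    proof (rule Bochner_Integration.integral_mono)
      show "integrable lborel (\<lambda>q. indicator ?A q *\<^sub>R \<bar>\<zeta> t q - P q\<bar>)"
        using integrable_abs[OF int] by (simp add: abs_mult)
      show "integrable lborel (\<lambda>q. indicator {p - \<epsilon>..p + \<epsilon>} q + K * \<epsilon> * indicator ?A q)"
        using bi by (simp add: has_bochner_integral_iff)
      fix q
      have K\<epsilon>: "0 \<le> K * \<epsilon>" using K \<epsilon> by simp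
      show "indicator ?A q *\<^sub>R \<bar>\<zeta> t q - P q\<bar> \<le> indicator {p - \<epsilon>..p + \<epsilon>} q + K * \<epsilon> * indicator ?A q"
      proof (cases "q \<in> ?A")
        case True
        show ?thesis
        proof (cases "\<epsilon> < \<bar>q - p\<bar>")
          case far: True
          then have "q \<notin> {p - \<epsilon>..p + \<epsilon>}" by auto
          then show ?thesis using T(2)[OF t _ _ far] True by simp
        next
          case False
          then have "q \<in> {p - \<epsilon>..p + \<epsilon>}" by auto
          then show ?thesis using diff[OF True] True K\<epsilon> by simp
        qed
      qed simp
    qed
    also have "\<dots> = (2 + K * D) * \<epsilon>"
      using has_bochner_integral_integral_eq[OF bi] by (simp add: algebra_simps)
    finally show "(LINT q:?A|lborel. \<bar>\<zeta> t q - P q\<bar>) \<le> (2 + K * D) * \<epsilon>" .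
  qed
  show "\<exists>T\<ge>0. \<forall>t\<ge>T. set_integrable lborel ?A (\<lambda>q. \<zeta> t q - P q) \<and>
      (LINT q:?A|lborel. \<bar>\<zeta> t q - P q\<bar>) \<le> (2 + K * D) * \<epsilon>"
    using main T(1) by (intro exI[of _ T]) auto
qed

lemma E_left: "E (- D) = 1 / h 0 - D"
  by (simp add: E_def psi_def)

lemma E_right: "E 0 = 1 / psi g D"
  by (simp add: E_def)

lemma psi_D_less_iff:
  assumes "h 0 > 0"
  shows "psi g D < h 1 \<longleftrightarrow> \<kappa> < E 0"
  using psi_ge[OF assms, of D] D_pos h_1_pos assms by (simp add: E_right \<kappa>_def field_simps)

lemma profile_convergence:
  "\<exists>C. \<forall>\<epsilon>>0. \<exists>T\<ge>0. \<forall>t\<ge>T.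
     set_integrable lborel {-D<..<0} (\<lambda>q. \<zeta> t q - profile g D q) \<and>
     (LINT q:{-D<..<0}|lborel. \<bar>\<zeta> t q - profile g D q\<bar>) \<le> C * \<epsilon>"
proof -
  obtain m where m: "m > 0" "\<And>a b. 0 \<le> a \<Longrightarrow> a \<le> b \<Longrightarrow> b \<le> 1 \<Longrightarrow> m * (b - a) \<le> h b - h a"
    using h_expanding by metis
  define K where "K = (h 1)\<^sup>2 / m"
  have K: "K \<ge> 0" using m by (simp add: K_def)
  have near: "\<exists>T\<ge>1. \<forall>t\<ge>T. Y t \<le> hi \<and> (\<forall>q. hi < q \<and> q < 0 \<longrightarrow> \<bar>\<zeta> t q - phi g q\<bar> \<le> K * \<epsilon>)"
    if hi: "-D < hi" "hi < 0" and \<epsilon>: "\<epsilon> > 0"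
      and c: "h 0 = 0 \<or> h 0 > 0 \<and> \<kappa> < E 0 \<and> \<kappa> < E hi" and l: "h 0 > 0 \<Longrightarrow> \<kappa> - 1 / h 0 \<le> hi" for hi \<epsilon>
  proof -
    define B where "B = (if h 0 = 0 then \<kappa> + \<epsilon> else min (\<kappa> + \<epsilon>) ((\<kappa> + E hi) / 2))"
    have B: "\<kappa> < B" "B \<le> \<kappa> + \<epsilon>" "h 0 = 0 \<or> h 0 > 0 \<and> psi g D < h 1 \<and> B < E hi"
      using c \<epsilon> psi_D_less_iff by (auto simp: B_def min_def field_simps)
    obtain T1 where T1: "T1 \<ge> 1" "\<And>t. t \<ge> T1 \<Longrightarrow> Y t \<le> hi \<and> (\<forall>q. hi < q \<and> q < 0 \<longrightarrow> k t q < B)"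
      using upper_level_eventually[OF hi B(1,3)] by blast
    obtain T2 where T2: "T2 \<ge> 1" "\<And>t q. t \<ge> T2 \<Longrightarrow> Y t < q \<Longrightarrow> q < 0 \<Longrightarrow> \<kappa> - \<epsilon> \<le> k t q"
      using lower_level_eventually[of "\<kappa> - \<epsilon>"] \<epsilon> by auto
    have "Y t \<le> hi \<and> (\<forall>q. hi < q \<and> q < 0 \<longrightarrow> \<bar>\<zeta> t q - phi g q\<bar> \<le> K * \<epsilon>)" if t: "t \<ge> max T1 T2" for t
    proof (intro conjI allI impI)
      show Y: "Y t \<le> hi" using T1 t by simp
      fix q assume q: "hi < q \<and> q < 0"
      show "\<bar>\<zeta> t q - phi g q\<bar> \<le> K * \<epsilon>"
        unfolding K_def
      proof (rule zeta_near_phi[OF m])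
        show "t > 0" "Y t < q" "q < 0" using t T1(1) Y q by auto
        show "\<kappa> - \<epsilon> \<le> k t q" using T2(2)[of t q] t Y q by simp
        have "k t q < B" using T1(2)[of t] t q by simp
        then show "k t q \<le> \<kappa> + \<epsilon>" using B(2) by simp
        show "\<kappa> - 1 / h 0 \<le> q" if "h 0 > 0" using l[OF that] q by simp
      qed
    qed
    then show ?thesis using T1(1) by (intro exI[of _ "max T1 T2"]) auto
  qed
  show ?thesis
  proof (cases "ereal D \<le> D_hk g")
    case True
    have P: "profile g D q = phi g q" if "-D < q" "q < 0" for q
      using that True by (simp add: profile_def)
    have D: "\<kappa> - 1 / h 0 \<le> -D" if "h 0 > 0"
      using True that by (simp add: D_hk_def \<kappa>_def)
    show ?thesis
    proof (rule L1_convergence[OF _ _ K])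
      show "mono_on {-D<..<0} (profile g D)"
        using P D by (auto intro!: mono_onI phi_mono)
      show "0 \<le> profile g D q \<and> profile g D q \<le> 1" if q: "-D < q" "q < 0" for q
        using phi_state[of q] P[OF q] q D by force
      fix \<epsilon> :: real assume \<epsilon>: "\<epsilon> > 0"
      define hi where "hi = min (- D + \<epsilon>) (- D / 2)"
      have hi: "-D < hi" "hi < 0" "hi \<le> -D + \<epsilon>" using \<epsilon> D_pos by (auto simp: hi_def min_def)
      have "\<exists>T\<ge>1. \<forall>t\<ge>T. Y t \<le> hi \<and> (\<forall>q. hi < q \<and> q < 0 \<longrightarrow> \<bar>\<zeta> t q - phi g q\<bar> \<le> K * \<epsilon>)"
      proof (rule near[OF hi(1,2) \<epsilon>])
        show "h 0 = 0 \<or> h 0 > 0 \<and> \<kappa> < E 0 \<and> \<kappa> < E hi"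
        proof (cases "h 0 = 0")
          case False
          then have h0: "h 0 > 0" using h_0_nonneg by simp
          have "\<kappa> \<le> E (-D)" using D[OF h0] by (simp add: E_left)
          moreover have "E (-D) < E hi" "E (-D) < E 0" using hi D_pos h0 by (auto intro: E_strict_mono)
          ultimately show ?thesis using h0 by simp
        qed simp
        show "\<kappa> - 1 / h 0 \<le> hi" if "h 0 > 0" using D[OF that] hi by simp
      qed
      then obtain T where T: "T \<ge> 1" "\<And>t q. t \<ge> T \<Longrightarrow> hi < q \<Longrightarrow> q < 0 \<Longrightarrow> \<bar>\<zeta> t q - phi g q\<bar> \<le> K * \<epsilon>"
        by blast
      show "\<exists>T\<ge>1. \<forall>t\<ge>T. \<forall>q. -D < q \<and> q < 0 \<and> \<epsilon> < \<bar>q - (- D)\<bar> \<longrightarrow> \<bar>\<zeta> t q - profile g D q\<bar> \<le> K * \<epsilon>"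
        using T P hi by (intro exI[of _ T]) auto
    qed
  next
    case hk: False
    then have h0: "h 0 > 0" and D: "1 / h 0 - \<kappa> < D"
      by (auto simp: D_hk_def \<kappa>_def split: if_splits)
    have E0: "E (-D) < \<kappa>" using D by (simp add: E_left)
    show ?thesis
    proof (cases "D < D_ss g")
      case True
      then have EK: "\<kappa> < E 0" using D_ss_less_iff[OF h0 D_pos] psi_D_less_iff[OF h0] by simp
      have "continuous_on {-D..0} E" using E_cont[OF h0] by (rule continuous_on_subset) auto
      then obtain p where p: "-D \<le> p" "p \<le> 0" "E p = \<kappa>"
        using IVT'[of E "-D" \<kappa> 0] E0 EK D_pos by auto
      then have p': "-D < p" "p < 0" using E0 EK by (auto simp: less_le)
      have psi_p: "psi g (p + D) = 1 / (\<kappa> - p)"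
      proof -
        have "\<kappa> - p = 1 / psi g (p + D)" using p(3) by (simp add: E_def)
        then show ?thesis by simp
      qed
      have "h 0 < psi g (p + D)" using psi_strict_mono[OF h0, of 0 "p + D"] p' by (simp add: psi_def)
      then have "1 / psi g (p + D) < 1 / h 0" using h0 by (simp add: frac_less2)
      then have low: "\<kappa> - 1 / h 0 < p" using p(3) by (simp add: E_def)
      have front: "profile_front g D = p"
        unfolding profile_front_def
      proof (rule the_equality)
        have "h (phi g p) = 1 / (\<kappa> - p)" by (rule phi_state) (use p low in auto)
        moreover have "- D_hk g < ereal p" using low h0 by (simp add: D_hk_def \<kappa>_def)
        ultimately show "- D_hk g < ereal p \<and> p < 0 \<and> h (phi g p) = psi g (p + D)"
          using p' psi_p by simp
      next
        fix q assume q: "- D_hk g < ereal q \<and> q < 0 \<and> h (phi g q) = psi g (q + D)"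
        then have lq: "\<kappa> - 1 / h 0 < q" using h0 by (simp add: D_hk_def \<kappa>_def)
        have "h (phi g q) = 1 / (\<kappa> - q)" by (rule phi_state) (use q lq in auto)
        then have "psi g (q + D) = 1 / (\<kappa> - q)" using q by simp
        then have "E q = \<kappa>" by (simp add: E_def)
        then show "q = p"
          using E_strict_mono[OF h0, of q p] E_strict_mono[OF h0, of p q] p lq D
          by (cases q p rule: linorder_cases) auto
      qed
      have P: "profile g D q = (if q \<le> p then 0 else phi g q)" if "-D < q" "q < 0" for q
        using that True hk front by (simp add: profile_def)
      have phi01: "0 \<le> phi g q \<and> phi g q \<le> 1" if "p < q" "q < 0" for q
        using phi_state[of q] that low by force
      show ?thesis
      proof (rule L1_convergence[OF _ _ K])
        show "mono_on {-D<..<0} (profile g D)"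
          using P phi01 low by (auto intro!: mono_onI phi_mono)
        show "0 \<le> profile g D q \<and> profile g D q \<le> 1" if q: "-D < q" "q < 0" for q
          using phi01[of q] P[OF q] q by auto
        fix \<epsilon> :: real assume \<epsilon>: "\<epsilon> > 0"
        define hi where "hi = min (p + \<epsilon>) (p / 2)"
        have hi: "p < hi" "hi < 0" "hi \<le> p + \<epsilon>" using \<epsilon> p' by (auto simp: hi_def min_def)
        define lo where "lo = max (p - \<epsilon>) ((p - D) / 2)"
        have lo: "-D < lo" "lo < p" "p - \<epsilon> \<le> lo" using \<epsilon> p' by (auto simp: lo_def max_def)
        have "\<exists>T\<ge>1. \<forall>t\<ge>T. Y t \<le> hi \<and> (\<forall>q. hi < q \<and> q < 0 \<longrightarrow> \<bar>\<zeta> t q - phi g q\<bar> \<le> K * \<epsilon>)"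
          using h0 EK E_strict_mono[OF h0 p(1) hi(1)] p p' hi low by (intro near[OF _ hi(2) \<epsilon>]) auto
        then obtain T1 where T1: "T1 \<ge> 1" "\<And>t q. t \<ge> T1 \<Longrightarrow> hi < q \<Longrightarrow> q < 0 \<Longrightarrow> \<bar>\<zeta> t q - phi g q\<bar> \<le> K * \<epsilon>"
          by blast
        have "E lo < \<kappa>" using E_strict_mono[OF h0 _ lo(2)] lo p by simp
        then obtain T2 where T2: "T2 \<ge> 1" "\<And>t. t \<ge> T2 \<Longrightarrow> lo \<le> Y t"
          using front_eventually_ge[OF h0 lo(1)] lo p' by auto
        have "\<bar>\<zeta> t q - profile g D q\<bar> \<le> K * \<epsilon>"
          if t: "t \<ge> max T1 T2" and q: "-D < q" "q < 0" "\<epsilon> < \<bar>q - p\<bar>" for t q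
        proof (cases "q \<le> p")
          case True
          then have "q < Y t" using q lo T2(2)[of t] t by auto
          then have "\<zeta> t q = 0" using zeta_left[of t q] q t T1 by simp
          then show ?thesis using True P[OF q(1,2)] K \<epsilon> by simp
        next
          case False
          then show ?thesis using P[OF q(1,2)] T1(2)[of t q] t q hi by auto
        qed
        then show "\<exists>T\<ge>1. \<forall>t\<ge>T. \<forall>q. -D < q \<and> q < 0 \<and> \<epsilon> < \<bar>q - p\<bar> \<longrightarrow> \<bar>\<zeta> t q - profile g D q\<bar> \<le> K * \<epsilon>"
          using T1(1) by (intro exI[of _ "max T1 T2"]) auto
      qed
    next
      case False
      then have EK: "E 0 \<le> \<kappa>" using D_ss_less_iff[OF h0 D_pos] psi_D_less_iff[OF h0] by auto
      have P: "profile g D q = 0" if "-D < q" "q < 0" for q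
        using that False hk by (simp add: profile_def)
      show ?thesis
      proof (rule L1_convergence[OF _ _ K])
        show "mono_on {-D<..<0} (profile g D)" using P by (auto intro!: mono_onI)
        show "0 \<le> profile g D q \<and> profile g D q \<le> 1" if "-D < q" "q < 0" for q
          using P[OF that] by simp
        fix \<epsilon> :: real assume \<epsilon>: "\<epsilon> > 0"
        define lo where "lo = max (- \<epsilon>) (- D / 2)"
        have lo: "-D < lo" "lo < 0" "- \<epsilon> \<le> lo" using \<epsilon> D_pos by (auto simp: lo_def max_def)
        have "E lo < \<kappa>" using E_strict_mono[OF h0 _ lo(2)] lo EK by simp
        then obtain T where T: "T \<ge> 1" "\<And>t. t \<ge> T \<Longrightarrow> lo \<le> Y t"
          using front_eventually_ge[OF h0 lo(1,2)] by auto
        have "\<bar>\<zeta> t q - profile g D q\<bar> \<le> K * \<epsilon>"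
          if t: "t \<ge> T" and q: "-D < q" "q < 0" "\<epsilon> < \<bar>q - 0\<bar>" for t q
        proof -
          have "q < Y t" using q lo T(2)[OF t] by auto
          then have "\<zeta> t q = 0" using zeta_left[of t q] q t T by simp
          then show ?thesis using P[OF q(1,2)] K \<epsilon> by simp
        qed
        then show "\<exists>T\<ge>1. \<forall>t\<ge>T. \<forall>q. -D < q \<and> q < 0 \<and> \<epsilon> < \<bar>q - 0\<bar> \<longrightarrow> \<bar>\<zeta> t q - profile g D q\<bar> \<le> K * \<epsilon>"
          using T(1) by (intro exI[of _ T]) auto
      qed
    qed
  qed
qed

end

theorem theorem4p1:
  fixes g :: "real \<Rightarrow> real" and z :: "real \<Rightarrow> real \<Rightarrow> real" and D u\<^sub>a :: real
  assumes "erosion_function g"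
    and "total_variation (z 0) UNIV < \<infinity>"
    and "integrable lborel (\<lambda>u. z 0 u - 1)"
    and "(z 0 \<longlongrightarrow> 1) at_top" and "(z 0 \<longlongrightarrow> 1) at_bot"
    and "\<And>u. 0 \<le> z 0 u \<and> z 0 u \<le> 1"
    and "\<And>u. u < u\<^sub>a \<Longrightarrow> z 0 u = 1"
    and "mono_on {u\<^sub>a..} (z 0)"
    and "D = (LINT u|lborel. \<bar>z 0 u - 1\<bar>)" and "D > 0"
    and "weak_solution g D z"
    and "smooth_law g D z" and "front_law g D z" and "front_lax g D z"
    and "stationary_left_jump D z" and "single_shock D z"
    and "regular_right_of_front D z" and "variation_at_most_2 D z"
  shows "\<exists>C. \<forall>\<epsilon>>0. \<exists>T\<ge>0. \<forall>t\<ge>T.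
           set_integrable lborel {-D<..<0} (\<lambda>q. zeta D z t q - profile g D q) \<and>
           (LINT q:{-D<..<0}|lborel. \<bar>zeta D z t q - profile g D q\<bar>) \<le> C * \<epsilon>"
proof -
  obtain g1 g2 where "\<And>z. z \<ge> 0 \<Longrightarrow> (g has_real_derivative g1 z) (at z within {0..})"
    "\<And>z. z \<ge> 0 \<Longrightarrow> (g1 has_real_derivative g2 z) (at z within {0..})"
    "\<And>z. z \<ge> 0 \<Longrightarrow> g2 z < 0" "continuous_on {0..} g2" "g 1 = 0" "g 0 \<ge> 0"
    using assms(1) unfolding erosion_function_def by blast
  then interpret flow g g1 g2 D z
    using assms by unfold_locales auto
  show ?thesis by (rule profile_convergence)
qed

end
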